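(* Let $k,s$ be integers with $1\leq s\leq k$. Then \[ \sum_{\substack{n_1,\dots,n_k\geq 0 \\ m_1,\dots,m_{k-1}\geq 0}} \frac{q^{n_k^2+\sum_{i=s}^k n_i+\sum_{i=s}^{k-1} m_i}}{(q)_{n_1}} \prod_{i=1}^{k-1} q^{n_i^2-n_im_i+m_i^2} {n_i \brack n_{i+1}} {n_i-n_{i+1}+m_{i+1}+\delta_{i,s-1} \brack m_i} =\frac{(q^{3k+2};q^{3k+2})_{\infty}^2}{(q;q)_{\infty}^2} \sum_{i=1}^s q^{s-i} \,\theta(q^i,q^i,q^{2i};q^{3k+2}), \] where $m_k:=2n_k$.
   Context: Identities are between formal power series in $q$. For $n\in\mathbb{Z}$, $(a)_n=(a;q)_n:=(a;q)_\infty/(aq^n;q)_\infty$ with $(a;q)_\infty=\prod_{i\geq0}(1-aq^i)$; in particular $1/(q)_n=0$ for $n<0$. $\theta(a;q):=(a;q)_\infty(q/a;q)_\infty$ and $\theta(a_1,\dots,a_j;q):=\theta(a_1;q)\cdots\theta(a_j;q)$. For $n,m\in\mathbb{Z}$, ${n\brack m}=\frac{(q)_n}{(q)_m(q)_{n-m}}$ if $0\leq m\leq n$ and $0$ otherwise. $\delta_{i,j}$ is the Kronecker delta. Empty sums are $0$, empty products are $1$. *)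

theory Defs
  imports
    "HOL-Analysis.Analysis"
    "HOL-Computational_Algebra.Computational_Algebra"
begin

(* All identities live in the power series ring over a field. The library makes it a metric
   space whose topology is the q-adic one, so infinite products (prodinf) and infinite sums
   (has_sum) are limits in that topology. *)

definition qpoch_inf :: "'a::field fps \<Rightarrow> 'a fps \<Rightarrow> 'a fps" where
  "qpoch_inf a q = (\<Prod>i. 1 - a * q ^ i)"

(* Restricted to indices n >= 0, since a q^n need not be a power series for n < 0. The integer
   q-binomial coefficients below use only indices >= 0. *)
definition qpoch :: "'a::field fps \<Rightarrow> 'a fps \<Rightarrow> nat \<Rightarrow> 'a fps" where
  "qpoch a q n = qpoch_inf a q / qpoch_inf (a * q ^ n) q"

definition qbinom :: "'a::field fps \<Rightarrow> int \<Rightarrow> int \<Rightarrow> 'a fps" where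
  "qbinom q n m =
     (if 0 \<le> m \<and> m \<le> n
      then qpoch q q (nat n) / (qpoch q q (nat m) * qpoch q q (nat (n - m)))
      else 0)"

(* The quotient q / a is division of power series; it is exact whenever a divides q, in
   particular if a and q are powers fps_X ^ i and fps_X ^ p with i <= p. *)
definition theta :: "'a::field fps \<Rightarrow> 'a fps \<Rightarrow> 'a fps" where
  "theta a q = qpoch_inf a q * qpoch_inf (q / a) q"

definition thetas :: "'a::field fps list \<Rightarrow> 'a fps \<Rightarrow> 'a fps" where
  "thetas as q = (\<Prod>a\<leftarrow>as. theta a q)"

end

theory Submission
  imports Defs
begin

text \<open>
  Summing out the $m_i$ from the inside by a $q$-Vandermonde argument turns the multisum, up to
  powers of $(q)_\infty$, into a $k$-fold iteration of the $A_2$ Bailey step with weight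
  $q^{n^2-nt+t^2}/((q)_{N-n}(q)_{M-t})$, with an additional $q^{n+t}$ in the steps $i \geq s$,
  applied to a product in closed form. This product is itself a sum over the $A_2$ root lattice of
  the kernel $(q)_{N+M}/\prod_i (q)_{N-\kappa_i}(q)_{M+\kappa_i}$ with an antisymmetric Gaussian
  coefficient of modulus 2, and by the $A_2$ Bailey lemma a step multiplies the coefficient of
  $\kappa$ by $q^{|\kappa|^2/2}$, that is, raises the modulus by 3. At the transition from the
  steps with $q^{n+t}$ to those without, $1 = (1 - q^{n+t+1}) + q \cdot q^{n+t}$ splits off one
  lattice sum with kernel shifted by the Weyl vector; every later step raises its linear exponent by
  one, and this produces the sum over $i$. For $N, M \to \infty$ each lattice sum becomes a product of
  theta functions by the Macdonald identity for $A_2^{(1)}$, which follows from three Jacobi triple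
  products and the pentagonal number theorem.

  The finite identities live in a field of characteristic 0 with \<open>q\<close> nonzero and not a root of unity;
  they are transferred to power series through the field of Laurent series. The reciprocal
  \<open>iq n\<close> of $(q)_n$ vanishes for negative \<open>n\<close>, whereas \<open>qfac n\<close> is then $1$.
\<close>

text \<open>The closed product that starts the chain is q^(2NM)/((q)_N (q)_M (q)_(N+M)). Its lattice
  sum is evaluated through \<open>dsum\<close>: after multiplication by (q)_(N+M)^2 the kernel is a
  product of three q-binomials with upper entry N + M, whose Gaussian weights account for modulus 3,
  against a coefficient of modulus -1; this is where 2 = 3 - 1 comes from. That coefficient is set
  to 0 off the lattice, so the three variables can be summed separately, and its quasi-periodicity
  acts on one variable at a time. Antisymmetry then annihilates enough terms to leave a first-order
  recurrence in N. The negative exponents met on the way are the reason for working in a field and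
  not among power series. All exponents are normalised to vanish at the Weyl vector: the modulus
  multiplies (|kappa|^2 - 2)/6, and the linear part is a - c - 2. In the limit the kernel tends to
  (q)_inf^(-5) and the prefactors of the multisum to (q)_inf^(-3); the quotient is the (q)_inf^(-2)
  of the theorem.\<close>

locale qfield =
  fixes q :: "'a::field_char_0"
  assumes q_nonzero [simp]: "q \<noteq> 0" and q_not_root: "n > 0 \<Longrightarrow> q ^ n \<noteq> 1"
begin

section \<open>Reciprocal q-factorials and q-Chu-Vandermonde sums\<close>

lemma powi_sum: "q powi a * q powi b = q powi (a + b)"
  by (simp add: power_int_add)

lemma powi_neq_1: "n > 0 \<Longrightarrow> q powi n \<noteq> 1"
  using q_not_root[of "nat n"] by (simp add: power_int_def)

definition qfac :: "int \<Rightarrow> 'a" where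
  "qfac n = (\<Prod>i\<in>{1..n}. 1 - q powi i)"

definition iq :: "int \<Rightarrow> 'a" where
  "iq n = (if n < 0 then 0 else inverse (qfac n))"

lemma qfac_nonzero [simp]: "qfac n \<noteq> 0"
  using powi_neq_1 by (force simp: qfac_def)

lemma qfac_nonpos [simp]: "n \<le> 0 \<Longrightarrow> qfac n = 1"
  by (simp add: qfac_def)

lemma qfac_rec: "n > 0 \<Longrightarrow> qfac n = (1 - q powi n) * qfac (n - 1)"
proof -
  assume "n > 0"
  then have "{1..n} = insert n {1..n - 1}" by auto
  then show ?thesis by (simp add: qfac_def)
qed

lemma iq_neg [simp]: "n < 0 \<Longrightarrow> iq n = 0"
  by (simp add: iq_def)

lemma iq_0 [simp]: "iq 0 = 1"
  by (simp add: iq_def)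

lemma iq_nonneg: "n \<ge> 0 \<Longrightarrow> iq n = inverse (qfac n)"
  by (simp add: iq_def)

text \<open>Holds for every integer, since 1 - q^0 = 0 matches the jump to 0 at negative arguments.
  Index shifts in sums over \<open>iq\<close> therefore need no case distinction.\<close>

lemma iq_rec: "iq (n - 1) = (1 - q powi n) * iq n"
proof (cases "n > 0")
  case True
  then have "1 - q powi n \<noteq> 0" using powi_neq_1[of n] by simp
  with True show ?thesis by (simp add: iq_nonneg qfac_rec[of n])
qed (auto simp: iq_def)

text \<open>The splitting 1 - XY = (1 - X) + X (1 - Y), applied to a single summand: below, 1 - X
  lowers the argument of one \<open>iq\<close> and 1 - Y shifts the summation index, while the
  hypothesis adjusts the power of q to that shift.\<close>

lemma pascal_step:
  fixes X Y E E' P Z :: 'a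
  assumes "P * E' = X * E"
  shows "(1 - X * Y) * (E * Z) = E * ((1 - X) * Z) + P * (E' * ((1 - Y) * Z))"
proof -
  have "P * (E' * ((1 - Y) * Z)) = X * E * ((1 - Y) * Z)"
    using assms by (metis mult.assoc)
  then show ?thesis by (simp add: algebra_simps)
qed

lemma sum_powi_iq_iq:
  assumes "finite J" "{0..n} \<subseteq> J"
  shows "(\<Sum>j\<in>J. q powi (j * (j + c)) * iq (n - j) * iq j * iq (j + c)) = iq n * iq (n + c)"
proof -
  have "(\<Sum>j\<in>{0..n}. q powi (j * (j + c)) * iq (n - j) * iq j * iq (j + c)) = iq n * iq (n + c)"
  proof (cases "n \<ge> 0")
    case True
    then show ?thesis
    proof (induction n arbitrary: c rule: int_ge_induct)
      case base
      show ?case by simp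
    next
      case (step n)
      let ?t = "\<lambda>n c j. q powi (j * (j + c)) * iq (n - j) * iq j * iq (j + c)"
      have nz: "1 - q powi (n + 1) \<noteq> 0" using powi_neq_1[of "n + 1"] step by simp
      have "(1 - q powi (n + 1)) * ?t (n + 1) c j
          = ?t n c j + q powi (n + 1 + c) * ?t n (c + 1) (j - 1)" for j
      proof -
        have i: "n - (j - 1) = n + 1 - j" "j - 1 + (c + 1) = j + c"
          by simp_all
        have e1: "iq (n - j) = (1 - q powi (n + 1 - j)) * iq (n + 1 - j)"
          using iq_rec[of "n + 1 - j"] by (simp add: algebra_simps)
        have e2: "q powi (n + 1 + c) * q powi ((j - 1) * (j + c))
            = q powi (n + 1 - j) * q powi (j * (j + c))"
          unfolding powi_sum by (rule arg_cong[of _ _ "\<lambda>x. q powi x"]) (simp add: algebra_simps)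
        have e3: "q powi (n + 1) = q powi (n + 1 - j) * q powi j"
          by (simp add: powi_sum)
        show ?thesis
          unfolding i e1 iq_rec[of j] e3
          using pascal_step[OF e2, of "q powi j" "iq (n + 1 - j) * iq j * iq (j + c)"]
          by (simp only: mult_ac)
      qed
      then have "(1 - q powi (n + 1)) * (\<Sum>j\<in>{0..n + 1}. ?t (n + 1) c j)
        = (\<Sum>j\<in>{0..n + 1}. ?t n c j) + q powi (n + 1 + c) * (\<Sum>j\<in>{0..n + 1}. ?t n (c + 1) (j - 1))"
        by (simp add: sum_distrib_left sum.distrib)
      also have "(\<Sum>j\<in>{0..n + 1}. ?t n c j) = (\<Sum>j\<in>{0..n}. ?t n c j)"
        by (rule sum.mono_neutral_right) auto
      also have "(\<Sum>j\<in>{0..n + 1}. ?t n (c + 1) (j - 1)) = (\<Sum>j\<in>{1..n + 1}. ?t n (c + 1) (j - 1))"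
        by (rule sum.mono_neutral_right) auto
      also have "\<dots> = (\<Sum>j\<in>{0..n}. ?t n (c + 1) j)"
        by (rule sum.reindex_bij_witness[of _ "\<lambda>j. j + 1" "\<lambda>j. j - 1"]) auto
      also have "(\<Sum>j\<in>{0..n}. ?t n c j) = iq n * iq (n + c)" by (rule step.IH)
      also have "(\<Sum>j\<in>{0..n}. ?t n (c + 1) j) = iq n * iq (n + (c + 1))" by (rule step.IH)
      also have "iq (n + c) = (1 - q powi (n + 1 + c)) * iq (n + 1 + c)"
        using iq_rec[of "n + 1 + c"] by (simp add: algebra_simps)
      also have "iq n = (1 - q powi (n + 1)) * iq (n + 1)"
        using iq_rec[of "n + 1"] by (simp add: algebra_simps)
      finally have "(1 - q powi (n + 1)) * (\<Sum>j\<in>{0..n + 1}. ?t (n + 1) c j)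
          = (1 - q powi (n + 1)) * (iq (n + 1) * iq (n + 1 + c))"
        by (simp add: algebra_simps)
      then show ?case using nz by simp
    qed
  qed simp
  moreover have "(\<Sum>j\<in>J. q powi (j * (j + c)) * iq (n - j) * iq j * iq (j + c))
      = (\<Sum>j\<in>{0..n}. q powi (j * (j + c)) * iq (n - j) * iq j * iq (j + c))"
    by (rule sum.mono_neutral_right) (use assms in auto)
  ultimately show ?thesis by simp
qed

lemma sum_shifted_iq:
  assumes "finite J" "{A..N} \<subseteq> J"
  shows "(\<Sum>r\<in>J. q powi ((r - A) * (r - B)) * iq (N - r) * iq (r - A) * iq (r - B))
    = iq (N - A) * iq (N - B)"
proof -
  have "(\<Sum>r\<in>J. q powi ((r - A) * (r - B)) * iq (N - r) * iq (r - A) * iq (r - B))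
    = (\<Sum>j\<in>(\<lambda>r. r - A) ` J. q powi (j * (j + (A - B))) * iq (N - A - j) * iq j * iq (j + (A - B)))"
    by (subst sum.reindex) (auto simp: inj_on_def)
  also have "\<dots> = iq (N - A) * iq (N - A + (A - B))"
  proof (rule sum_powi_iq_iq)
    have "j \<in> (\<lambda>r. r - A) ` J" if "j \<in> {0..N - A}" for j
      by (rule image_eqI[of _ _ "j + A"]) (use that assms in auto)
    then show "{0..N - A} \<subseteq> (\<lambda>r. r - A) ` J" by blast
  qed (use assms in simp)
  finally show ?thesis by simp
qed

text \<open>Same induction, where the shifted part now also lowers d. The value 1 of
  \<open>qfac\<close> at negative arguments does no harm, because then one of the \<open>iq\<close>
  on the right is 0.\<close>

lemma q_vandermonde_iq:
  assumes "finite J" "{0..n} \<subseteq> J"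
  shows "(\<Sum>j\<in>J. q powi (j * (j + c)) * iq j * iq (j + c) * iq (n - j) * iq (d - j))
    = qfac (n + d + c) * iq n * iq (n + c) * iq d * iq (d + c)"
proof -
  have "(\<Sum>j\<in>{0..n}. q powi (j * (j + c)) * iq j * iq (j + c) * iq (n - j) * iq (d - j))
    = qfac (n + d + c) * iq n * iq (n + c) * iq d * iq (d + c)"
  proof (cases "n \<ge> 0")
    case True
    then show ?thesis
    proof (induction n arbitrary: c d rule: int_ge_induct)
      case base
      show ?case
        by (cases "d < 0 \<or> c < 0"; cases "d + c < 0") (auto simp: iq_nonneg)
    next
      case (step n)
      let ?t = "\<lambda>n d c j. q powi (j * (j + c)) * iq j * iq (j + c) * iq (n - j) * iq (d - j)"
      have nz: "1 - q powi (n + 1) \<noteq> 0" using powi_neq_1[of "n + 1"] step by simp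
      have "(1 - q powi (n + 1)) * ?t (n + 1) d c j
          = ?t n d c j + q powi (n + 1 + c) * ?t n (d - 1) (c + 1) (j - 1)" for j
      proof -
        have i: "n - (j - 1) = n + 1 - j" "j - 1 + (c + 1) = j + c" "d - 1 - (j - 1) = d - j"
          by simp_all
        have e1: "iq (n - j) = (1 - q powi (n + 1 - j)) * iq (n + 1 - j)"
          using iq_rec[of "n + 1 - j"] by (simp add: algebra_simps)
        have e2: "q powi (n + 1 + c) * q powi ((j - 1) * (j + c))
            = q powi (n + 1 - j) * q powi (j * (j + c))"
          unfolding powi_sum by (rule arg_cong[of _ _ "\<lambda>x. q powi x"]) (simp add: algebra_simps)
        have e3: "q powi (n + 1) = q powi (n + 1 - j) * q powi j"
          by (simp add: powi_sum)
        show ?thesis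
          unfolding i e1 iq_rec[of j] e3
          using pascal_step[OF e2, of "q powi j" "iq j * iq (j + c) * iq (n + 1 - j) * iq (d - j)"]
          by (simp only: mult_ac)
      qed
      then have "(1 - q powi (n + 1)) * (\<Sum>j\<in>{0..n + 1}. ?t (n + 1) d c j)
        = (\<Sum>j\<in>{0..n + 1}. ?t n d c j)
          + q powi (n + 1 + c) * (\<Sum>j\<in>{0..n + 1}. ?t n (d - 1) (c + 1) (j - 1))"
        by (simp add: sum_distrib_left sum.distrib)
      also have "(\<Sum>j\<in>{0..n + 1}. ?t n d c j) = (\<Sum>j\<in>{0..n}. ?t n d c j)"
        by (rule sum.mono_neutral_right) auto
      also have "(\<Sum>j\<in>{0..n + 1}. ?t n (d - 1) (c + 1) (j - 1))
          = (\<Sum>j\<in>{1..n + 1}. ?t n (d - 1) (c + 1) (j - 1))"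
        by (rule sum.mono_neutral_right) auto
      also have "\<dots> = (\<Sum>j\<in>{0..n}. ?t n (d - 1) (c + 1) j)"
        by (rule sum.reindex_bij_witness[of _ "\<lambda>j. j + 1" "\<lambda>j. j - 1"]) auto
      also have "(\<Sum>j\<in>{0..n}. ?t n d c j) = qfac (n + d + c) * iq n * iq (n + c) * iq d * iq (d + c)"
        by (rule step.IH)
      also have "(\<Sum>j\<in>{0..n}. ?t n (d - 1) (c + 1) j)
          = qfac (n + (d - 1) + (c + 1)) * iq n * iq (n + (c + 1)) * iq (d - 1) * iq (d - 1 + (c + 1))"
        by (rule step.IH)
      also have "iq (n + c) = (1 - q powi (n + 1 + c)) * iq (n + 1 + c)"
        using iq_rec[of "n + 1 + c"] by (simp add: algebra_simps)
      also have "iq n = (1 - q powi (n + 1)) * iq (n + 1)"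
        using iq_rec[of "n + 1"] by (simp add: algebra_simps)
      also have "iq (d - 1) = (1 - q powi d) * iq d"
        by (rule iq_rec)
      finally have A: "(1 - q powi (n + 1)) * (\<Sum>j\<in>{0..n + 1}. ?t (n + 1) d c j)
          = (1 - q powi (n + 1)) * (qfac (n + d + c) * iq (n + 1) * iq (n + 1 + c) * iq d * iq (d + c)
              * ((1 - q powi (n + 1 + c)) + q powi (n + 1 + c) * (1 - q powi d)))"
        by (simp add: algebra_simps)
      have B: "(1 - q powi (n + 1 + c)) + q powi (n + 1 + c) * (1 - q powi d)
          = 1 - q powi (n + 1 + d + c)"
        by (simp add: algebra_simps powi_sum)
      \<comment> \<open>The recursion of \<open>qfac\<close> fails at arguments below 1, but there d
        or d + c is negative, or n + 1 + c is, and both sides are 0.\<close>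
      have C: "qfac (n + d + c) * (1 - q powi (n + 1 + d + c)) * (iq (n + 1 + c) * iq d * iq (d + c))
          = qfac (n + 1 + d + c) * (iq (n + 1 + c) * iq d * iq (d + c))"
      proof (cases "n + 1 + d + c > 0")
        case True
        have e: "n + 1 + d + c - 1 = n + d + c" by simp
        show ?thesis unfolding qfac_rec[OF True] e by (simp only: mult_ac)
      next
        case False
        then have "n + 1 + c < 0 \<or> d < 0 \<or> d + c < 0" using step by linarith
        then show ?thesis by auto
      qed
      have "(1 - q powi (n + 1)) * (\<Sum>j\<in>{0..n + 1}. ?t (n + 1) d c j)
          = (1 - q powi (n + 1)) * (iq (n + 1) *
            (qfac (n + d + c) * (1 - q powi (n + 1 + d + c)) * (iq (n + 1 + c) * iq d * iq (d + c))))"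
        unfolding A B by (simp only: mult_ac)
      also have "\<dots> = (1 - q powi (n + 1)) * (qfac (n + 1 + d + c) * iq (n + 1) * iq (n + 1 + c) * iq d * iq (d + c))"
        unfolding C by (simp only: mult_ac)
      finally have "(1 - q powi (n + 1)) * (\<Sum>j\<in>{0..n + 1}. ?t (n + 1) d c j)
          = (1 - q powi (n + 1)) * (qfac (n + 1 + d + c) * iq (n + 1) * iq (n + 1 + c) * iq d * iq (d + c))" .
      then show ?case using nz by simp
    qed
  qed simp
  moreover have "(\<Sum>j\<in>J. q powi (j * (j + c)) * iq j * iq (j + c) * iq (n - j) * iq (d - j))
      = (\<Sum>j\<in>{0..n}. q powi (j * (j + c)) * iq j * iq (j + c) * iq (n - j) * iq (d - j))"
    by (rule sum.mono_neutral_right) (use assms in auto)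
  ultimately show ?thesis by simp
qed

lemma q_vandermonde_shifted:
  assumes "finite J" "{A..C} \<subseteq> J"
  shows "(\<Sum>u\<in>J. q powi ((u - A) * (u - B)) * iq (u - A) * iq (u - B) * iq (C - u) * iq (D - u))
    = qfac (C + D - A - B) * iq (C - A) * iq (C - B) * iq (D - A) * iq (D - B)"
proof -
  have "(\<Sum>u\<in>J. q powi ((u - A) * (u - B)) * iq (u - A) * iq (u - B) * iq (C - u) * iq (D - u))
    = (\<Sum>j\<in>(\<lambda>u. u - A) ` J. q powi (j * (j + (A - B))) * iq j * iq (j + (A - B))
        * iq (C - A - j) * iq (D - A - j))"
    by (subst sum.reindex) (auto simp: inj_on_def)
  also have "\<dots> = qfac (C - A + (D - A) + (A - B)) * iq (C - A) * iq (C - A + (A - B))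
      * iq (D - A) * iq (D - A + (A - B))"
  proof (rule q_vandermonde_iq)
    have "j \<in> (\<lambda>u. u - A) ` J" if "j \<in> {0..C - A}" for j
      by (rule image_eqI[of _ _ "j + A"]) (use that assms in auto)
    then show "{0..C - A} \<subseteq> (\<lambda>u. u - A) ` J" by blast
  qed (use assms in simp)
  finally show ?thesis by (simp add: algebra_simps)
qed

text \<open>\<open>sum_powi_iq_iq\<close> read from right to left, with j = u + a - w. Its use: if u
  + a and u + b are free of u, then only the factor \<open>iq (w - u)\<close> and the power of q
  still involve u.\<close>

lemma iq_iq_expand:
  assumes "finite J" "{u..u + a} \<subseteq> J"
  shows "iq a * iq b = (\<Sum>w\<in>J. q powi ((w - u - a) * (w - u - b)) * iq (w - u)
      * iq (u + a - w) * iq (u + b - w))"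
proof -
  have "(\<Sum>w\<in>J. q powi ((w - u - a) * (w - u - b)) * iq (w - u) * iq (u + a - w) * iq (u + b - w))
     = (\<Sum>j\<in>(\<lambda>w. u + a - w) ` J. q powi (j * (j + (b - a))) * iq (a - j) * iq j * iq (j + (b - a)))"
    by (subst sum.reindex) (auto simp: inj_on_def algebra_simps)
  also have "\<dots> = iq a * iq (a + (b - a))"
  proof (rule sum_powi_iq_iq)
    have "j \<in> (\<lambda>w. u + a - w) ` J" if "j \<in> {0..a}" for j
      by (rule image_eqI[of _ _ "u + a - j"]) (use that assms in auto)
    then show "{0..a} \<subseteq> (\<lambda>w. u + a - w) ` J" by blast
  qed (use assms in simp)
  finally show ?thesis by simp
qed

section \<open>The A2 Bailey lemma\<close>

definition ker3 :: "int \<Rightarrow> int \<Rightarrow> int \<Rightarrow> int \<Rightarrow> int \<Rightarrow> 'a" where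
  "ker3 N M a b c = qfac (N + M) * iq (N - a) * iq (N - b) * iq (N - c)
     * iq (M + a) * iq (M + b) * iq (M + c)"

lemma sum_chain4:
  fixes h k g :: "int \<Rightarrow> int \<Rightarrow> 'a"
  assumes "finite J"
  shows "(\<Sum>r\<in>J. \<Sum>s\<in>J. \<Sum>u\<in>J. \<Sum>w\<in>J. c w * g w u * h w r * k w s)
    = (\<Sum>w\<in>J. c w * (\<Sum>u\<in>J. g w u) * (\<Sum>r\<in>J. h w r) * (\<Sum>s\<in>J. k w s))"
proof -
  have "(\<Sum>r\<in>J. \<Sum>s\<in>J. \<Sum>u\<in>J. \<Sum>w\<in>J. c w * g w u * h w r * k w s)
      = (\<Sum>r\<in>J. \<Sum>s\<in>J. \<Sum>w\<in>J. \<Sum>u\<in>J. c w * g w u * h w r * k w s)"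
    by (intro sum.cong refl sum.swap)
  also have "\<dots> = (\<Sum>r\<in>J. \<Sum>w\<in>J. \<Sum>s\<in>J. \<Sum>u\<in>J. c w * g w u * h w r * k w s)"
    by (intro sum.cong refl sum.swap)
  also have "\<dots> = (\<Sum>w\<in>J. \<Sum>r\<in>J. \<Sum>s\<in>J. \<Sum>u\<in>J. c w * g w u * h w r * k w s)"
    by (rule sum.swap)
  also have "\<dots> = (\<Sum>w\<in>J. c w * (\<Sum>u\<in>J. g w u) * (\<Sum>r\<in>J. h w r) * (\<Sum>s\<in>J. k w s))"
  proof (intro sum.cong refl)
    fix w
    have "(\<Sum>r\<in>J. \<Sum>s\<in>J. \<Sum>u\<in>J. c w * g w u * h w r * k w s)
      = (\<Sum>r\<in>J. \<Sum>s\<in>J. c w * (\<Sum>u\<in>J. g w u) * h w r * k w s)"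
      by (simp add: sum_distrib_left sum_distrib_right)
    also have "\<dots> = (\<Sum>r\<in>J. c w * (\<Sum>u\<in>J. g w u) * h w r * (\<Sum>s\<in>J. k w s))"
      by (simp only: sum_distrib_left)
    also have "\<dots> = c w * (\<Sum>u\<in>J. g w u) * (\<Sum>r\<in>J. h w r) * (\<Sum>s\<in>J. k w s)"
    proof -
      have "(\<Sum>r\<in>J. C * h w r * D) = C * (\<Sum>r\<in>J. h w r) * D" for C D
        by (simp only: sum_distrib_left sum_distrib_right)
      then show ?thesis .
    qed
    finally show "(\<Sum>r\<in>J. \<Sum>s\<in>J. \<Sum>u\<in>J. c w * g w u * h w r * k w s)
      = c w * (\<Sum>u\<in>J. g w u) * (\<Sum>r\<in>J. h w r) * (\<Sum>s\<in>J. k w s)" .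
  qed
  finally show ?thesis .
qed

text \<open>q-Vandermonde with A = b, B = c, C = N, D = M - a. Because a + b + c = 0, the argument
  of \<open>qfac\<close> is N + M, and D - A, D - B are M + c, M + b.\<close>

lemma ker3_expand:
  assumes "finite J" "{b..N} \<subseteq> J" "a + b + c = 0"
  shows "ker3 N M a b c = iq (N - a) * iq (M + a)
    * (\<Sum>u\<in>J. q powi ((u - b) * (u - c)) * iq (u - b) * iq (u - c) * iq (N - u) * iq (M - a - u))"
proof -
  have c: "c = - a - b" using assms by simp
  show ?thesis
    unfolding q_vandermonde_shifted[OF assms(1,2)] ker3_def
    by (simp add: c algebra_simps)
qed

text \<open>Reduction to sums in one variable. \<open>ker3_expand\<close> opens the kernel with a
  variable u, and \<open>iq_iq_expand\<close> introduces w so that r and s are linked to w instead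
  of u. The exponent then splits into parts containing w and only one of r, s, u; the three inner
  sums are instances of \<open>sum_shifted_iq\<close>, and the sum over w that remains is
  \<open>ker3_expand\<close> for the outer kernel. On the lattice a^2 - bc = a^2 + ab + b^2.\<close>

lemma a2_bailey_lemma:
  assumes "a + b + c = 0"
  shows "(\<Sum>r\<in>{0..N}. \<Sum>s\<in>{0..M}. q powi (r^2 - r * s + s^2) * iq (N - r) * iq (M - s) * ker3 r s a b c)
    = q powi (a^2 - b * c) * ker3 N M a b c"
proof -
  \<comment> \<open>Large enough for the range conditions of all the summations below, so that they
    can be interchanged over the one set J.\<close>
  define B where "B = \<bar>N\<bar> + \<bar>M\<bar> + \<bar>a\<bar> + \<bar>b\<bar>"
  define J where "J = {-B..B}"
  have J: "finite J" by (simp add: J_def)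
  have bnd: "-B \<le> a" "-B \<le> b" "a \<le> B" "N \<le> B" "M \<le> B" "0 \<le> B" "b \<le> B"
    unfolding B_def by linarith+
  have c: "c = - a - b" using assms by simp
  let ?F = "\<lambda>r s u w. q powi (w^2 + a * w + a^2)
      * (q powi ((u - b) * (u - c)) * iq (w - u) * iq (u - b) * iq (u - c))
      * (q powi ((r - w) * (r - a)) * iq (N - r) * iq (r - w) * iq (r - a))
      * (q powi ((s - (w + a)) * (s - - a)) * iq (M - s) * iq (s - (w + a)) * iq (s - - a))"
  \<comment> \<open>The arguments r - a, r - b, r - c add up to 3r and the other three to 3s, so a
    negative r or s forces a negative argument.\<close>
  have ker0: "ker3 r s a b c = 0" if "r < 0 \<or> s < 0" for r s
  proof -
    have "r - a < 0 \<or> r - b < 0 \<or> r - c < 0 \<or> s + a < 0 \<or> s + b < 0 \<or> s + c < 0"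
      using that assms by linarith
    then show ?thesis by (auto simp: ker3_def)
  qed
  have "(\<Sum>r\<in>{0..N}. \<Sum>s\<in>{0..M}. q powi (r^2 - r * s + s^2) * iq (N - r) * iq (M - s) * ker3 r s a b c)
     = (\<Sum>r\<in>{0..N}. \<Sum>s\<in>J. q powi (r^2 - r * s + s^2) * iq (N - r) * iq (M - s) * ker3 r s a b c)"
    by (intro sum.cong refl sum.mono_neutral_left J) (use bnd in \<open>auto simp: J_def ker0\<close>)
  also have "\<dots> = (\<Sum>r\<in>J. \<Sum>s\<in>J. q powi (r^2 - r * s + s^2) * iq (N - r) * iq (M - s) * ker3 r s a b c)"
    by (intro sum.mono_neutral_left J) (use bnd in \<open>auto simp: J_def ker0\<close>)
  also have "\<dots> = (\<Sum>r\<in>J. \<Sum>s\<in>J. \<Sum>u\<in>J. \<Sum>w\<in>J. ?F r s u w)"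
  proof (intro sum.cong refl)
    fix r s assume rs: "r \<in> J" "s \<in> J"
    have "{b..r} \<subseteq> J" using rs bnd by (auto simp: J_def)
    from ker3_expand[OF J this assms, of s]
    have "q powi (r^2 - r * s + s^2) * iq (N - r) * iq (M - s) * ker3 r s a b c
      = (\<Sum>u\<in>J. q powi (r^2 - r * s + s^2) * iq (N - r) * iq (M - s) * iq (r - a) * iq (s + a)
          * q powi ((u - b) * (u - c)) * iq (u - b) * iq (u - c) * (iq (r - u) * iq (s - a - u)))"
      by (simp add: sum_distrib_left sum_distrib_right mult_ac)
    also have "\<dots> = (\<Sum>u\<in>J. \<Sum>w\<in>J. ?F r s u w)"
    proof (intro sum.cong refl)
      fix u assume u: "u \<in> J"
      have "{u..u + (r - u)} \<subseteq> J" using rs u by (auto simp: J_def)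
      note E = iq_iq_expand[OF J this, of "s - a - u"]
      have X: "q powi (r^2 - r * s + s^2) * (q powi ((w - u - (r - u)) * (w - u - (s - a - u))) * z)
         = q powi (w^2 + a * w + a^2) * (q powi ((r - w) * (r - a)) * (q powi ((s - (w + a)) * (s - - a)) * z))"
         for w z
      proof -
        have "r^2 - r * s + s^2 + (w - u - (r - u)) * (w - u - (s - a - u))
          = w^2 + a * w + a^2 + (r - w) * (r - a) + (s - (w + a)) * (s - - a)"
          by (simp add: algebra_simps power2_eq_square)
        then show ?thesis
          by (simp only: mult.assoc[symmetric] powi_sum add.assoc)
      qed
      have eqs: "u + (r - u) - w = r - w" "u + (s - a - u) - w = s - (w + a)" "s - - a = s + a" for w
        by simp_all
      show "q powi (r^2 - r * s + s^2) * iq (N - r) * iq (M - s) * iq (r - a) * iq (s + a)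
          * q powi ((u - b) * (u - c)) * iq (u - b) * iq (u - c) * (iq (r - u) * iq (s - a - u))
        = (\<Sum>w\<in>J. ?F r s u w)"
        unfolding E sum_distrib_left
      proof (intro sum.cong refl)
        fix w
        show "q powi (r^2 - r * s + s^2) * iq (N - r) * iq (M - s) * iq (r - a) * iq (s + a)
          * q powi ((u - b) * (u - c)) * iq (u - b) * iq (u - c)
          * (q powi ((w - u - (r - u)) * (w - u - (s - a - u))) * iq (w - u) * iq (u + (r - u) - w)
             * iq (u + (s - a - u) - w))
          = ?F r s u w"
          using X[of w "iq (N - r) * iq (M - s) * iq (r - a) * iq (s + a)
          * q powi ((u - b) * (u - c)) * iq (u - b) * iq (u - c) * iq (w - u) * iq (r - w) * iq (s - (w + a))"]
          unfolding eqs by (simp only: mult_ac)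
      qed
    qed
    finally show "q powi (r^2 - r * s + s^2) * iq (N - r) * iq (M - s) * ker3 r s a b c
      = (\<Sum>u\<in>J. \<Sum>w\<in>J. ?F r s u w)" .
  qed
  also have "\<dots> = (\<Sum>w\<in>J. q powi (w^2 + a * w + a^2)
     * (\<Sum>u\<in>J. q powi ((u - b) * (u - c)) * iq (w - u) * iq (u - b) * iq (u - c))
     * (\<Sum>r\<in>J. q powi ((r - w) * (r - a)) * iq (N - r) * iq (r - w) * iq (r - a))
     * (\<Sum>s\<in>J. q powi ((s - (w + a)) * (s - - a)) * iq (M - s) * iq (s - (w + a)) * iq (s - - a)))"
    by (rule sum_chain4[OF J])
  also have "\<dots> = (\<Sum>w\<in>J. q powi (a^2 - b * c) * iq (N - a) * iq (M + a)
     * (q powi ((w - b) * (w - c)) * iq (w - b) * iq (w - c) * iq (N - w) * iq (M - a - w)))"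
  proof (intro sum.cong refl)
    fix w assume w: "w \<in> J"
    have S1: "(\<Sum>u\<in>J. q powi ((u - b) * (u - c)) * iq (w - u) * iq (u - b) * iq (u - c)) = iq (w - b) * iq (w - c)"
      by (rule sum_shifted_iq[OF J]) (use w bnd in \<open>auto simp: J_def\<close>)
    have S2: "(\<Sum>r\<in>J. q powi ((r - w) * (r - a)) * iq (N - r) * iq (r - w) * iq (r - a)) = iq (N - w) * iq (N - a)"
      by (rule sum_shifted_iq[OF J]) (use w bnd in \<open>auto simp: J_def\<close>)
    have S3: "(\<Sum>s\<in>J. q powi ((s - - a) * (s - (w + a))) * iq (M - s) * iq (s - - a) * iq (s - (w + a)))
      = iq (M - - a) * iq (M - (w + a))"
      by (rule sum_shifted_iq[OF J]) (use w bnd in \<open>auto simp: J_def\<close>)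
    have P: "q powi (w^2 + a * w + a^2) = q powi (a^2 - b * c) * q powi ((w - b) * (w - c))"
      unfolding powi_sum by (rule arg_cong[of _ _ "\<lambda>x. q powi x"])
        (simp add: c algebra_simps power2_eq_square)
    have S3': "(\<Sum>s\<in>J. q powi ((s - (w + a)) * (s - - a)) * iq (M - s) * iq (s - (w + a)) * iq (s - - a))
      = iq (M + a) * iq (M - a - w)"
      using S3 by (simp add: mult_ac algebra_simps)
    show "q powi (w^2 + a * w + a^2)
     * (\<Sum>u\<in>J. q powi ((u - b) * (u - c)) * iq (w - u) * iq (u - b) * iq (u - c))
     * (\<Sum>r\<in>J. q powi ((r - w) * (r - a)) * iq (N - r) * iq (r - w) * iq (r - a))
     * (\<Sum>s\<in>J. q powi ((s - (w + a)) * (s - - a)) * iq (M - s) * iq (s - (w + a)) * iq (s - - a))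
     = q powi (a^2 - b * c) * iq (N - a) * iq (M + a)
     * (q powi ((w - b) * (w - c)) * iq (w - b) * iq (w - c) * iq (N - w) * iq (M - a - w))"
      unfolding S1 S2 S3' P by (simp only: mult_ac)
  qed
  also have "\<dots> = q powi (a^2 - b * c) * ker3 N M a b c"
    unfolding sum_distrib_left[symmetric]
    by (subst ker3_expand[OF J _ assms]) (use bnd in \<open>auto simp: J_def mult_ac\<close>)
  finally show ?thesis .
qed

end

subsection \<open>The modulus 2 seed\<close>

lemma tri_step: "(y + 1) * y div 2 = y * (y - 1) div 2 + (y :: int)"
proof -
  have "(y + 1) * y = y * (y - 1) + y * 2" by (simp add: algebra_simps)
  then show ?thesis by simp
qed

lemma tri_double: "2 * (y * (y - 1) div 2) = y * (y - 1 :: int)"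
  by (simp add: even_mult_iff)

text \<open>Half the squared norm of the root lattice vector (a, b, -a-b).\<close>

definition qform :: "int \<Rightarrow> int \<Rightarrow> int" where
  "qform a b = a^2 + a * b + b^2"

text \<open>The nontrivial Dirichlet character modulo 3. Taken at a - b it is antisymmetric under
  all permutations of a triple with sum 0.\<close>

definition chi3 :: "int \<Rightarrow> int" where
  "chi3 x = (if x mod 3 = 1 then 1 else if x mod 3 = 2 then -1 else 0)"

lemma chi3_0 [simp]: "chi3 0 = 0"
  by (simp add: chi3_def)

lemma chi3_minus: "chi3 (- x) = - chi3 x"
proof -
  have "x mod 3 = 0 \<or> x mod 3 = 1 \<or> x mod 3 = 2" by presburger
  then show ?thesis
    unfolding chi3_def by (elim disjE) (auto simp: zmod_zminus1_eq_if)
qed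

lemma chi3_cong: "3 dvd x - y \<Longrightarrow> chi3 x = chi3 y"
  unfolding chi3_def by (simp add: mod_eq_dvd_iff[symmetric])

text \<open>a^2 + ab + b^2 is congruent to (a - b)^2 modulo 3. So wherever the coefficient of a
  lattice sum is nonzero, the division by 3 in its exponent is exact.\<close>

lemma qform_mod3:
  assumes "chi3 (a - b) \<noteq> 0"
  shows "3 * ((qform a b - 1) div 3) = qform a b - 1"
proof -
  have "(a - b) mod 3 = 1 \<or> (a - b) mod 3 = 2"
    using assms by (auto simp: chi3_def split: if_splits)
  then obtain m where "a = b + 3 * m + 1 \<or> a = b + 3 * m + 2"
    by (metis add.commute add.left_commute diff_add_cancel mod_mult_div_eq mult.commute)
  then have "3 dvd qform a b - 1"
  proof
    assume a: "a = b + 3 * m + 1"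
    have "qform a b - 1 = 3 * (b^2 + 3 * b * m + b + 3 * m^2 + 2 * m)"
      unfolding a qform_def by (simp add: algebra_simps power2_eq_square)
    then show ?thesis by simp
  next
    assume a: "a = b + 3 * m + 2"
    have "qform a b - 1 = 3 * (b^2 + 3 * b * m + 2 * b + 3 * m^2 + 4 * m + 1)"
      unfolding a qform_def by (simp add: algebra_simps power2_eq_square)
    then show ?thesis by simp
  qed
  then show ?thesis by simp
qed

text \<open>The A2 root lattice cut off by a box. For fixed N and M the kernels have finite support,
  so a large enough box captures the whole lattice sum.\<close>

definition tri :: "int \<Rightarrow> (int \<times> int \<times> int) set" where
  "tri B = {(a, b, c) \<in> {-B..B} \<times> {-B..B} \<times> {-B..B}. a + b + c = 0}"

lemma finite_tri [simp]: "finite (tri B)"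
  unfolding tri_def by (rule finite_subset[of _ "{-B..B} \<times> {-B..B} \<times> {-B..B}"]) auto

context qfield
begin

text \<open>The condition 0 <= m <= n is built in: otherwise one of the two \<open>iq\<close> is
  0.\<close>

definition qbi :: "int \<Rightarrow> int \<Rightarrow> 'a" where
  "qbi n m = qfac n * iq m * iq (n - m)"

text \<open>Trades the $q$-binomial in the summation variable $m$ for a factor $1/(q)_{M-s}$; applied to
  the innermost variable first, it turns the sum over the $m_i$ into a chain of Bailey steps.\<close>

lemma sum_qbi_iq:
  assumes "finite I" "{0..r + b} \<subseteq> I" "finite J" "{0..M} \<subseteq> J" "r + b \<ge> 0"
  shows "(\<Sum>m\<in>I. q powi (m^2 - r * m) * qbi (r + b) m * iq M * iq (M + m - r))
    = (\<Sum>s\<in>J. q powi (s^2 - r * s) * iq (M - s) * iq s * iq (s + b))"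
proof -
  define n where "n = r + b"
  have "(\<Sum>s\<in>J. q powi (s^2 - r * s) * iq (M - s) * iq s * iq (s + b))
    = (\<Sum>s\<in>J. q powi (s^2 - r * s) * iq (M - s) * iq s * (qfac n * (iq n * iq (s + b))))"
  proof -
    have "qfac n * iq n = 1" using assms by (simp add: n_def iq_nonneg)
    then have "qfac n * (iq n * x) = x" for x by (simp add: mult.assoc[symmetric])
    then show ?thesis by (simp only:)
  qed
  also have "\<dots> = (\<Sum>s\<in>J. \<Sum>m\<in>{0..n}. qfac n * q powi (m^2 - r * m) * iq m * iq (n - m)
      * (q powi ((s - 0) * (s - (r - m))) * iq (M - s) * iq (s - 0) * iq (s - (r - m))))"
  proof (intro sum.cong refl)
    fix s assume "s \<in> J"
    have "iq n * iq (s + b) = (\<Sum>w\<in>{0..n}. q powi ((w - n) * (w - (s + b))) * iq w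
      * iq (n - w) * iq (s + b - w))"
      using iq_iq_expand[of "{0..n}" 0 n "s + b"] by simp
    also have "\<dots> = (\<Sum>m\<in>{0..n}. q powi (- m * (r - m - s)) * iq (n - m) * iq m * iq (s - (r - m)))"
      by (rule sum.reindex_bij_witness[of _ "\<lambda>m. n - m" "\<lambda>m. n - m"]) (auto simp: n_def algebra_simps)
    finally have E: "iq n * iq (s + b)
      = (\<Sum>m\<in>{0..n}. q powi (- m * (r - m - s)) * iq (n - m) * iq m * iq (s - (r - m)))" .
    show "q powi (s^2 - r * s) * iq (M - s) * iq s * (qfac n * (iq n * iq (s + b)))
      = (\<Sum>m\<in>{0..n}. qfac n * q powi (m^2 - r * m) * iq m * iq (n - m)
      * (q powi ((s - 0) * (s - (r - m))) * iq (M - s) * iq (s - 0) * iq (s - (r - m))))"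
      unfolding E sum_distrib_left
    proof (intro sum.cong refl)
      fix m
      have "q powi (s^2 - r * s) * q powi (- m * (r - m - s)) = q powi (m^2 - r * m) * q powi ((s - 0) * (s - (r - m)))"
        unfolding powi_sum by (rule arg_cong[of _ _ "\<lambda>x. q powi x"]) (simp add: algebra_simps power2_eq_square)
      then have X: "q powi (s^2 - r * s) * q powi (- m * (r - m - s)) * z
        = q powi (m^2 - r * m) * q powi ((s - 0) * (s - (r - m))) * z" for z by simp
      show "q powi (s^2 - r * s) * iq (M - s) * iq s * (qfac n
          * (q powi (- m * (r - m - s)) * iq (n - m) * iq m * iq (s - (r - m))))
        = qfac n * q powi (m^2 - r * m) * iq m * iq (n - m)
          * (q powi ((s - 0) * (s - (r - m))) * iq (M - s) * iq (s - 0) * iq (s - (r - m)))"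
        using X[of "iq (M - s) * iq s * qfac n * iq (n - m) * iq m * iq (s - (r - m))"]
        by (simp only: mult_ac diff_0_right)
    qed
  qed
  also have "\<dots> = (\<Sum>m\<in>{0..n}. qfac n * q powi (m^2 - r * m) * iq m * iq (n - m)
      * (\<Sum>s\<in>J. q powi ((s - 0) * (s - (r - m))) * iq (M - s) * iq (s - 0) * iq (s - (r - m))))"
    by (subst sum.swap) (simp only: sum_distrib_left)
  also have "\<dots> = (\<Sum>m\<in>{0..n}. q powi (m^2 - r * m) * qbi n m * iq M * iq (M + m - r))"
    by (intro sum.cong refl, subst sum_shifted_iq[OF assms(3,4)]) (simp add: qbi_def algebra_simps)
  also have "\<dots> = (\<Sum>m\<in>I. q powi (m^2 - r * m) * qbi n m * iq M * iq (M + m - r))"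
    by (rule sum.mono_neutral_left) (use assms in \<open>auto simp: n_def qbi_def\<close>)
  finally show ?thesis by (simp add: n_def)
qed

text \<open>For L >= 0, the coefficient of z^y in the product of 1 - z q^i over 0 <= i < L; see
  \<open>q_binomial_thm\<close>.\<close>

definition wt :: "int \<Rightarrow> int \<Rightarrow> 'a" where
  "wt L y = (-1) powi y * q powi (y * (y - 1) div 2) * qbi L y"

lemma wt_rec: "(1 - q powi (y + 1)) * wt L (y + 1) = - (q powi y - q powi L) * wt L y"
proof -
  have "iq y = (1 - q powi (y + 1)) * iq (y + 1)"
    using iq_rec[of "y + 1"] by simp
  moreover have "iq (L - (y + 1)) = (1 - q powi (L - y)) * iq (L - y)"
    using iq_rec[of "L - y"] by (simp add: algebra_simps)
  moreover have "q powi ((y + 1) * (y + 1 - 1) div 2) = q powi y * q powi (y * (y - 1) div 2)"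
    using tri_step[of y] by (simp add: powi_sum add.commute)
  moreover have "(-1 :: 'a) powi (y + 1) = - ((-1) powi y)"
    by (simp add: power_int_add)
  moreover have "q powi y - q powi L = q powi y * (1 - q powi (L - y))"
    by (simp add: algebra_simps powi_sum)
  ultimately show ?thesis
    unfolding wt_def qbi_def by (simp only: mult_ac mult_minus_left mult_minus_right)
qed

text \<open>Summation by parts, using \<open>wt_rec\<close>. There are no boundary terms: 1 - q^y
  vanishes at y = 0 and q^y - q^L at y = L.\<close>

lemma sum_wt_shift:
  "(\<Sum>y\<in>{0..L}. (1 - q powi y) * wt L y * F y)
    = - (\<Sum>y\<in>{0..L}. (q powi y - q powi L) * wt L y * F (y + 1))"
proof (cases "L \<ge> 0")
  case True
  have "(\<Sum>y\<in>{0..L}. (1 - q powi y) * wt L y * F y) = (\<Sum>y\<in>{1..L}. (1 - q powi y) * wt L y * F y)"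
  proof -
    have "{0..L} = insert 0 {1..L}" using True by auto
    then show ?thesis by simp
  qed
  also have "\<dots> = (\<Sum>y\<in>{0..L - 1}. (1 - q powi (y + 1)) * wt L (y + 1) * F (y + 1))"
    by (rule sum.reindex_bij_witness[of _ "\<lambda>y. y + 1" "\<lambda>y. y - 1"]) auto
  also have "\<dots> = (\<Sum>y\<in>{0..L - 1}. - (q powi y - q powi L) * wt L y * F (y + 1))"
    by (simp only: wt_rec)
  also have "\<dots> = (\<Sum>y\<in>{0..L}. - (q powi y - q powi L) * wt L y * F (y + 1))"
    by (rule sum.mono_neutral_left) auto
  finally show ?thesis by (simp only: sum_negf mult_minus_left)
qed simp

text \<open>A Gaussian of modulus -1. Together with the modulus 3 that the powers q^(y(y-1)/2) of
  three weights \<open>wt\<close> supply, it produces modulus 2. Setting it to 0 off the lattice is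
  what decouples the three summation variables of \<open>dsum\<close>.\<close>

definition beta :: "int \<Rightarrow> int \<Rightarrow> int \<Rightarrow> 'a" where
  "beta a b c = (if a + b + c = 0 then of_int (chi3 (a - b)) * q powi (- ((qform a b - 1) div 3)) else 0)"

lemma beta_swap12: "beta b a c = - beta a b c"
  using chi3_minus[of "a - b"] by (simp add: beta_def qform_def algebra_simps)

lemma beta_swap23: "beta a c b = - beta a b c"
proof (cases "a + b + c = 0")
  case True
  then have c: "c = - a - b" by simp
  have "chi3 (a - c) = chi3 (b - a)"
    by (rule chi3_cong) (simp add: c)
  also have "\<dots> = - chi3 (a - b)"
    using chi3_minus[of "a - b"] by simp
  finally have "chi3 (a - c) = - chi3 (a - b)" .
  moreover have "qform a c = qform a b"
    by (simp add: c qform_def algebra_simps power2_eq_square)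
  ultimately show ?thesis using True by (simp add: beta_def algebra_simps)
qed (simp add: beta_def algebra_simps)

text \<open>Translation by (-2, 1, 1) preserves a - b modulo 3 and changes \<open>qform\<close> by
  3(1 - a), so that it only costs a power of q that is linear in a.\<close>

lemma beta_translate: "q powi a * beta a b c = q * beta (a - 2) (b + 1) (c + 1)"
proof (cases "a + b + c = 0 \<and> chi3 (a - b) \<noteq> 0")
  case True
  have chi: "chi3 (a - b - 3) = chi3 (a - b)"
    by (rule chi3_cong) simp
  have "qform (a - 2) (b + 1) - 1 = qform a b - 1 + (1 - a) * 3"
    by (simp add: qform_def algebra_simps power2_eq_square)
  then have "(qform (a - 2) (b + 1) - 1) div 3 = (qform a b - 1) div 3 + (1 - a)"
    by simp
  moreover have "q * q powi z = q powi (1 + z)" for z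
    using powi_sum[of 1 z] by simp
  ultimately have "q * q powi (- ((qform (a - 2) (b + 1) - 1) div 3)) = q powi a * q powi (- ((qform a b - 1) div 3))"
    by (simp add: powi_sum)
  with True show ?thesis by (simp add: beta_def chi mult_ac)
next
  case False
  have "chi3 (a - 2 - (b + 1)) = chi3 (a - b)"
    by (rule chi3_cong) simp
  with False show ?thesis by (auto simp: beta_def)
qed

text \<open>The seed as a sum over three independent coordinates: it has the quasi-periods of a theta
  function in each coordinate separately, which is what makes the four-term relation below possible.\<close>

definition dsum :: "int \<Rightarrow> int \<Rightarrow> int \<Rightarrow> int \<Rightarrow> 'a" where
  "dsum L a b c = (\<Sum>y\<in>{0..L}. \<Sum>z\<in>{0..L}. \<Sum>t\<in>{0..L}. wt L t * wt L z * wt L y * beta (a + t) (b + z) (c + y))"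

lemma dsum_swap12: "dsum L b a c = - dsum L a b c"
proof -
  have "dsum L b a c = (\<Sum>y\<in>{0..L}. \<Sum>t\<in>{0..L}. \<Sum>z\<in>{0..L}. wt L t * wt L z * wt L y * beta (b + t) (a + z) (c + y))"
    unfolding dsum_def by (intro sum.cong refl sum.swap)
  also have "\<dots> = - dsum L a b c"
    unfolding dsum_def sum_negf[symmetric]
    by (intro sum.cong refl, subst beta_swap12) (simp add: mult_ac)
  finally show ?thesis .
qed

lemma dsum_swap23: "dsum L a c b = - dsum L a b c"
proof -
  have "dsum L a c b = (\<Sum>z\<in>{0..L}. \<Sum>y\<in>{0..L}. \<Sum>t\<in>{0..L}. wt L t * wt L z * wt L y * beta (a + t) (c + z) (b + y))"
    unfolding dsum_def by (rule sum.swap)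
  also have "\<dots> = - dsum L a b c"
    unfolding dsum_def sum_negf[symmetric]
    by (intro sum.cong refl, subst beta_swap23) (simp add: mult_ac)
  finally show ?thesis .
qed

text \<open>Insert 1 - q^t under the sum. Absorbing q^t into a translation of the arguments by
  \<open>beta_translate\<close> gives the left side; moving the same factor with
  \<open>sum_wt_shift\<close> before absorbing gives the right side.\<close>

lemma dsum_rel:
  "dsum L a b c - q powi (1 - a) * dsum L (a - 2) (b + 1) (c + 1)
    = q powi L * dsum L (a + 1) b c - q powi (- a) * dsum L (a - 1) (b + 1) (c + 1)"
proof -
  have tr: "q powi t * beta (x + t) b c = q powi (1 - x) * beta (x + t - 2) (b + 1) (c + 1)" for t x b c
  proof -
    have "q powi (-x) * (q powi (x + t) * beta (x + t) b c) = q powi (-x) * (q * beta (x + t - 2) (b + 1) (c + 1))"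
      by (simp only: beta_translate)
    then show ?thesis using powi_sum[of "-x" 1]
      by (simp add: mult.assoc[symmetric] powi_sum)
  qed
  have "(\<Sum>t\<in>{0..L}. wt L t * wt L z * wt L y * beta (a + t) (b + z) (c + y))
      - q powi (1 - a) * (\<Sum>t\<in>{0..L}. wt L t * wt L z * wt L y * beta (a - 2 + t) (b + 1 + z) (c + 1 + y))
    = q powi L * (\<Sum>t\<in>{0..L}. wt L t * wt L z * wt L y * beta (a + 1 + t) (b + z) (c + y))
      - q powi (- a) * (\<Sum>t\<in>{0..L}. wt L t * wt L z * wt L y * beta (a - 1 + t) (b + 1 + z) (c + 1 + y))" for y z
  proof -
    have "(\<Sum>t\<in>{0..L}. wt L t * wt L z * wt L y * beta (a + t) (b + z) (c + y))
        - q powi (1 - a) * (\<Sum>t\<in>{0..L}. wt L t * wt L z * wt L y * beta (a - 2 + t) (b + 1 + z) (c + 1 + y))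
      = (\<Sum>t\<in>{0..L}. (1 - q powi t) * wt L t * (wt L z * wt L y * beta (a + t) (b + z) (c + y)))"
      unfolding sum_distrib_left sum_subtractf[symmetric]
    proof (intro sum.cong refl)
      fix t
      have e: "a + t - 2 = a - 2 + t" "b + z + 1 = b + 1 + z" "c + y + 1 = c + 1 + y" by simp_all
      then have "q powi t * beta (a + t) (b + z) (c + y) = q powi (1 - a) * beta (a - 2 + t) (b + 1 + z) (c + 1 + y)"
        using tr[of t a "b + z" "c + y"] by (simp only: e)
      then show "wt L t * wt L z * wt L y * beta (a + t) (b + z) (c + y) -
         q powi (1 - a) * (wt L t * wt L z * wt L y * beta (a - 2 + t) (b + 1 + z) (c + 1 + y)) =
         (1 - q powi t) * wt L t * (wt L z * wt L y * beta (a + t) (b + z) (c + y))"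
        by (simp add: algebra_simps)
    qed
    also have "\<dots> = - (\<Sum>t\<in>{0..L}. (q powi t - q powi L) * wt L t * (wt L z * wt L y * beta (a + (t + 1)) (b + z) (c + y)))"
      by (rule sum_wt_shift)
    also have "\<dots> = q powi L * (\<Sum>t\<in>{0..L}. wt L t * wt L z * wt L y * beta (a + 1 + t) (b + z) (c + y))
      - q powi (- a) * (\<Sum>t\<in>{0..L}. wt L t * wt L z * wt L y * beta (a - 1 + t) (b + 1 + z) (c + 1 + y))"
      unfolding sum_distrib_left sum_subtractf[symmetric] sum_negf[symmetric]
    proof (intro sum.cong refl)
      fix t
      have e: "a + 1 + t - 2 = a - 1 + t" "b + z + 1 = b + 1 + z" "c + y + 1 = c + 1 + y" "a + (t + 1) = a + 1 + t" by simp_all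
      have "1 - (a + 1) = - a" by simp
      then have "q powi t * beta (a + 1 + t) (b + z) (c + y) = q powi (- a) * beta (a - 1 + t) (b + 1 + z) (c + 1 + y)"
        using tr[of t "a + 1" "b + z" "c + y"] by (simp only: e)
      then show "- ((q powi t - q powi L) * wt L t * (wt L z * wt L y * beta (a + (t + 1)) (b + z) (c + y)))
        = q powi L * (wt L t * wt L z * wt L y * beta (a + 1 + t) (b + z) (c + y))
         - q powi (- a) * (wt L t * wt L z * wt L y * beta (a - 1 + t) (b + 1 + z) (c + 1 + y))"
        unfolding e(4) by (simp add: algebra_simps)
    qed
    finally show ?thesis .
  qed
  then have "(\<Sum>y\<in>{0..L}. \<Sum>z\<in>{0..L}. (\<Sum>t\<in>{0..L}. wt L t * wt L z * wt L y * beta (a + t) (b + z) (c + y))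
      - q powi (1 - a) * (\<Sum>t\<in>{0..L}. wt L t * wt L z * wt L y * beta (a - 2 + t) (b + 1 + z) (c + 1 + y)))
    = (\<Sum>y\<in>{0..L}. \<Sum>z\<in>{0..L}. q powi L * (\<Sum>t\<in>{0..L}. wt L t * wt L z * wt L y * beta (a + 1 + t) (b + z) (c + y))
      - q powi (- a) * (\<Sum>t\<in>{0..L}. wt L t * wt L z * wt L y * beta (a - 1 + t) (b + 1 + z) (c + 1 + y)))"
    by (simp only:)
  then show ?thesis
    unfolding dsum_def by (simp only: sum_subtractf sum_distrib_left)
qed

text \<open>By antisymmetry \<open>dsum\<close> is 0 when two arguments coincide and is invariant
  under cyclic shifts. At (1-N, -N, -1-N), (1-N, 1-N, -1-N) and (1-N, 1-N, -N) the four-term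
  relation therefore connects just two values. These three relations raise one coordinate at a time,
  and together they lead from N to N - 1.\<close>

lemma dsum_rec:
  "q powi (2 * N) * (1 - q powi N) * dsum L (1 - N) (- N) (- 1 - N)
    = q powi (2 * L) * (q powi L - q powi (N - 1)) * dsum L (2 - N) (1 - N) (- N)"
proof -
  let ?D = "dsum L"
  have eq0: "?D x y x = 0" "?D x x y = 0" "?D y x x = 0" for x y
  proof -
    show *: "?D x x y = 0" for x y using dsum_swap12[of L x x y] by simp
    show "?D y x x = 0" for x y using dsum_swap23[of L y x x] by simp
    show "?D x y x = 0" using dsum_swap23[of L x y x] * by simp
  qed
  have cyc: "?D c a b = ?D a b c" for a b c
    using dsum_swap12[of L c a b] dsum_swap23[of L a c b] by simp
  have 1: "(1 - q powi N) * ?D (1 - N) (- N) (- 1 - N) = q powi L * ?D (2 - N) (- N) (- 1 - N)"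
    using dsum_rel[of L "1 - N" "- N" "- 1 - N"] cyc[of "-1 - N" "1 - N" "- N"]
    by (simp add: eq0 algebra_simps)
  have 2: "- (q powi N * ?D (2 - N) (- N) (- 1 - N)) = q powi L * ?D (2 - N) (1 - N) (- 1 - N)"
    using dsum_rel[of L "1 - N" "1 - N" "- 1 - N"] cyc[of "-1 - N" "2 - N" "- N"]
    by (simp add: eq0 algebra_simps)
  have 3: "- (q powi N * ?D (2 - N) (1 - N) (- 1 - N)) = (q powi L - q powi (N - 1)) * ?D (2 - N) (1 - N) (- N)"
    using dsum_rel[of L "1 - N" "1 - N" "- N"] cyc[of "-1 - N" "2 - N" "1 - N"] cyc[of "- N" "2 - N" "1 - N"]
    by (simp add: eq0 algebra_simps)
  have p: "q powi (2 * N) = q powi N * q powi N" "q powi (2 * L) = q powi L * q powi L"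
    by (simp_all add: powi_sum)
  show ?thesis
    unfolding p using 1 2 3 by algebra
qed

text \<open>The arguments already add up to 0, so among nonnegative shifts only t = z = y = 0 stays
  on the lattice.\<close>

lemma dsum_0:
  assumes "L \<ge> 0"
  shows "dsum L 1 0 (-1) = 1"
proof -
  have wt0: "wt L 0 = 1" using assms by (simp add: wt_def qbi_def iq_nonneg)
  have "dsum L 1 0 (-1) = (\<Sum>y\<in>{0..L}. \<Sum>z\<in>{0..L}. \<Sum>t\<in>{0..L}. if t = 0 then if z = 0 then if y = 0 then 1 else 0 else 0 else 0)"
    unfolding dsum_def by (intro sum.cong refl) (auto simp: wt0 beta_def chi3_def qform_def)
  also have "\<dots> = 1" using assms by simp
  finally show ?thesis .
qed

lemma dsum_eval:
  assumes "0 \<le> N" "N \<le> L"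
  shows "dsum L (1 - N) (- N) (- 1 - N)
    = (-1) powi N * q powi (N * (N - 1) div 2 + 2 * L * N - N * (N + 1)) * qbi L N"
  using assms
proof (induction N rule: int_ge_induct)
  case base
  then show ?case by (simp add: dsum_0 qbi_def iq_nonneg)
next
  case (step N)
  let ?E = "\<lambda>N. N * (N - 1) div 2 + 2 * L * N - N * (N + 1)"
  have nz: "1 - q powi (N + 1) \<noteq> 0" using powi_neq_1[of "N + 1"] step by simp
  have "iq N = (1 - q powi (N + 1)) * iq (N + 1)"
    using iq_rec[of "N + 1"] by simp
  moreover have "iq (L - (N + 1)) = (1 - q powi (L - N)) * iq (L - N)"
    using iq_rec[of "L - N"] by (simp add: algebra_simps)
  ultimately have b: "(1 - q powi (N + 1)) * qbi L (N + 1) = (1 - q powi (L - N)) * qbi L N"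
    by (simp add: qbi_def mult_ac)
  have "q powi (2 * (N + 1)) * (1 - q powi (N + 1)) * dsum L (1 - (N + 1)) (- (N + 1)) (- 1 - (N + 1))
    = q powi (2 * L) * (q powi L - q powi N) * dsum L (1 - N) (- N) (- 1 - N)"
    using dsum_rec[of "N + 1" L] by (simp add: algebra_simps)
  also have "\<dots> = q powi (2 * L) * (q powi L - q powi N) * ((-1) powi N * q powi ?E N * qbi L N)"
    using step by simp
  also have "q powi L - q powi N = - (q powi N) * (1 - q powi (L - N))"
    by (simp add: algebra_simps powi_sum)
  also have "q powi (2 * L) * (- (q powi N) * (1 - q powi (L - N))) * ((-1) powi N * q powi ?E N * qbi L N)
    = - ((-1) powi N) * (q powi (2 * L) * q powi N * q powi ?E N) * ((1 - q powi (L - N)) * qbi L N)"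
    by (simp add: mult_ac)
  also have "q powi (2 * L) * q powi N * q powi ?E N = q powi (2 * (N + 1)) * q powi ?E (N + 1)"
    unfolding powi_sum using tri_step[of N]
    by (intro arg_cong[of _ _ "\<lambda>x. q powi x"]) (simp add: algebra_simps)
  also have "- ((-1) powi N) = (-1 :: 'a) powi (N + 1)"
    by (simp add: power_int_add)
  finally have "(q powi (2 * (N + 1)) * (1 - q powi (N + 1))) * dsum L (1 - (N + 1)) (- (N + 1)) (- 1 - (N + 1))
     = (q powi (2 * (N + 1)) * (1 - q powi (N + 1))) * ((-1) powi (N + 1) * q powi ?E (N + 1) * qbi L (N + 1))"
    unfolding b[symmetric] by (simp only: mult_ac)
  with nz show ?case by simp
qed

lemma ker3_nonzeroD:
  assumes "ker3 N M a b c \<noteq> 0"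
  shows "a \<le> N" "b \<le> N" "c \<le> N" "- a \<le> M" "- b \<le> M" "- c \<le> M"
proof -
  have *: "n \<ge> 0" if "iq n \<noteq> 0" for n
    using that by (meson iq_neg not_le)
  have "N - a \<ge> 0" "N - b \<ge> 0" "N - c \<ge> 0" "M + a \<ge> 0" "M + b \<ge> 0" "M + c \<ge> 0"
    by (rule *, use assms in \<open>force simp: ker3_def\<close>)+
  then show "a \<le> N" "b \<le> N" "c \<le> N" "- a \<le> M" "- b \<le> M" "- c \<le> M" by simp_all
qed

text \<open>In both bosonic sums \<open>K\<close> is the modulus; \<open>bos\<close> has the kernel shifted by
  $\rho = (1,0,-1)$ and its linear exponent multiplied by \<open>i\<close>.\<close>

definition bos :: "int \<Rightarrow> int \<Rightarrow> int \<Rightarrow> int \<Rightarrow> int \<Rightarrow> 'a" where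
  "bos B K i N M = (\<Sum>(a, b, c)\<in>tri B. of_int (chi3 (a - b))
     * q powi (K * ((qform a b - 1) div 3) - i * (a - c - 2)) * ker3 N M (a - 1) b (c + 1))"

text \<open>Put t = N + 1 - a, z = N - b, y = N - 1 - c. The six \<open>iq\<close> of the shifted
  kernel pair up to three q-binomials with upper entry L = N + M, and the lattice sum becomes a
  value of \<open>dsum\<close> that \<open>dsum_eval\<close> knows. The bound on B makes the box
  contain the support of the kernel.\<close>

lemma seed:
  assumes "0 \<le> N" "0 \<le> M" "N + M + 1 \<le> B"
  shows "bos B 2 1 N M = q powi (2 * N * M) * iq N * iq M * iq (N + M)"
proof -
  define L where "L = N + M"
  define T where "T = N * (N - 1) div 2"
  have L: "L \<ge> 0" using assms by (simp add: L_def)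
  \<comment> \<open>Three q-binomials contain (q)_L^3 and the kernel contains (q)_L; the sign and
    q^(3T) are the parts of the three weights that do not depend on the lattice point.\<close>
  let ?C = "(-1) powi N * q powi (3 * T) * qfac L * qfac L"
  let ?F = "\<lambda>(a, b, c). of_int (chi3 (a - b))
     * q powi (2 * ((qform a b - 1) div 3) - 1 * (a - c - 2)) * ker3 N M (a - 1) b (c + 1)"
  let ?G = "\<lambda>(t, z, y). wt L t * wt L z * wt L y * beta (-1 - N + t) (- N + z) (1 - N + y)"
  define S where "S = {(a, b, c). a + b + c = 0 \<and> 0 \<le> N - a + 1 \<and> N - a + 1 \<le> L
     \<and> 0 \<le> N - b \<and> N - b \<le> L \<and> 0 \<le> N - c - 1 \<and> N - c - 1 \<le> L}"
  define U where "U = {(t, z, y). t + z + y = 3 * N \<and> 0 \<le> t \<and> t \<le> L \<and> 0 \<le> z \<and> z \<le> L \<and> 0 \<le> y \<and> y \<le> L}"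
  have term_eq: "?C * ?F (a, b, c) = - ?G (N - a + 1, N - b, N - c - 1)" if s: "a + b + c = 0" for a b c
  proof (cases "chi3 (a - b) = 0")
    case True
    then have "chi3 (- (a - b)) = 0" by (simp only: chi3_minus)
    with True show ?thesis by (simp add: beta_def)
  next
    case False
    have c: "c = - a - b" using s by simp
    have chi: "chi3 (- a - - b) = - chi3 (a - b)"
      using chi3_minus[of "a - b"] by simp
    have qm: "qform (- a) (- b) = qform a b" by (simp add: qform_def)
    define e where "e = (qform a b - 1) div 3"
    have e: "3 * e = qform a b - 1" unfolding e_def by (rule qform_mod3[OF False])
    have m1: "(-1 :: 'a) powi (N - a + 1) * (-1) powi (N - b) * (-1) powi (N - c - 1) = (-1) powi N"
    proof -
      have "(-1 :: 'a) powi (N - a + 1) * (-1) powi (N - b) * (-1) powi (N - c - 1)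
        = (-1) powi (N - a + 1 + (N - b) + (N - c - 1))"
        by (simp only: power_int_add neg_equal_0_iff_equal one_neq_zero simp_thms if_False disj_not1 HOL.implies_True_equals)
      also have "N - a + 1 + (N - b) + (N - c - 1) = N + 2 * N" by (simp add: c)
      also have "(-1 :: 'a) powi (N + 2 * N) = (-1) powi N"
        by (simp add: power_int_add power_int_mult)
      finally show ?thesis .
    qed
    have ex: "(N - a + 1) * (N - a + 1 - 1) div 2 + (N - b) * (N - b - 1) div 2
        + (N - c - 1) * (N - c - 1 - 1) div 2 - e = 3 * T + (2 * e - 1 * (a - c - 2))"
    proof -
      define t1 t2 t3 where "t1 = (N - a + 1) * (N - a + 1 - 1) div 2"
        and "t2 = (N - b) * (N - b - 1) div 2" and "t3 = (N - c - 1) * (N - c - 1 - 1) div 2"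
      have "2 * t1 = (N - a + 1) * (N - a + 1 - 1)" "2 * t2 = (N - b) * (N - b - 1)"
        "2 * t3 = (N - c - 1) * (N - c - 1 - 1)" "2 * T = N * (N - 1)"
        "3 * e = a^2 + a * b + b^2 - 1"
        using tri_double e by (simp_all only: t1_def t2_def t3_def T_def qform_def)
      then have "2 * (t1 + t2 + t3 - e) = 2 * (3 * T + (2 * e - 1 * (a - c - 2)))"
        unfolding c by algebra
      then have "t1 + t2 + t3 - e = 3 * T + (2 * e - 1 * (a - c - 2))" by simp
      then show ?thesis by (simp only: t1_def t2_def t3_def)
    qed
    have pw: "q powi ((N - a + 1) * (N - a + 1 - 1) div 2) * q powi ((N - b) * (N - b - 1) div 2)
        * q powi ((N - c - 1) * (N - c - 1 - 1) div 2) * q powi (- e) = q powi (3 * T) * q powi (2 * e - 1 * (a - c - 2))"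
      unfolding powi_sum using ex by (intro arg_cong[of _ _ "\<lambda>x. q powi x"]) simp
    have bt: "beta (-1 - N + (N - a + 1)) (- N + (N - b)) (1 - N + (N - c - 1))
        = - (of_int (chi3 (a - b)) * q powi (- e))"
      using chi by (simp add: beta_def c qm e_def)
    have i: "L - (N - a + 1) = M + (a - 1)" "L - (N - b) = M + b" "L - (N - c - 1) = M + (c + 1)"
      by (simp_all add: L_def)
    have ii: "N - a + 1 = N - (a - 1)" "N - c - 1 = N - (c + 1)" by simp_all
    have "- ?G (N - a + 1, N - b, N - c - 1)
      = ((-1) powi (N - a + 1) * (-1) powi (N - b) * (-1) powi (N - c - 1))
        * (q powi ((N - a + 1) * (N - a + 1 - 1) div 2) * q powi ((N - b) * (N - b - 1) div 2)
        * q powi ((N - c - 1) * (N - c - 1 - 1) div 2) * q powi (- e))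
        * of_int (chi3 (a - b)) * (qbi L (N - a + 1) * qbi L (N - b) * qbi L (N - c - 1))"
      unfolding prod.case bt wt_def by (simp add: mult_ac)
    also have "qbi L (N - a + 1) * qbi L (N - b) * qbi L (N - c - 1) = qfac L * qfac L * ker3 N M (a - 1) b (c + 1)"
      unfolding qbi_def i ker3_def ii by (simp add: L_def mult_ac)
    finally show ?thesis
      unfolding m1 pw unfolding prod.case e_def by (simp only: mult_ac)
  qed
  have "?C * bos B 2 1 N M = ?C * (\<Sum>x\<in>tri B. ?F x)"
    by (simp add: bos_def)
  also have "(\<Sum>x\<in>tri B. ?F x) = (\<Sum>x\<in>S. ?F x)"
  proof (rule sum.mono_neutral_right)
    show "S \<subseteq> tri B" using assms by (auto simp: S_def tri_def L_def)
    show "\<forall>x\<in>tri B - S. ?F x = 0"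
    proof (rule ballI, rule ccontr)
      fix x assume x: "x \<in> tri B - S" "?F x \<noteq> 0"
      obtain a b c where abc: "x = (a, b, c)" by (metis prod_cases3)
      with x have "ker3 N M (a - 1) b (c + 1) \<noteq> 0" by auto
      from ker3_nonzeroD[OF this] x(1) abc show False
        by (auto simp: S_def tri_def L_def)
    qed
  qed simp
  also have "?C * \<dots> = - (\<Sum>x\<in>U. ?G x)"
    unfolding sum_distrib_left sum_negf[symmetric]
    by (rule sum.reindex_bij_witness[of _ "\<lambda>(t, z, y). (N + 1 - t, N - z, N - 1 - y)"
          "\<lambda>(a, b, c). (N - a + 1, N - b, N - c - 1)"])
      (use term_eq in \<open>auto simp: S_def U_def\<close>)
  also have "(\<Sum>x\<in>U. ?G x) = (\<Sum>x\<in>{0..L} \<times> {0..L} \<times> {0..L}. ?G x)"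
    by (rule sum.mono_neutral_left) (auto simp: U_def beta_def split: if_splits)
  also have "\<dots> = dsum L (-1 - N) (- N) (1 - N)"
  proof -
    have "(\<Sum>x\<in>{0..L} \<times> {0..L} \<times> {0..L}. ?G x) = (\<Sum>t\<in>{0..L}. \<Sum>z\<in>{0..L}. \<Sum>y\<in>{0..L}. ?G (t, z, y))"
      by (simp add: sum.cartesian_product)
    also have "\<dots> = (\<Sum>t\<in>{0..L}. \<Sum>y\<in>{0..L}. \<Sum>z\<in>{0..L}. ?G (t, z, y))"
      by (intro sum.cong refl sum.swap)
    also have "\<dots> = (\<Sum>y\<in>{0..L}. \<Sum>t\<in>{0..L}. \<Sum>z\<in>{0..L}. ?G (t, z, y))"
      by (rule sum.swap)
    also have "\<dots> = (\<Sum>y\<in>{0..L}. \<Sum>z\<in>{0..L}. \<Sum>t\<in>{0..L}. ?G (t, z, y))"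
      by (intro sum.cong refl sum.swap)
    finally show ?thesis by (simp add: dsum_def)
  qed
  \<comment> \<open>Reversing the order of the three arguments is an odd permutation.\<close>
  also have "\<dots> = - dsum L (1 - N) (- N) (-1 - N)"
    using dsum_swap12[of L "-1 - N" "- N" "1 - N"] dsum_swap23[of L "- N" "-1 - N" "1 - N"]
      dsum_swap12[of L "- N" "1 - N" "-1 - N"] by simp
  also have "dsum L (1 - N) (- N) (-1 - N)
    = (-1) powi N * q powi (T + 2 * L * N - N * (N + 1)) * qbi L N"
    unfolding T_def by (rule dsum_eval) (use assms in \<open>auto simp: L_def\<close>)
  also have "q powi (T + 2 * L * N - N * (N + 1)) = q powi (3 * T) * q powi (2 * N * M)"
    unfolding powi_sum using tri_double[of N]
    by (intro arg_cong[of _ _ "\<lambda>x. q powi x"]) (simp add: T_def L_def algebra_simps)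
  also have "qbi L N = qfac L * qfac L * (iq N * iq M * iq (N + M))"
    using L by (simp add: qbi_def L_def iq_nonneg[of "N + M"])
  finally have "?C * bos B 2 1 N M = ?C * (q powi (2 * N * M) * iq N * iq M * iq (N + M))"
    by (simp only: minus_minus mult_ac)
  then show ?thesis by simp
qed

end

subsection \<open>Bosonic sums\<close>

text \<open>Each permutation of the coordinates maps the box to itself, so six times the sum is the
  sum of the symmetrised terms, and 6 is invertible.\<close>

lemma sum_tri_antisym:
  fixes F :: "int \<times> int \<times> int \<Rightarrow> 'a::field_char_0"
  assumes "\<And>a b c. a + b + c = 0 \<Longrightarrow>
    F (a, b, c) + F (b, c, a) + F (c, a, b) + F (b, a, c) + F (a, c, b) + F (c, b, a) = 0"
  shows "sum F (tri B) = 0"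
proof -
  have f1: "(\<Sum>(a, b, c)\<in>tri B. F (b, c, a)) = sum F (tri B)"
    by (rule sum.reindex_bij_witness[of _ "\<lambda>(a, b, c). (c, a, b)" "\<lambda>(a, b, c). (b, c, a)"])
      (auto simp: tri_def)
  have f2: "(\<Sum>(a, b, c)\<in>tri B. F (c, a, b)) = sum F (tri B)"
    by (rule sum.reindex_bij_witness[of _ "\<lambda>(a, b, c). (b, c, a)" "\<lambda>(a, b, c). (c, a, b)"])
      (auto simp: tri_def)
  have f3: "(\<Sum>(a, b, c)\<in>tri B. F (b, a, c)) = sum F (tri B)"
    by (rule sum.reindex_bij_witness[of _ "\<lambda>(a, b, c). (b, a, c)" "\<lambda>(a, b, c). (b, a, c)"])
      (auto simp: tri_def)
  have f4: "(\<Sum>(a, b, c)\<in>tri B. F (a, c, b)) = sum F (tri B)"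
    by (rule sum.reindex_bij_witness[of _ "\<lambda>(a, b, c). (a, c, b)" "\<lambda>(a, b, c). (a, c, b)"])
      (auto simp: tri_def)
  have f5: "(\<Sum>(a, b, c)\<in>tri B. F (c, b, a)) = sum F (tri B)"
    by (rule sum.reindex_bij_witness[of _ "\<lambda>(a, b, c). (c, b, a)" "\<lambda>(a, b, c). (c, b, a)"])
      (auto simp: tri_def)
  have f6: "(\<Sum>(a, b, c)\<in>tri B. F (a, b, c)) = sum F (tri B)"
    by (rule sum.reindex_bij_witness[of _ "\<lambda>(a, b, c). (a, b, c)" "\<lambda>(a, b, c). (a, b, c)"])
      (auto simp: tri_def)
  have "6 * sum F (tri B) = (\<Sum>(a, b, c)\<in>tri B. F (a, b, c)) + (\<Sum>(a, b, c)\<in>tri B. F (b, c, a))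
     + (\<Sum>(a, b, c)\<in>tri B. F (c, a, b)) + (\<Sum>(a, b, c)\<in>tri B. F (b, a, c))
     + (\<Sum>(a, b, c)\<in>tri B. F (a, c, b)) + (\<Sum>(a, b, c)\<in>tri B. F (c, b, a))"
    unfolding f1 f2 f3 f4 f5 f6 by simp
  also have "\<dots> = (\<Sum>(a, b, c)\<in>tri B. F (a, b, c) + F (b, c, a) + F (c, a, b) + F (b, a, c) + F (a, c, b) + F (c, b, a))"
    by (simp add: sum.distrib case_prod_unfold)
  also have "\<dots> = 0"
    by (rule sum.neutral) (use assms in \<open>auto simp: tri_def\<close>)
  finally show ?thesis by simp
qed

text \<open>What remains of the difference of the two kernels in \<open>bosf_switch\<close> after
  extracting common factors, for p = 1/q, \<alpha> = q^(n+1), \<beta> = q^(m+1) and x, y, z = q^a,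
  q^b, q^c. On the lattice y z^2 = q^(c-a) is the linear part of the weight.\<close>

definition switch_poly :: "'a::comm_ring_1 \<Rightarrow> 'a \<Rightarrow> 'a \<Rightarrow> 'a \<Rightarrow> 'a \<Rightarrow> 'a \<Rightarrow> 'a" where
  "switch_poly p \<alpha> \<beta> x y z = (1 - \<alpha> * \<beta>) * (1 - \<alpha> * \<beta> * p)^2 * y * z^2
     - (y - \<alpha>) * (z - \<alpha>) * (z - \<alpha> * p) * (1 - \<beta> * x) * (1 - \<beta> * x * p) * (1 - \<beta> * y)"

text \<open>The left side is the determinant of the values of f, g, h at x, y, z. The matrix of
  values is the coefficient matrix times a Vandermonde matrix, whose determinant is V.\<close>

lemma antisym_quadratics:
  fixes x y z :: "'a::comm_ring_1"
  defines "V \<equiv> y * z^2 + z * x^2 + x * y^2 - x * z^2 - z * y^2 - y * x^2"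
  assumes f: "\<And>x. f x = f0 + f1 * x + f2 * x^2" and g: "\<And>x. g x = g0 + g1 * x + g2 * x^2"
    and h: "\<And>x. h x = h0 + h1 * x + h2 * x^2"
  shows "f x * g y * h z + f y * g z * h x + f z * g x * h y - f y * g x * h z - f x * g z * h y - f z * g y * h x
    = (f0 * (g1 * h2 - g2 * h1) - f1 * (g0 * h2 - g2 * h0) + f2 * (g0 * h1 - g1 * h0)) * V"
proof -
  have gh: "g y * h z - g z * h y = (g0 * h1 - g1 * h0) * (z - y) + (g0 * h2 - g2 * h0) * (z^2 - y^2)
      + (g1 * h2 - g2 * h1) * (y * z^2 - z * y^2)" for y z
    unfolding g h by (simp add: algebra_simps power2_eq_square)
  have "f x * g y * h z + f y * g z * h x + f z * g x * h y - f y * g x * h z - f x * g z * h y - f z * g y * h x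
    = f x * (g y * h z - g z * h y) + f y * (g z * h x - g x * h z) + f z * (g x * h y - g y * h x)"
    by (simp add: algebra_simps)
  also have "\<dots> = (f0 * (g1 * h2 - g2 * h1) - f1 * (g0 * h2 - g2 * h0) + f2 * (g0 * h1 - g1 * h0)) * V"
  proof -
    define A B C where "A = g0 * h1 - g1 * h0" and "B = g0 * h2 - g2 * h0" and "C = g1 * h2 - g2 * h1"
    show ?thesis
      unfolding gh f V_def A_def[symmetric] B_def[symmetric] C_def[symmetric]
      by (simp add: algebra_simps power2_eq_square)
  qed
  finally show ?thesis .
qed

text \<open>The long product is f(x) g(y) h(z) with three quadratics. Their coefficient determinant
  happens to be D, the very factor in front of y z^2, and the alternating sum of y z^2 is the
  Vandermonde determinant V; so both parts contribute D V.\<close>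

lemma switch_poly_antisym:
  "switch_poly p \<alpha> \<beta> x y z + switch_poly p \<alpha> \<beta> y z x + switch_poly p \<alpha> \<beta> z x y
    - switch_poly p \<alpha> \<beta> y x z - switch_poly p \<alpha> \<beta> x z y - switch_poly p \<alpha> \<beta> z y x = 0"
proof -
  define f g h where "f = (\<lambda>x. (1 - \<beta> * x) * (1 - \<beta> * x * p))" and "g = (\<lambda>y. (y - \<alpha>) * (1 - \<beta> * y))"
    and "h = (\<lambda>z. (z - \<alpha>) * (z - \<alpha> * p))"
  define D where "D = (1 - \<alpha> * \<beta>) * (1 - \<alpha> * \<beta> * p)^2"
  have sp: "switch_poly p \<alpha> \<beta> x y z = D * (y * z^2) - f x * g y * h z" for x y z
    by (simp add: switch_poly_def D_def f_def g_def h_def mult_ac)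
  have f: "f x = 1 + (- \<beta> * (1 + p)) * x + (\<beta>^2 * p) * x^2" for x
    by (simp add: f_def algebra_simps power2_eq_square)
  have g: "g x = - \<alpha> + (1 + \<alpha> * \<beta>) * x + (- \<beta>) * x^2" for x
    by (simp add: g_def algebra_simps power2_eq_square)
  have h: "h x = \<alpha>^2 * p + (- \<alpha> * (1 + p)) * x + 1 * x^2" for x
    by (simp add: h_def algebra_simps power2_eq_square)
  have "1 * ((1 + \<alpha> * \<beta>) * 1 - (- \<beta>) * (- \<alpha> * (1 + p))) - (- \<beta> * (1 + p)) * ((- \<alpha>) * 1 - (- \<beta>) * (\<alpha>^2 * p))
     + (\<beta>^2 * p) * ((- \<alpha>) * (- \<alpha> * (1 + p)) - (1 + \<alpha> * \<beta>) * (\<alpha>^2 * p)) = D"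
    by (simp add: D_def algebra_simps power2_eq_square)
  from antisym_quadratics[OF f g h, of x y z, unfolded this]
  show ?thesis unfolding sp by (simp add: algebra_simps)
qed

lemma chi_qform_perm:
  assumes "a + b + c = 0"
  shows "chi3 (b - c) = chi3 (a - b)" "chi3 (c - a) = chi3 (a - b)" "chi3 (b - a) = - chi3 (a - b)"
    "chi3 (a - c) = - chi3 (a - b)" "chi3 (c - b) = - chi3 (a - b)"
    "qform b c = qform a b" "qform c a = qform a b" "qform b a = qform a b" "qform a c = qform a b"
    "qform c b = qform a b"
proof -
  have c: "c = - a - b" using assms by simp
  show 1: "chi3 (b - c) = chi3 (a - b)" by (rule chi3_cong) (simp add: c)
  show 2: "chi3 (c - a) = chi3 (a - b)" by (rule chi3_cong) (simp add: c)
  show "chi3 (b - a) = - chi3 (a - b)" using chi3_minus[of "a - b"] by simp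
  show "chi3 (a - c) = - chi3 (a - b)" using chi3_minus[of "c - a"] 2 by simp
  show "chi3 (c - b) = - chi3 (a - b)" using chi3_minus[of "b - c"] 1 by simp
  show "qform b c = qform a b" "qform c a = qform a b" "qform b a = qform a b" "qform a c = qform a b"
    "qform c b = qform a b"
    by (simp_all add: c qform_def algebra_simps power2_eq_square)
qed

context qfield
begin

definition bosf :: "int \<Rightarrow> int \<Rightarrow> int \<Rightarrow> int \<Rightarrow> 'a" where
  "bosf B K N M = (\<Sum>(a, b, c)\<in>tri B. of_int (chi3 (a - b))
     * q powi (K * ((qform a b - 1) div 3) - (a - c - 2)) * ker3 N M a b c)"

definition bailey_step :: "int \<Rightarrow> (int \<Rightarrow> int \<Rightarrow> 'a) \<Rightarrow> int \<Rightarrow> int \<Rightarrow> 'a" where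
  "bailey_step e h N M = (\<Sum>n\<in>{0..N}. \<Sum>t\<in>{0..M}. q powi (n^2 - n * t + t^2 + e * (n + t))
     * iq (N - n) * iq (M - t) * h n t)"

lemma bailey_step_cong:
  assumes "\<And>n t. 0 \<le> n \<Longrightarrow> n \<le> N \<Longrightarrow> 0 \<le> t \<Longrightarrow> t \<le> M \<Longrightarrow> h n t = h' n t"
  shows "bailey_step e h N M = bailey_step e h' N M"
  unfolding bailey_step_def by (intro sum.cong refl) (simp add: assms)

lemma bailey_step_add: "bailey_step e (\<lambda>n t. h n t + g n t) N M = bailey_step e h N M + bailey_step e g N M"
  unfolding bailey_step_def by (simp add: sum.distrib distrib_left)

lemma bailey_step_cmult: "bailey_step e (\<lambda>n t. c * h n t) N M = c * bailey_step e h N M"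
  unfolding bailey_step_def by (simp add: sum_distrib_left mult_ac)

lemma bailey_step_sum: "bailey_step e (\<lambda>n t. \<Sum>x\<in>A. h x n t) N M = (\<Sum>x\<in>A. bailey_step e (h x) N M)"
proof -
  have "bailey_step e (\<lambda>n t. \<Sum>x\<in>A. h x n t) N M = (\<Sum>n\<in>{0..N}. \<Sum>t\<in>{0..M}. \<Sum>x\<in>A. q powi (n^2 - n * t + t^2 + e * (n + t))
     * iq (N - n) * iq (M - t) * h x n t)"
    unfolding bailey_step_def by (simp add: sum_distrib_left)
  also have "\<dots> = (\<Sum>n\<in>{0..N}. \<Sum>x\<in>A. \<Sum>t\<in>{0..M}. q powi (n^2 - n * t + t^2 + e * (n + t))
     * iq (N - n) * iq (M - t) * h x n t)"
    by (intro sum.cong refl sum.swap)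
  also have "\<dots> = (\<Sum>x\<in>A. bailey_step e (h x) N M)"
    unfolding bailey_step_def by (rule sum.swap)
  finally show ?thesis .
qed

lemma bailey_step_ker3:
  "a + b + c = 0 \<Longrightarrow> bailey_step 0 (\<lambda>n t. ker3 n t a b c) N M = q powi (a^2 - b * c) * ker3 N M a b c"
  unfolding bailey_step_def using a2_bailey_lemma[of a b c N M] by simp

text \<open>The kernel sits at kappa - rho, and |kappa - rho|^2/2 = |kappa|^2/2 - (a - c) + 1, which
  is 3 times the normalised quadratic exponent minus (a - c - 2). So a step adds 3 to the modulus
  and 1 to the multiple of the linear term.\<close>

lemma bailey_step_bos: "bailey_step 0 (bos B K i) N M = bos B (K + 3) (i + 1) N M"
proof -
  have "bailey_step 0 (bos B K i) N M = bailey_step 0 (\<lambda>n t. \<Sum>x\<in>tri B.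
      (case x of (a, b, c) \<Rightarrow> of_int (chi3 (a - b)) * q powi (K * ((qform a b - 1) div 3) - i * (a - c - 2)))
       * (case x of (a, b, c) \<Rightarrow> ker3 n t (a - 1) b (c + 1))) N M"
    unfolding bos_def by (simp add: case_prod_unfold)
  also have "\<dots> = (\<Sum>x\<in>tri B. (case x of (a, b, c) \<Rightarrow> of_int (chi3 (a - b)) * q powi (K * ((qform a b - 1) div 3) - i * (a - c - 2)))
       * bailey_step 0 (\<lambda>n t. case x of (a, b, c) \<Rightarrow> ker3 n t (a - 1) b (c + 1)) N M)"
    unfolding bailey_step_sum bailey_step_cmult ..
  also have "\<dots> = bos B (K + 3) (i + 1) N M"
    unfolding bos_def
  proof (intro sum.cong refl)
    fix x assume x: "x \<in> tri B"
    obtain a b c where abc: "x = (a, b, c)" by (metis prod_cases3)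
    have s: "a + b + c = 0" using x by (simp add: abc tri_def)
    then have s': "a - 1 + b + (c + 1) = 0" by simp
    have c: "c = - a - b" using s by simp
    show "(case x of (a, b, c) \<Rightarrow> of_int (chi3 (a - b)) * q powi (K * ((qform a b - 1) div 3) - i * (a - c - 2)))
       * bailey_step 0 (\<lambda>n t. case x of (a, b, c) \<Rightarrow> ker3 n t (a - 1) b (c + 1)) N M
      = (case x of (a, b, c) \<Rightarrow> of_int (chi3 (a - b))
     * q powi ((K + 3) * ((qform a b - 1) div 3) - (i + 1) * (a - c - 2)) * ker3 N M (a - 1) b (c + 1))"
    proof (cases "chi3 (a - b) = 0")
      case False
      define e where "e = (qform a b - 1) div 3"
      have e: "3 * e = qform a b - 1" unfolding e_def by (rule qform_mod3[OF False])
      have "(a - 1)^2 - b * (c + 1) = 3 * e - (a - c - 2)"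
        unfolding e qform_def c by (simp add: algebra_simps power2_eq_square)
      then have "q powi (K * e - i * (a - c - 2)) * q powi ((a - 1)^2 - b * (c + 1))
         = q powi ((K + 3) * e - (i + 1) * (a - c - 2))"
        unfolding powi_sum by (intro arg_cong[of _ _ "\<lambda>x. q powi x"]) (simp add: algebra_simps)
      then show ?thesis
        unfolding abc prod.case bailey_step_ker3[OF s'] e_def[symmetric]
        by (simp add: mult.assoc[symmetric])
    qed (simp add: abc)
  qed
  finally show ?thesis .
qed

text \<open>The kernel then lives only at a = b = c = 0, where the character vanishes. A Bailey sum
  of \<open>bosf\<close> thus starts at index 1 in both variables.\<close>

lemma bosf_zero: "bosf B K 0 M = 0" "bosf B K N 0 = 0"
proof -
  have z: "chi3 (a - b) = 0 \<or> ker3 N M a b c = 0" if "a + b + c = 0" "N = 0 \<or> M = 0" for a b c N M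
  proof (cases "ker3 N M a b c = 0")
    case False
    from ker3_nonzeroD[OF False] that have "a = b" by auto
    then show ?thesis by simp
  qed simp
  show "bosf B K 0 M = 0"
    unfolding bosf_def by (rule sum.neutral) (use z[where N = 0 and M = M] in \<open>fastforce simp: tri_def\<close>)
  show "bosf B K N 0 = 0"
    unfolding bosf_def by (rule sum.neutral) (use z[where N = N and M = 0] in \<open>fastforce simp: tri_def\<close>)
qed

text \<open>Moving both indices by one turns r^2 - rs + s^2 into n^2 - nt + t^2 + (n + t) + 1: a
  plain step on the unshifted kernel is a step with the weight q^(n+t) in the new indices. The
  constant 1 cancels against the 1 in \<open>qform\<close> = 3e + 1. As the kernel is unshifted, the
  linear exponent stays.\<close>

lemma bailey_step_bosf:
  assumes "N \<ge> 0" "M \<ge> 0"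
  shows "bailey_step 1 (\<lambda>n t. bosf B K (n + 1) (t + 1)) N M = bosf B (K + 3) (N + 1) (M + 1)"
proof -
  have "bailey_step 0 (bosf B K) (N + 1) (M + 1) = bailey_step 0 (\<lambda>n t. \<Sum>x\<in>tri B.
      (case x of (a, b, c) \<Rightarrow> of_int (chi3 (a - b)) * q powi (K * ((qform a b - 1) div 3) - (a - c - 2)))
       * (case x of (a, b, c) \<Rightarrow> ker3 n t a b c)) (N + 1) (M + 1)"
    unfolding bosf_def by (simp add: case_prod_unfold)
  also have "\<dots> = (\<Sum>x\<in>tri B. (case x of (a, b, c) \<Rightarrow> of_int (chi3 (a - b)) * q powi (K * ((qform a b - 1) div 3) - (a - c - 2)))
       * bailey_step 0 (\<lambda>n t. case x of (a, b, c) \<Rightarrow> ker3 n t a b c) (N + 1) (M + 1))"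
    unfolding bailey_step_sum bailey_step_cmult ..
  also have "\<dots> = q * bosf B (K + 3) (N + 1) (M + 1)"
    unfolding bosf_def sum_distrib_left
  proof (intro sum.cong refl)
    fix x assume x: "x \<in> tri B"
    obtain a b c where abc: "x = (a, b, c)" by (metis prod_cases3)
    have s: "a + b + c = 0" using x by (simp add: abc tri_def)
    have c: "c = - a - b" using s by simp
    show "(case x of (a, b, c) \<Rightarrow> of_int (chi3 (a - b)) * q powi (K * ((qform a b - 1) div 3) - (a - c - 2)))
       * bailey_step 0 (\<lambda>n t. case x of (a, b, c) \<Rightarrow> ker3 n t a b c) (N + 1) (M + 1)
      = q * (case x of (a, b, c) \<Rightarrow> of_int (chi3 (a - b))
     * q powi ((K + 3) * ((qform a b - 1) div 3) - (a - c - 2)) * ker3 (N + 1) (M + 1) a b c)"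
    proof (cases "chi3 (a - b) = 0")
      case False
      define e where "e = (qform a b - 1) div 3"
      have e: "3 * e = qform a b - 1" unfolding e_def by (rule qform_mod3[OF False])
      have "a^2 - b * c = 3 * e + 1"
        unfolding e qform_def c by (simp add: algebra_simps power2_eq_square)
      moreover have "q * q powi z = q powi (1 + z)" for z
        using powi_sum[of 1 z] by simp
      ultimately have "q powi (K * e - (a - c - 2)) * q powi (a^2 - b * c)
         = q * q powi ((K + 3) * e - (a - c - 2))"
        by (simp add: powi_sum algebra_simps)
      then show ?thesis
        unfolding abc prod.case bailey_step_ker3[OF s] e_def[symmetric]
        by (simp add: mult_ac)
    qed (simp add: abc)
  qed
  finally have *: "bailey_step 0 (bosf B K) (N + 1) (M + 1) = q * bosf B (K + 3) (N + 1) (M + 1)" .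
  have i0: "{0..n + 1} = insert 0 {1..n + 1}" if "n \<ge> 0" for n :: int using that by auto
  have "bailey_step 0 (bosf B K) (N + 1) (M + 1)
    = (\<Sum>r\<in>{1..N + 1}. \<Sum>s\<in>{1..M + 1}. q powi (r^2 - r * s + s^2) * iq (N + 1 - r) * iq (M + 1 - s) * bosf B K r s)"
    unfolding bailey_step_def using assms by (simp add: i0 bosf_zero)
  also have "\<dots> = (\<Sum>n\<in>{0..N}. \<Sum>s\<in>{1..M + 1}. q powi ((n + 1)^2 - (n + 1) * s + s^2) * iq (N - n) * iq (M + 1 - s) * bosf B K (n + 1) s)"
    by (rule sum.reindex_bij_witness[of _ "\<lambda>n. n + 1" "\<lambda>n. n - 1"]) (auto simp: diff_diff_eq2)
  also have "\<dots> = (\<Sum>n\<in>{0..N}. \<Sum>t\<in>{0..M}. q powi ((n + 1)^2 - (n + 1) * (t + 1) + (t + 1)^2) * iq (N - n) * iq (M - t) * bosf B K (n + 1) (t + 1))"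
    by (rule sum.cong[OF refl], rule sum.reindex_bij_witness[of _ "\<lambda>n. n + 1" "\<lambda>n. n - 1"]) (auto simp: diff_diff_eq2)
  also have "\<dots> = q * bailey_step 1 (\<lambda>n t. bosf B K (n + 1) (t + 1)) N M"
    unfolding bailey_step_def sum_distrib_left
  proof (intro sum.cong refl)
    fix n t :: int
    have "(n + 1)^2 - (n + 1) * (t + 1) + (t + 1)^2 = 1 + (n^2 - n * t + t^2 + 1 * (n + t))"
      by (simp add: algebra_simps power2_eq_square)
    moreover have "q powi (1 + z) = q * q powi z" for z
      using powi_sum[of 1 z] by simp
    ultimately show "q powi ((n + 1)^2 - (n + 1) * (t + 1) + (t + 1)^2) * iq (N - n) * iq (M - t) * bosf B K (n + 1) (t + 1)
      = q * (q powi (n^2 - n * t + t^2 + 1 * (n + t)) * iq (N - n) * iq (M - t) * bosf B K (n + 1) (t + 1))"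
      by (simp only: mult.assoc)
  qed
  finally show ?thesis using * by simp
qed

text \<open>The coefficients are antisymmetric under permutations of $(a,b,c)$, so it suffices that the
  antisymmetrisation of the difference of the two kernels vanishes, a polynomial identity.\<close>

lemma bosf_switch:
  assumes "n \<ge> 0" "m \<ge> 0"
  shows "(1 - q powi (n + m + 1)) * bosf B K (n + 1) (m + 1) = bos B K 1 n m"
proof -
  define p \<alpha> \<beta> where "p = q powi (-1)" and "\<alpha> = q powi (n + 1)" and "\<beta> = q powi (m + 1)"
  \<comment> \<open>The part common to both kernels. Compared with the unshifted kernel at (n+1,
    m+1), the shifted one at (n, m) has its arguments lowered by 0, 1, 2 for N and by 2, 1, 0 for M,
    which produces the six factors of the long product in \<open>switch_poly\<close>.\<close>
  define I where "I = (\<lambda>a b c. qfac (n + m) * (iq (n + 1 - a) * iq (m + 1 + a)) * (iq (n + 1 - b) * iq (m + 1 + b)) * (iq (n + 1 - c) * iq (m + 1 + c)))"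
  define F where "F = (\<lambda>(a, b, c). of_int (chi3 (a - b))
     * q powi (K * ((qform a b - 1) div 3)) * q^2 * I a b c * switch_poly p \<alpha> \<beta> (q powi a) (q powi b) (q powi c))"
  have term_eq: "(1 - q powi (n + m + 1)) * (of_int (chi3 (a - b))
     * q powi (K * ((qform a b - 1) div 3) - (a - c - 2)) * ker3 (n + 1) (m + 1) a b c)
     - of_int (chi3 (a - b)) * q powi (K * ((qform a b - 1) div 3) - 1 * (a - c - 2)) * ker3 n m (a - 1) b (c + 1)
     = F (a, b, c)" if s: "a + b + c = 0" for a b c
  proof -
    define x y z where "x = q powi a" and "y = q powi b" and "z = q powi c"
    have c: "c = - a - b" using s by simp
    have xyz: "y * z^2 = q powi (c - a)"
      unfolding y_def z_def power2_eq_square powi_sum by (rule arg_cong[of _ _ "\<lambda>x. q powi x"]) (simp add: c)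
    have ex: "q powi (K * ((qform a b - 1) div 3) - (a - c - 2)) = q powi (K * ((qform a b - 1) div 3)) * q^2 * q powi (c - a)"
    proof -
      have q2: "q^2 = q powi 2" by (simp add: power_int_def)
      have "K * ((qform a b - 1) div 3) - (a - c - 2) = K * ((qform a b - 1) div 3) + 2 + (c - a)" by simp
      then show ?thesis by (simp only: q2 powi_sum)
    qed
    have pr: "\<alpha> * \<beta> = q powi (n + m + 2)" "\<alpha> * \<beta> * p = q powi (n + m + 1)"
    proof -
      have "n + 1 + (m + 1) = n + m + 2" "n + m + 2 + - 1 = n + m + 1" by simp_all
      then show "\<alpha> * \<beta> = q powi (n + m + 2)" "\<alpha> * \<beta> * p = q powi (n + m + 1)"
        by (simp_all only: \<alpha>_def \<beta>_def p_def powi_sum)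
    qed
    have f: "qfac (n + 1 + (m + 1)) = (1 - \<alpha> * \<beta>) * (1 - \<alpha> * \<beta> * p) * qfac (n + m)"
    proof -
      have e: "n + 1 + (m + 1) = n + m + 2" "n + m + 2 - 1 = n + m + 1" "n + m + 1 - 1 = n + m" by simp_all
      have "qfac (n + m + 2) = (1 - q powi (n + m + 2)) * qfac (n + m + 1)"
        using qfac_rec[of "n + m + 2"] assms by (simp add: e)
      moreover have "qfac (n + m + 1) = (1 - q powi (n + m + 1)) * qfac (n + m)"
        using qfac_rec[of "n + m + 1"] assms by (simp only: e)
      ultimately show ?thesis unfolding e unfolding pr(2) unfolding pr(1) by (simp only: mult_ac)
    qed
    have k1: "ker3 (n + 1) (m + 1) a b c = (1 - \<alpha> * \<beta>) * (1 - \<alpha> * \<beta> * p) * I a b c"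
      unfolding ker3_def f I_def by (simp only: mult_ac)
    have i1: "iq (n - b) = (1 - q powi (n + 1 - b)) * iq (n + 1 - b)"
      using iq_rec[of "n + 1 - b"] by (simp add: algebra_simps)
    have i2: "iq (n - (c + 1)) = (1 - q powi (n - c)) * ((1 - q powi (n + 1 - c)) * iq (n + 1 - c))"
    proof -
      have "iq (n - (c + 1)) = (1 - q powi (n - c)) * iq (n - c)"
        using iq_rec[of "n - c"] by (simp add: diff_diff_eq)
      moreover have "iq (n - c) = (1 - q powi (n + 1 - c)) * iq (n + 1 - c)"
        using iq_rec[of "n + 1 - c"] by (simp add: algebra_simps)
      ultimately show ?thesis by (simp only:)
    qed
    have i3: "iq (m + (a - 1)) = (1 - q powi (m + a)) * ((1 - q powi (m + 1 + a)) * iq (m + 1 + a))"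
    proof -
      have "iq (m + (a - 1)) = (1 - q powi (m + a)) * iq (m + a)"
        using iq_rec[of "m + a"] by (simp add: add_diff_eq)
      moreover have "iq (m + a) = (1 - q powi (m + 1 + a)) * iq (m + 1 + a)"
        using iq_rec[of "m + 1 + a"] by (simp add: algebra_simps)
      ultimately show ?thesis by (simp only:)
    qed
    have i4: "iq (m + b) = (1 - q powi (m + 1 + b)) * iq (m + 1 + b)"
      using iq_rec[of "m + 1 + b"] by (simp add: algebra_simps)
    have i5: "iq (n - (a - 1)) = iq (n + 1 - a)" "iq (m + (c + 1)) = iq (m + 1 + c)"
      by (simp_all add: algebra_simps)
    have e1: "y * (1 - q powi (n + 1 - b)) = y - \<alpha>"
      by (simp add: y_def \<alpha>_def right_diff_distrib powi_sum)
    have e2: "z * (1 - q powi (n + 1 - c)) = z - \<alpha>"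
      by (simp add: z_def \<alpha>_def right_diff_distrib powi_sum)
    have e3: "z * (1 - q powi (n - c)) = z - \<alpha> * p"
    proof -
      have "\<alpha> * p = q powi n" unfolding \<alpha>_def p_def powi_sum by simp
      then show ?thesis by (simp add: z_def right_diff_distrib powi_sum)
    qed
    have e4: "q powi (m + 1 + a) = \<beta> * x" "q powi (m + a) = \<beta> * x * p" "q powi (m + 1 + b) = \<beta> * y"
      unfolding \<beta>_def x_def y_def p_def powi_sum by simp_all
    have "y * z^2 * ker3 n m (a - 1) b (c + 1)
      = (y * (1 - q powi (n + 1 - b))) * (z * (1 - q powi (n + 1 - c))) * (z * (1 - q powi (n - c)))
        * (1 - q powi (m + 1 + a)) * (1 - q powi (m + a)) * (1 - q powi (m + 1 + b)) * I a b c"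
      unfolding ker3_def i1 i2 i3 i4 i5 I_def power2_eq_square by (simp only: mult_ac)
    also have "\<dots> = (y - \<alpha>) * (z - \<alpha>) * (z - \<alpha> * p) * (1 - \<beta> * x) * (1 - \<beta> * x * p) * (1 - \<beta> * y) * I a b c"
      unfolding e1 e2 e3 e4 ..
    finally have k2: "y * z^2 * ker3 n m (a - 1) b (c + 1)
      = (y - \<alpha>) * (z - \<alpha>) * (z - \<alpha> * p) * (1 - \<beta> * x) * (1 - \<beta> * x * p) * (1 - \<beta> * y) * I a b c" .
    let ?A = "of_int (chi3 (a - b)) * q powi (K * ((qform a b - 1) div 3)) * q^2"
    have "(1 - q powi (n + m + 1)) * (of_int (chi3 (a - b))
     * q powi (K * ((qform a b - 1) div 3) - (a - c - 2)) * ker3 (n + 1) (m + 1) a b c)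
     - of_int (chi3 (a - b)) * q powi (K * ((qform a b - 1) div 3) - 1 * (a - c - 2)) * ker3 n m (a - 1) b (c + 1)
     = ?A * ((1 - \<alpha> * \<beta> * p) * (y * z^2) * ker3 (n + 1) (m + 1) a b c - y * z^2 * ker3 n m (a - 1) b (c + 1))"
      unfolding mult_1 ex xyz[symmetric] pr[symmetric] by (simp add: algebra_simps)
    also have "\<dots> = ?A * (I a b c * switch_poly p \<alpha> \<beta> x y z)"
      unfolding k1 k2 switch_poly_def by (simp add: algebra_simps power2_eq_square)
    also have "\<dots> = F (a, b, c)"
      by (simp add: F_def x_def y_def z_def mult_ac)
    finally show ?thesis .
  qed
  have "sum F (tri B) = 0"
  proof (rule sum_tri_antisym)
    fix a b c :: int assume s: "a + b + c = 0"
    define x y z A where "x = q powi a" and "y = q powi b" and "z = q powi c"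
      and "A = of_int (chi3 (a - b)) * q powi (K * ((qform a b - 1) div 3)) * q^2 * I a b c"
    have I: "I b c a = I a b c" "I c a b = I a b c" "I b a c = I a b c" "I a c b = I a b c" "I c b a = I a b c"
      by (simp_all add: I_def mult_ac)
    have "F (a, b, c) + F (b, c, a) + F (c, a, b) + F (b, a, c) + F (a, c, b) + F (c, b, a)
      = A * (switch_poly p \<alpha> \<beta> x y z + switch_poly p \<alpha> \<beta> y z x + switch_poly p \<alpha> \<beta> z x y
    - switch_poly p \<alpha> \<beta> y x z - switch_poly p \<alpha> \<beta> x z y - switch_poly p \<alpha> \<beta> z y x)"
      unfolding F_def prod.case chi_qform_perm[OF s] I A_def x_def y_def z_def
      by (simp add: algebra_simps)
    then show "F (a, b, c) + F (b, c, a) + F (c, a, b) + F (b, a, c) + F (a, c, b) + F (c, b, a) = 0"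
      unfolding switch_poly_antisym by simp
  qed
  moreover have "sum F (tri B) = (1 - q powi (n + m + 1)) * bosf B K (n + 1) (m + 1) - bos B K 1 n m"
    unfolding bosf_def bos_def sum_distrib_left sum_subtractf[symmetric]
    by (rule sum.cong[OF refl]) (use term_eq in \<open>auto simp: tri_def\<close>)
  ultimately show ?thesis by simp
qed

lemma bosf_seed:
  assumes "0 \<le> N" "0 \<le> M" "N + M + 1 \<le> B"
  shows "bosf B 2 (N + 1) (M + 1) = q powi (2 * N * M) * iq N * iq M * iq (N + M + 1)"
proof -
  have nz: "1 - q powi (N + M + 1) \<noteq> 0" using powi_neq_1[of "N + M + 1"] assms by simp
  have "(1 - q powi (N + M + 1)) * bosf B 2 (N + 1) (M + 1) = q powi (2 * N * M) * iq N * iq M * iq (N + M)"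
    using bosf_switch[of N M B 2] seed[of N M B] assms by simp
  also have "iq (N + M) = (1 - q powi (N + M + 1)) * iq (N + M + 1)"
    using iq_rec[of "N + M + 1"] by simp
  finally have "(1 - q powi (N + M + 1)) * bosf B 2 (N + 1) (M + 1)
    = (1 - q powi (N + M + 1)) * (q powi (2 * N * M) * iq N * iq M * iq (N + M + 1))"
    by (simp only: mult_ac)
  with nz show ?thesis by simp
qed

lemma bailey_step0_bosf:
  assumes "N \<ge> 0" "M \<ge> 0"
  shows "bailey_step 0 (\<lambda>n t. bosf B K (n + 1) (t + 1)) N M
    = bos B (K + 3) 2 N M + q * bosf B (K + 3) (N + 1) (M + 1)"
proof -
  have "bailey_step 0 (\<lambda>n t. bosf B K (n + 1) (t + 1)) N M
      = bailey_step 0 (bos B K 1) N M + q * bailey_step 1 (\<lambda>n t. bosf B K (n + 1) (t + 1)) N M"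
    unfolding bailey_step_def sum_distrib_left sum.distrib[symmetric]
  proof (intro sum.cong refl)
    fix n t assume "n \<in> {0..N}" "t \<in> {0..M}"
    then have nt: "n \<ge> 0" "t \<ge> 0" by simp_all
    have "q powi (n^2 - n * t + t^2 + 0 * (n + t)) * q powi (n + t + 1) = q * q powi (n^2 - n * t + t^2 + 1 * (n + t))"
    proof -
      have "q * q powi z = q powi (1 + z)" for z using powi_sum[of 1 z] by simp
      then show ?thesis by (simp add: powi_sum algebra_simps)
    qed
    then have X: "q powi (n^2 - n * t + t^2 + 0 * (n + t)) * q powi (n + t + 1) * w = q * q powi (n^2 - n * t + t^2 + 1 * (n + t)) * w" for w
      by simp
    show "q powi (n^2 - n * t + t^2 + 0 * (n + t)) * iq (N - n) * iq (M - t) * bosf B K (n + 1) (t + 1)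
      = q powi (n^2 - n * t + t^2 + 0 * (n + t)) * iq (N - n) * iq (M - t) * bos B K 1 n t
       + q * (q powi (n^2 - n * t + t^2 + 1 * (n + t)) * iq (N - n) * iq (M - t) * bosf B K (n + 1) (t + 1))"
      unfolding bosf_switch[OF nt, symmetric]
      using X[of "iq (N - n) * iq (M - t) * bosf B K (n + 1) (t + 1)"]
      by (simp add: algebra_simps)
  qed
  then show ?thesis
    using bailey_step_bos[of B K 1 N M] by (simp add: bailey_step_bosf assms)
qed

subsection \<open>The fermionic chain\<close>

text \<open>After the first weighted step, which raises the modulus from 2 to 5, the sum over t is
  again \<open>sum_powi_iq_iq\<close>. The surviving M + n + 1 is the argument M + m - n + 1 of
  \<open>ferm_sum\<close> at m = 2n; this is the source of the convention for m_k.\<close>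

lemma bosf_eval_first:
  assumes "0 \<le> N" "0 \<le> M" "N + M + 1 \<le> B"
  shows "bosf B 5 (N + 1) (M + 1)
    = (\<Sum>n\<in>{0..N}. q powi (n^2 + n) * iq (N - n) * iq n * iq M * iq (M + n + 1))"
proof -
  have "bosf B 5 (N + 1) (M + 1) = bailey_step 1 (\<lambda>n t. bosf B 2 (n + 1) (t + 1)) N M"
    using bailey_step_bosf[of N M B 2] assms by simp
  also have "\<dots> = bailey_step 1 (\<lambda>n t. q powi (2 * n * t) * iq n * iq t * iq (n + t + 1)) N M"
    by (rule bailey_step_cong, rule bosf_seed) (use assms in auto)
  also have "\<dots> = (\<Sum>n\<in>{0..N}. q powi (n^2 + n) * iq (N - n) * iq n
      * (\<Sum>t\<in>{0..M}. q powi (t * (t + (n + 1))) * iq (M - t) * iq t * iq (t + (n + 1))))"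
    unfolding bailey_step_def sum_distrib_left
  proof (intro sum.cong refl)
    fix n t :: int
    have "n^2 - n * t + t^2 + 1 * (n + t) + 2 * n * t = n^2 + n + t * (t + (n + 1))"
      by (simp add: algebra_simps power2_eq_square)
    then have pw: "q powi (n^2 - n * t + t^2 + 1 * (n + t)) * q powi (2 * n * t) * z
        = q powi (n^2 + n) * q powi (t * (t + (n + 1))) * z" for z
      by (simp only: powi_sum)
    have i: "n + t + 1 = t + (n + 1)" by simp
    show "q powi (n^2 - n * t + t^2 + 1 * (n + t)) * iq (N - n) * iq (M - t)
        * (q powi (2 * n * t) * iq n * iq t * iq (n + t + 1))
      = q powi (n^2 + n) * iq (N - n) * iq n * (q powi (t * (t + (n + 1))) * iq (M - t) * iq t * iq (t + (n + 1)))"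
      using pw[of "iq (N - n) * iq (M - t) * iq n * iq t * iq (t + (n + 1))"]
      unfolding i by (simp only: mult_ac)
  qed
  also have "\<dots> = (\<Sum>n\<in>{0..N}. q powi (n^2 + n) * iq (N - n) * iq n * (iq M * iq (M + (n + 1))))"
    by (simp add: sum_powi_iq_iq)
  finally show ?thesis by (simp add: mult_ac add_ac)
qed

text \<open>Here \<open>d\<close> stands for $k-i$ and \<open>D\<close> for $k-s$, so that \<open>lin\<close> is the indicator
  of $i \geq s$ and \<open>d = D\<close> in the successor case is the condition $i = s-1$.\<close>

definition lin :: "nat \<Rightarrow> nat \<Rightarrow> int" where
  "lin D d = (if d \<le> D then 1 else 0)"

primrec ferm :: "nat \<Rightarrow> nat \<Rightarrow> int \<Rightarrow> int \<Rightarrow> 'a" where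
  "ferm D 0 n m = (if m = 2 * n then q powi (n^2 + n) else 0)"
| "ferm D (Suc d) n m = q powi (n^2 - n * m + m^2 + lin D (Suc d) * (n + m))
     * (\<Sum>n'\<in>{0..n}. \<Sum>m'\<in>{0..2 * n' + 1 - lin D d}.
         qbi n n' * qbi (n - n' + m' + of_bool (d = D)) m * ferm D d n' m')"

text \<open>The multisum from index k - d on, completed by the factors that allow one more Bailey
  step. As N and M grow, all of these except \<open>iq n\<close> tend to 1/(q)_inf, and
  \<open>iq n\<close> is the 1/(q)_(n_1) of the theorem.\<close>

definition ferm_sum :: "nat \<Rightarrow> nat \<Rightarrow> int \<Rightarrow> int \<Rightarrow> 'a" where
  "ferm_sum D d N M = (\<Sum>n\<in>{0..N}. \<Sum>m\<in>{0..2 * n + 1 - lin D d}.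
     iq (N - n) * iq M * iq (M + m - n + lin D d) * iq n * ferm D d n m)"

text \<open>The shifts fit together because $\delta_{i,s-1} + [i \geq s] = [i+1 \geq s]$.\<close>

lemma ferm_sum_step: "ferm_sum D (Suc d) N M = bailey_step (lin D (Suc d)) (ferm_sum D d) N M"
proof -
  define e e' \<delta> where "e = lin D (Suc d)" and "e' = lin D d" and "\<delta> = (of_bool (d = D) :: int)"
  have ee: "\<delta> + e = e'" "\<delta> \<ge> 0" "e' \<le> 1" "e \<ge> 0"
    by (auto simp: \<delta>_def e_def e'_def lin_def)
  let ?f = "\<lambda>n m n' m'. iq (N - n) * iq M * iq (M + m - n + e) * iq n
      * (q powi (n^2 - n * m + m^2 + e * (n + m)) * (qbi n n' * qbi (n - n' + m' + \<delta>) m * ferm D d n' m'))"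
  let ?g = "\<lambda>n t n' m'. q powi (n^2 - n * t + t^2 + e * (n + t)) * iq (N - n) * iq (M - t)
      * (iq (n - n') * iq t * iq (t + m' - n' + e') * iq n' * ferm D d n' m')"
  have "ferm_sum D (Suc d) N M = (\<Sum>n\<in>{0..N}. \<Sum>m\<in>{0..2 * n + 1 - e}. \<Sum>n'\<in>{0..n}. \<Sum>m'\<in>{0..2 * n' + 1 - e'}. ?f n m n' m')"
    unfolding ferm_sum_def ferm.simps e_def e'_def \<delta>_def by (simp only: sum_distrib_left)
  also have "\<dots> = (\<Sum>n\<in>{0..N}. \<Sum>n'\<in>{0..n}. \<Sum>m\<in>{0..2 * n + 1 - e}. \<Sum>m'\<in>{0..2 * n' + 1 - e'}. ?f n m n' m')"
    by (rule sum.cong[OF refl], rule sum.swap)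
  also have "\<dots> = (\<Sum>n\<in>{0..N}. \<Sum>n'\<in>{0..n}. \<Sum>m'\<in>{0..2 * n' + 1 - e'}. \<Sum>m\<in>{0..2 * n + 1 - e}. ?f n m n' m')"
    by (rule sum.cong[OF refl], rule sum.cong[OF refl], rule sum.swap)
  also have "\<dots> = (\<Sum>n\<in>{0..N}. \<Sum>n'\<in>{0..n}. \<Sum>m'\<in>{0..2 * n' + 1 - e'}. \<Sum>t\<in>{0..M}. ?g n t n' m')"
  proof (rule sum.cong[OF refl], rule sum.cong[OF refl], rule sum.cong[OF refl])
    fix n n' m' assume A: "n \<in> {0..N}" "n' \<in> {0..n}" "m' \<in> {0..2 * n' + 1 - e'}"
    \<comment> \<open>\<open>sum_qbi_iq\<close> is used with r = n - e, which absorbs the linear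
      weight: n^2 - nm + m^2 + e(n + m) = n^2 + en + m^2 - (n - e)m.\<close>
    have b: "n - e + (m' - n' + e') = n - n' + m' + \<delta>" using ee by simp
    have S: "(\<Sum>m\<in>{0..2 * n + 1 - e}. q powi (m^2 - (n - e) * m) * qbi (n - e + (m' - n' + e')) m * iq M * iq (M + m - (n - e)))
      = (\<Sum>t\<in>{0..M}. q powi (t^2 - (n - e) * t) * iq (M - t) * iq t * iq (t + (m' - n' + e')))"
      by (rule sum_qbi_iq) (use A ee in \<open>auto simp: b\<close>)
    have qn: "iq n * qbi n n' = iq n' * iq (n - n')"
      using A by (simp add: qbi_def iq_nonneg)
    let ?C = "q powi (n^2 + e * n) * iq (N - n) * (iq n * qbi n n') * ferm D d n' m'"
    have pw: "q powi (n^2 + e * n) * q powi (x^2 - (n - e) * x) = q powi (n^2 - n * x + x^2 + e * (n + x))" for x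
      unfolding powi_sum by (rule arg_cong[of _ _ "\<lambda>x. q powi x"]) (simp add: algebra_simps)
    have arg: "M + m - n + e = M + m - (n - e)" "t + m' - n' + e' = t + (m' - n' + e')" for m t
      by simp_all
    have "(\<Sum>m\<in>{0..2 * n + 1 - e}. ?f n m n' m')
      = ?C * (\<Sum>m\<in>{0..2 * n + 1 - e}. q powi (m^2 - (n - e) * m) * qbi (n - e + (m' - n' + e')) m * iq M * iq (M + m - (n - e)))"
      unfolding sum_distrib_left pw[symmetric] b arg by (rule sum.cong[OF refl]) (simp only: mult_ac)
    also have "\<dots> = (\<Sum>t\<in>{0..M}. ?g n t n' m')"
      unfolding S qn sum_distrib_left pw[symmetric] arg by (rule sum.cong[OF refl]) (simp only: mult_ac)
    finally show "(\<Sum>m\<in>{0..2 * n + 1 - e}. ?f n m n' m')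
      = (\<Sum>t\<in>{0..M}. ?g n t n' m')" .
  qed
  also have "\<dots> = (\<Sum>n\<in>{0..N}. \<Sum>n'\<in>{0..n}. \<Sum>t\<in>{0..M}. \<Sum>m'\<in>{0..2 * n' + 1 - e'}. ?g n t n' m')"
    by (rule sum.cong[OF refl], rule sum.cong[OF refl], rule sum.swap)
  also have "\<dots> = (\<Sum>n\<in>{0..N}. \<Sum>t\<in>{0..M}. \<Sum>n'\<in>{0..n}. \<Sum>m'\<in>{0..2 * n' + 1 - e'}. ?g n t n' m')"
    by (rule sum.cong[OF refl], rule sum.swap)
  also have "\<dots> = bailey_step e (ferm_sum D d) N M"
    unfolding bailey_step_def ferm_sum_def e'_def by (simp only: sum_distrib_left)
  finally show ?thesis by (simp add: e_def)
qed

text \<open>Truncated subtraction covers both regimes. For d <= D the sum over l is empty and the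
  power of q is 1; beyond that every step raises the l of the terms already present and splits off a
  new one with l = 2. The modulus is 2 plus 3 for each of d + 1 steps.\<close>

lemma ferm_sum_eq:
  assumes "0 \<le> N" "0 \<le> M" "N + M + 1 \<le> B"
  shows "ferm_sum D d N M
    = (\<Sum>l\<in>{2..d - D + 1}. q ^ (d - D + 1 - l) * bos B (3 * int d + 5) (int l) N M)
      + q ^ (d - D) * bosf B (3 * int d + 5) (N + 1) (M + 1)"
  using assms
proof (induction d arbitrary: N M)
  case 0
  have "ferm_sum D 0 N M = (\<Sum>n\<in>{0..N}. \<Sum>m\<in>{0..2 * n}.
      if m = 2 * n then iq (N - n) * iq M * iq (M + m - n + 1) * iq n * q powi (n^2 + n) else 0)"
    unfolding ferm_sum_def by (intro sum.cong) (auto simp: lin_def)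
  also have "\<dots> = bosf B 5 (N + 1) (M + 1)"
    unfolding bosf_eval_first[OF 0]
    by (rule sum.cong[OF refl]) (simp add: algebra_simps)
  finally show ?case by simp
next
  case (Suc d)
  let ?h = "\<lambda>n t. (\<Sum>l\<in>{2..d - D + 1}. q ^ (d - D + 1 - l) * bos B (3 * int d + 5) (int l) n t)
      + q ^ (d - D) * bosf B (3 * int d + 5) (n + 1) (t + 1)"
  have K: "3 * int d + 5 + 3 = 3 * int (Suc d) + 5" by simp
  have "ferm_sum D (Suc d) N M = bailey_step (lin D (Suc d)) ?h N M"
    unfolding ferm_sum_step by (rule bailey_step_cong, rule Suc.IH) (use Suc.prems in auto)
  also have "\<dots> = (\<Sum>l\<in>{2..Suc d - D + 1}. q ^ (Suc d - D + 1 - l) * bos B (3 * int (Suc d) + 5) (int l) N M)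
      + q ^ (Suc d - D) * bosf B (3 * int (Suc d) + 5) (N + 1) (M + 1)"
  proof (cases "Suc d \<le> D")
    case True
    then show ?thesis
      using bailey_step_bosf[OF Suc.prems(1,2), of B "3 * int d + 5"] by (simp add: lin_def K add_ac)
  next
    case False
    define j where "j = d - D"
    have j: "Suc d - D = Suc j" using False by (simp add: j_def)
    have "bailey_step 0 ?h N M = (\<Sum>l\<in>{2..j + 1}. q ^ (j + 1 - l) * bos B (3 * int (Suc d) + 5) (int l + 1) N M)
      + q ^ j * (bos B (3 * int (Suc d) + 5) 2 N M + q * bosf B (3 * int (Suc d) + 5) (N + 1) (M + 1))"
      unfolding bailey_step_add bailey_step_sum bailey_step_cmult bailey_step_bos
        bailey_step0_bosf[OF Suc.prems(1,2)] K j_def ..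
    also have "(\<Sum>l\<in>{2..j + 1}. q ^ (j + 1 - l) * bos B (3 * int (Suc d) + 5) (int l + 1) N M)
      = (\<Sum>l\<in>{3..j + 2}. q ^ (j + 2 - l) * bos B (3 * int (Suc d) + 5) (int l) N M)"
      by (rule sum.reindex_bij_witness[of _ "\<lambda>l. l - 1" "\<lambda>l. l + 1"]) (auto simp: add_ac)
    finally have "bailey_step 0 ?h N M = (\<Sum>l\<in>{3..j + 2}. q ^ (j + 2 - l) * bos B (3 * int (Suc d) + 5) (int l) N M)
      + q ^ j * (bos B (3 * int (Suc d) + 5) 2 N M + q * bosf B (3 * int (Suc d) + 5) (N + 1) (M + 1))" .
    moreover have "{2..j + 2} = insert 2 {3..j + 2}" by auto
    ultimately show ?thesis
      using False unfolding j by (simp add: lin_def algebra_simps)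
  qed
  finally show ?case .
qed

section \<open>The q-binomial theorem and the finite Jacobi triple product\<close>

lemma wt_pascal:
  assumes "n \<ge> 0"
  shows "wt (n + 1) k = wt n k - q powi n * wt n (k - 1)"
proof -
  have a: "iq (n - k) = (1 - q powi (n + 1 - k)) * iq (n + 1 - k)"
    using iq_rec[of "n + 1 - k"] by (simp add: algebra_simps)
  have b: "iq (n - (k - 1)) = iq (n + 1 - k)" by (simp add: algebra_simps)
  have c: "qfac (n + 1) = (1 - q powi (n + 1)) * qfac n"
    using qfac_rec[of "n + 1"] assms by simp
  have d: "q powi (n + 1) = q powi (n + 1 - k) * q powi k" by (simp add: powi_sum)
  have e: "q powi n * q powi ((k - 1) * (k - 1 - 1) div 2) = q powi (n + 1 - k) * q powi (k * (k - 1) div 2)"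
    using tri_step[of "k - 1"] by (simp add: powi_sum)
  have s: "(-1 :: 'a) powi (k - 1) = - ((-1) powi k)"
    by (simp add: power_int_diff)
  have "q powi n * wt n (k - 1) = - ((-1) powi k * (q powi n * q powi ((k - 1) * (k - 1 - 1) div 2))
      * (qfac n * ((1 - q powi k) * iq k) * iq (n + 1 - k)))"
    unfolding wt_def qbi_def s b iq_rec[of k] by simp
  then show ?thesis
    unfolding e wt_def qbi_def a c d by (simp add: algebra_simps)
qed

lemma q_binomial_thm:
  assumes "z \<noteq> 0"
  shows "(\<Prod>i<m. 1 - z * q ^ i) = (\<Sum>k\<in>{0..int m}. wt (int m) k * z powi k)"
proof (induction m)
  case 0
  then show ?case by (simp add: wt_def qbi_def)
next
  case (Suc m)
  let ?n = "int m"
  have n: "int (Suc m) = ?n + 1" by simp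
  have z: "z powi (k + 1) = z * z powi k" for k
    using assms by (simp add: power_int_add)
  have wz: "wt ?n k = 0" if "k < 0 \<or> k > ?n" for k
    using that by (auto simp: wt_def qbi_def)
  have "(\<Sum>k\<in>{0..?n + 1}. wt (?n + 1) k * z powi k)
      = (\<Sum>k\<in>{0..?n + 1}. wt ?n k * z powi k) - q powi ?n * (\<Sum>k\<in>{0..?n + 1}. wt ?n (k - 1) * z powi k)"
  proof -
    have wp: "wt (?n + 1) k = wt ?n k - q powi ?n * wt ?n (k - 1)" for k
      by (rule wt_pascal) simp
    show ?thesis
      unfolding wp by (simp only: left_diff_distrib sum_subtractf sum_distrib_left mult.assoc)
  qed
  also have "(\<Sum>k\<in>{0..?n + 1}. wt ?n k * z powi k) = (\<Sum>k\<in>{0..?n}. wt ?n k * z powi k)"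
    by (rule sum.mono_neutral_right) (auto simp: wz)
  also have "(\<Sum>k\<in>{0..?n + 1}. wt ?n (k - 1) * z powi k) = (\<Sum>k\<in>{1..?n + 1}. wt ?n (k - 1) * z powi k)"
    by (rule sum.mono_neutral_right) (auto simp: wz)
  also have "\<dots> = (\<Sum>k\<in>{0..?n}. wt ?n k * z powi (k + 1))"
    by (rule sum.reindex_bij_witness[of _ "\<lambda>k. k + 1" "\<lambda>k. k - 1"]) auto
  also have "\<dots> = z * (\<Sum>k\<in>{0..?n}. wt ?n k * z powi k)"
    by (simp add: z sum_distrib_left mult_ac)
  finally show ?case
    unfolding n prod.lessThan_Suc Suc.IH by (simp add: algebra_simps)
qed

text \<open>The q-binomial theorem with 2N factors at z = x q^(-N). The last N factors are 1 - x
  q^i; the first N, read backwards, become 1 - q^(i+1)/x once -x q^(-i-1) is taken out.\<close>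

lemma finite_jacobi_triple:
  assumes x: "x \<noteq> 0"
  shows "(\<Prod>i<N. (1 - x * q ^ i) * (1 - q ^ (i + 1) / x))
    = (\<Sum>n\<in>{- int N..int N}. (-1) powi n * q powi (n * (n - 1) div 2) * x powi n * qbi (2 * int N) (int N + n))"
proof -
  define z where "z = x * q powi (- int N)"
  have z: "z \<noteq> 0" using x by (simp add: z_def)
  define T where "T = int N * (int N + 1) div 2"
  have qi: "q ^ i = q powi (int i)" for i by simp
  have "(\<Prod>i<2 * N. 1 - z * q ^ i) = (\<Prod>i\<in>{..<N}. 1 - z * q ^ i) * (\<Prod>i\<in>{N..<2 * N}. 1 - z * q ^ i)"
    by (subst prod.union_disjoint[symmetric]) (auto intro: prod.cong)
  also have "(\<Prod>i\<in>{N..<2 * N}. 1 - z * q ^ i) = (\<Prod>i<N. 1 - x * q ^ i)"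
  proof (rule prod.reindex_bij_witness[of _ "\<lambda>i. N + i" "\<lambda>i. i - N"])
    fix i assume "i \<in> {N..<2 * N}"
    then have "q powi (- int N) * q ^ i = q ^ (i - N)"
      unfolding qi powi_sum by (simp add: of_nat_diff)
    then show "1 - x * q ^ (i - N) = 1 - z * q ^ i"
      unfolding z_def by (simp only: mult.assoc)
  qed auto
  also have "(\<Prod>i\<in>{..<N}. 1 - z * q ^ i) = (\<Prod>i<N. (- (x * q powi (- int (i + 1)))) * (1 - q ^ (i + 1) / x))"
  proof (rule prod.reindex_bij_witness[of _ "\<lambda>i. N - 1 - i" "\<lambda>i. N - 1 - i"])
    fix i assume i: "i \<in> {..<N}"
    have "q powi (- int N) * q ^ i = q powi (- int (N - 1 - i + 1))"
      unfolding qi powi_sum using i by (intro arg_cong[of _ _ "\<lambda>x. q powi x"]) (simp add: of_nat_diff)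
    moreover have "q powi (- int (N - 1 - i + 1)) * q ^ (N - 1 - i + 1) = 1"
      unfolding qi powi_sum by simp
    ultimately show "(- (x * q powi (- int (N - 1 - i + 1)))) * (1 - q ^ (N - 1 - i + 1) / x) = 1 - z * q ^ i"
      using x unfolding z_def by (simp only: mult.assoc) (simp add: right_diff_distrib)
  qed auto
  also have "\<dots> = (\<Prod>i<N. - (x * q powi (- int (i + 1)))) * (\<Prod>i<N. 1 - q ^ (i + 1) / x)"
    by (rule prod.distrib)
  also have "(\<Prod>i<N. - (x * q powi (- int (i + 1)))) = (-1) powi (int N) * x powi (int N) * q powi (- T)"
    unfolding T_def
  proof (induction N)
    case (Suc N)
    have "q powi (- (int N * (int N + 1) div 2)) * q powi (- int (N + 1)) = q powi (- (int (Suc N) * (int (Suc N) + 1) div 2))"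
      using tri_step[of "int N + 1"] by (simp add: powi_sum algebra_simps)
    note e = this
    have s: "(-1 :: 'a) powi int (Suc N) = - ((-1) powi int N)" "x powi int (Suc N) = x * x powi int N"
      by (simp_all only: power_int_of_nat power_Suc mult_minus1)
    show ?case
      unfolding prod.lessThan_Suc Suc.IH s e[symmetric] by (simp only: mult_ac mult_minus_left mult_minus_right)
  qed simp
  finally have A: "(\<Prod>i<2 * N. 1 - z * q ^ i)
    = (-1) powi (int N) * x powi (int N) * q powi (- T) * (\<Prod>i<N. (1 - x * q ^ i) * (1 - q ^ (i + 1) / x))"
    by (simp only: prod.distrib mult_ac)
  have "(\<Prod>i<2 * N. 1 - z * q ^ i) = (\<Sum>k\<in>{0..int (2 * N)}. wt (int (2 * N)) k * z powi k)"
    by (rule q_binomial_thm[OF z])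
  also have "\<dots> = (\<Sum>n\<in>{- int N..int N}. wt (2 * int N) (int N + n) * z powi (int N + n))"
    by (rule sum.reindex_bij_witness[of _ "\<lambda>n. int N + n" "\<lambda>k. k - int N"]) auto
  also have "\<dots> = (-1) powi (int N) * x powi (int N) * q powi (- T)
     * (\<Sum>n\<in>{- int N..int N}. (-1) powi n * q powi (n * (n - 1) div 2) * x powi n * qbi (2 * int N) (int N + n))"
    unfolding sum_distrib_left
  proof (intro sum.cong refl)
    fix n
    let ?t = "(int N + n) * (int N + n - 1) div 2"
    have "2 * (?t - int N * (int N + n)) = 2 * (n * (n - 1) div 2 - T)"
      using tri_double[of "int N + n"] tri_double[of n] tri_double[of "int N + 1"]
      by (simp add: T_def algebra_simps)
    then have "?t - int N * (int N + n) = n * (n - 1) div 2 - T" by simp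
    then have "q powi ?t * q powi (- int N * (int N + n)) = q powi (- T) * q powi (n * (n - 1) div 2)"
      by (simp add: powi_sum)
    moreover have "z powi (int N + n) = x powi (int N) * x powi n * q powi (- int N * (int N + n))"
    proof -
      have "x powi (int N + n) = x powi (int N) * x powi n"
        using x by (simp add: power_int_add)
      then show ?thesis
        by (simp only: z_def power_int_mult_distrib power_int_mult)
    qed
    moreover have "(-1 :: 'a) powi (int N + n) = (-1) powi (int N) * (-1) powi n"
      by (simp add: power_int_add)
    ultimately show "wt (2 * int N) (int N + n) * z powi (int N + n)
      = (-1) powi (int N) * x powi (int N) * q powi (- T)
       * ((-1) powi n * q powi (n * (n - 1) div 2) * x powi n * qbi (2 * int N) (int N + n))"
      unfolding wt_def by (simp only: mult_ac)
  qed
  finally show ?thesis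
    using A x by simp
qed

end

subsection \<open>Coefficientwise approximation of power series\<close>

text \<open>Congruence modulo X^d. Limits are handled as congruences for each d; the topology enters
  only where the infinite product and the infinite sum themselves are identified.\<close>

definition agree :: "nat \<Rightarrow> 'a fps \<Rightarrow> 'a fps \<Rightarrow> bool" where
  "agree d f g \<longleftrightarrow> (\<forall>n<d. fps_nth f n = fps_nth g n)"

lemma agree_refl [simp]: "agree d f f"
  by (simp add: agree_def)

lemma agree_sym: "agree d f g \<Longrightarrow> agree d g f"
  by (simp add: agree_def)

lemma agree_trans [trans]: "agree d f g \<Longrightarrow> agree d g h \<Longrightarrow> agree d f h"
  by (simp add: agree_def)

lemma agree_eqI: "(\<And>d. agree d f g) \<Longrightarrow> f = g"
  by (metis agree_def fps_ext lessI)

lemma agree_add: "agree d f g \<Longrightarrow> agree d f' g' \<Longrightarrow> agree d (f + f' :: 'a::comm_ring_1 fps) (g + g')"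
  by (simp add: agree_def)

lemma agree_mult: "agree d f g \<Longrightarrow> agree d f' g' \<Longrightarrow> agree d (f * f' :: 'a::comm_ring_1 fps) (g * g')"
  by (simp add: agree_def fps_mult_nth)

lemma agree_sum: "(\<And>i. i \<in> A \<Longrightarrow> agree d (f i) (g i :: 'a::comm_ring_1 fps)) \<Longrightarrow> agree d (sum f A) (sum g A)"
  by (simp add: agree_def fps_sum_nth)

lemma agree_inverse:
  fixes f g :: "'a::field fps"
  assumes "agree d f g" "fps_nth f 0 \<noteq> 0" "fps_nth g 0 \<noteq> 0"
  shows "agree d (inverse f) (inverse g)"
proof -
  have "inverse f = inverse f * (g * inverse g)"
    using assms by (simp add: inverse_mult_eq_1')
  also have "agree d \<dots> (inverse f * (f * inverse g))"
    by (intro agree_mult agree_refl agree_sym[OF assms(1)])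
  also have "inverse f * (f * inverse g) = inverse g"
    using assms by (simp add: mult.assoc[symmetric] inverse_mult_eq_1)
  finally show ?thesis .
qed

lemma agree_X_power: "d \<le> e \<Longrightarrow> agree d (fps_X ^ e * f :: 'a::comm_ring_1 fps) 0"
  by (simp add: agree_def fps_X_power_mult_nth)

section \<open>Truncated products, their limits and their images among Laurent series\<close>

definition pfin :: "nat \<Rightarrow> nat \<Rightarrow> nat \<Rightarrow> 'a::field fps" where
  "pfin K j N = (\<Prod>i<N. 1 - fps_X ^ (j + K * i))"

abbreviation pinf :: "nat \<Rightarrow> nat \<Rightarrow> 'a::field fps" where
  "pinf K j \<equiv> qpoch_inf (fps_X ^ j) (fps_X ^ K)"

lemma agree_pfin:
  assumes "K \<ge> 1" "j \<ge> 1" "d \<le> N" "N \<le> M"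
  shows "agree d (pfin K j N) (pfin K j M :: 'a::field fps)"
  using assms(4)
proof (induction M rule: dec_induct)
  case (step M)
  have "d \<le> K * M" using assms step by (metis le_trans mult_le_mono1 nat_mult_1)
  have "agree d (pfin K j M * 1) (pfin K j M * (1 - fps_X ^ (j + K * M)))"
    by (intro agree_mult agree_refl) (use \<open>d \<le> K * M\<close> in \<open>auto simp: agree_def\<close>)
  from agree_trans[OF step.IH this[unfolded mult_1_right]] show ?case
    by (simp add: pfin_def)
qed simp

lemma pfin_nth_0: "j \<ge> 1 \<Longrightarrow> fps_nth (pfin K j N :: 'a::field fps) 0 = 1"
  unfolding pfin_def by (induction N) auto

lemma agree_pinf:
  assumes "K \<ge> 1" "j \<ge> 1" "d \<le> N"
  shows "agree d (pinf K j) (pfin K j N :: 'a::field fps)"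
proof -
  \<comment> \<open>A diagonal limit: coefficient n no longer changes once n + 1 factors are
    present.\<close>
  define P :: "'a fps" where "P = Abs_fps (\<lambda>n. fps_nth (pfin K j (Suc n)) n)"
  have P: "agree d P (pfin K j N)" if "d \<le> N" for d N
    unfolding agree_def P_def
  proof (intro allI impI)
    fix n assume "n < d"
    then show "fps_nth (Abs_fps (\<lambda>n. fps_nth (pfin K j (Suc n)) n)) n = fps_nth (pfin K j N :: 'a fps) n"
      using agree_pfin[of K j "Suc n" "Suc n" N, where 'a = 'a] assms that by (simp add: agree_def)
  qed
  have "(\<lambda>n. \<Prod>i\<le>n. 1 - fps_X ^ j * (fps_X ^ K) ^ i) \<longlonglongrightarrow> P"
  proof (rule tendsto_fpsI)
    fix n
    have "fps_nth (\<Prod>i\<le>m. 1 - fps_X ^ j * (fps_X ^ K) ^ i) n = fps_nth P n" if "m \<ge> n" for m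
      using P[of "Suc n" "Suc m"] that
      by (simp add: agree_def pfin_def lessThan_Suc_atMost power_add power_mult)
    then show "\<forall>\<^sub>F m in sequentially. fps_nth (\<Prod>i\<le>m. 1 - fps_X ^ j * (fps_X ^ K) ^ i) n = fps_nth P n"
      using eventually_sequentially by blast
  qed
  \<comment> \<open>\<open>has_prod\<close> demands a nonzero limit.\<close>
  moreover have "fps_nth P 0 = 1"
    using pfin_nth_0[OF assms(2), of K "Suc 0", where 'a = 'a] by (simp add: P_def)
  then have "P \<noteq> 0" by auto
  ultimately have "(\<lambda>i. 1 - fps_X ^ j * (fps_X ^ K) ^ i) has_prod P"
    by (simp add: has_prod_def raw_has_prod_def)
  then have "pinf K j = P"
    unfolding qpoch_inf_def using has_prod_unique by metis
  then show ?thesis using P assms by simp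
qed

lemma pinf_nth_0: "K \<ge> 1 \<Longrightarrow> j \<ge> 1 \<Longrightarrow> fps_nth (pinf K j :: 'a::field fps) 0 = 1"
  using agree_pinf[of K j 1 1, where 'a = 'a] pfin_nth_0[of j K 1, where 'a = 'a] by (simp add: agree_def)

definition iqf :: "nat \<Rightarrow> int \<Rightarrow> 'a::field fps" where
  "iqf K n = (if n < 0 then 0 else inverse (pfin K K (nat n)))"

lemma agree_iqf:
  assumes "K \<ge> 1" "int d \<le> n"
  shows "agree d (iqf K n) (inverse (pinf K K) :: 'a::field fps)"
proof -
  have "agree d (inverse (pfin K K (nat n))) (inverse (pinf K K) :: 'a fps)"
    by (rule agree_inverse, rule agree_sym, rule agree_pinf)
      (use assms in \<open>auto simp: pfin_nth_0 pinf_nth_0\<close>)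
  then show ?thesis using assms by (simp add: iqf_def)
qed

lemma fps_to_fls_prod: "fps_to_fls (prod f A) = (\<Prod>i\<in>A. fps_to_fls (f i :: 'a::comm_ring_1 fps))"
  by (induction A rule: infinite_finite_induct) (simp_all add: fls_times_fps_to_fls)

lemma fps_to_fls_sum: "fps_to_fls (sum f A) = (\<Sum>i\<in>A. fps_to_fls (f i :: 'a::comm_ring_1 fps))"
  by (induction A rule: infinite_finite_induct) simp_all

lemma fps_to_fls_inverse:
  fixes f :: "'a::field fps"
  assumes "fps_nth f 0 \<noteq> 0"
  shows "fps_to_fls (inverse f) = inverse (fps_to_fls f)"
proof -
  have "fps_to_fls f * fps_to_fls (inverse f) = 1"
    using assms by (simp add: fls_times_fps_to_fls[symmetric] inverse_mult_eq_1')
  then show ?thesis by (metis inverse_unique)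
qed

text \<open>The Bailey chain has base X; the powers X^K serve the triple products, whose base is the
  modulus.\<close>

lemma qfield_fls_X:
  assumes "K \<ge> 1"
  shows "qfield (fls_X ^ K :: 'a::field_char_0 fls)"
proof
  show "(fls_X ^ K :: 'a fls) \<noteq> 0" by simp
  fix n :: nat assume "n > 0"
  then have "K * n \<noteq> 0" using assms by simp
  then have "fls_nth (fls_X ^ (K * n) :: 'a fls) 0 \<noteq> fls_nth 1 0"
    by simp
  then show "(fls_X ^ K :: 'a fls) ^ n \<noteq> 1"
    by (metis power_mult)
qed

lemma qfac_fls:
  assumes "K \<ge> 1"
  shows "qfield.qfac (fls_X ^ K :: 'a::field_char_0 fls) n = fps_to_fls (pfin K K (nat n))"
proof -
  interpret qfield "fls_X ^ K :: 'a fls" by (rule qfield_fls_X[OF assms])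
  have "(\<Prod>i\<in>{1..n}. 1 - (fls_X ^ K :: 'a fls) powi i) = (\<Prod>i<nat n. 1 - fls_X ^ (K + K * i))"
  proof (rule prod.reindex_bij_witness[of _ "\<lambda>i. int i + 1" "\<lambda>i. nat (i - 1)"])
    fix i assume "i \<in> {1..n}"
    then have "i = int (Suc (nat (i - 1)))" by simp
    then have "(fls_X ^ K :: 'a fls) powi i = (fls_X ^ K) ^ Suc (nat (i - 1))"
      by (metis power_int_of_nat)
    then show "1 - fls_X ^ (K + K * nat (i - 1)) = 1 - (fls_X ^ K :: 'a fls) powi i"
      by (simp add: power_add power_mult)
  qed auto
  then show ?thesis
    by (simp add: qfac_def pfin_def fps_to_fls_prod fps_to_fls_power)
qed

lemma iq_fls:
  assumes "K \<ge> 1"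
  shows "qfield.iq (fls_X ^ K :: 'a::field_char_0 fls) n = fps_to_fls (iqf K n)"
proof -
  interpret qfield "fls_X ^ K :: 'a fls" by (rule qfield_fls_X[OF assms])
  show ?thesis
    using assms by (simp add: iq_def iqf_def qfac_fls fps_to_fls_inverse pfin_nth_0)
qed

subsection \<open>Theta series\<close>

definition sgn1 :: "int \<Rightarrow> 'a::comm_ring_1" where
  "sgn1 n = (if even n then 1 else -1)"

text \<open>The series of c_i X^(e_i) over a possibly infinite index set. It has this meaning only
  under \<open>admissible\<close>, because \<open>sum\<close> over an infinite fibre is 0 and
  negative exponents are dropped.\<close>

definition tser :: "('i \<Rightarrow> int) \<Rightarrow> ('i \<Rightarrow> 'a::comm_ring_1) \<Rightarrow> 'i set \<Rightarrow> 'a fps" where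
  "tser e c A = Abs_fps (\<lambda>n. \<Sum>i\<in>{i\<in>A. e i = int n}. c i)"

definition admissible :: "('i \<Rightarrow> int) \<Rightarrow> 'i set \<Rightarrow> bool" where
  "admissible e A \<longleftrightarrow> (\<forall>i\<in>A. e i \<ge> 0) \<and> (\<forall>n. finite {i\<in>A. e i = n})"

lemma admissible_finite_le:
  assumes "admissible e A"
  shows "finite {i\<in>A. e i \<le> n}"
proof (rule finite_subset)
  show "{i\<in>A. e i \<le> n} \<subseteq> (\<Union>m\<in>{0..n}. {i\<in>A. e i = m})"
    using assms by (auto simp: admissible_def)
  show "finite (\<Union>m\<in>{0..n}. {i\<in>A. e i = m})"
    using assms by (auto simp: admissible_def)
qed

lemma admissible_subset:
  assumes "admissible e A" "B \<subseteq> A"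
  shows "admissible e B"
proof -
  have "{i\<in>B. e i = n} \<subseteq> {i\<in>A. e i = n}" for n using assms by auto
  with assms show ?thesis unfolding admissible_def by (metis finite_subset subsetD)
qed

lemma tser_agree:
  assumes "admissible e A" "finite S" "S \<subseteq> A" "\<And>i. i \<in> A \<Longrightarrow> e i < int d \<Longrightarrow> i \<in> S"
  shows "agree d (tser e c A) (\<Sum>i\<in>S. fps_const (c i) * fps_X ^ nat (e i))"
  unfolding agree_def
proof (intro allI impI)
  fix n assume n: "n < d"
  have "fps_nth (\<Sum>i\<in>S. fps_const (c i) * fps_X ^ nat (e i)) n = (\<Sum>i\<in>S. if e i = int n then c i else 0)"
    unfolding fps_sum_nth
    by (rule sum.cong[OF refl]) (use assms(1,3) in \<open>auto simp: admissible_def\<close>)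
  also have "\<dots> = (\<Sum>i\<in>{i\<in>S. e i = int n}. c i)"
    using assms(2) by (simp add: sum.inter_filter)
  also have "{i\<in>S. e i = int n} = {i\<in>A. e i = int n}"
    using assms(3,4) n by auto
  finally show "fps_nth (tser e c A) n = fps_nth (\<Sum>i\<in>S. fps_const (c i) * fps_X ^ nat (e i)) n"
    by (simp add: tser_def)
qed

lemma admissible_Times:
  assumes "admissible e A" "admissible e' B"
  shows "admissible (\<lambda>(i, j). e i + e' j) (A \<times> B)"
proof -
  have "finite {x \<in> A \<times> B. (case x of (i, j) \<Rightarrow> e i + e' j) = n}" for n
  proof (rule finite_subset)
    show "{x \<in> A \<times> B. (case x of (i, j) \<Rightarrow> e i + e' j) = n} \<subseteq> {i\<in>A. e i \<le> n} \<times> {j\<in>B. e' j \<le> n}"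
    proof
      fix x assume x: "x \<in> {x \<in> A \<times> B. (case x of (i, j) \<Rightarrow> e i + e' j) = n}"
      then obtain i j where ij: "x = (i, j)" "i \<in> A" "j \<in> B" "e i + e' j = n" by auto
      moreover have "e i \<ge> 0" "e' j \<ge> 0" using assms ij by (simp_all add: admissible_def)
      ultimately show "x \<in> {i\<in>A. e i \<le> n} \<times> {j\<in>B. e' j \<le> n}" by simp
    qed
  qed (use admissible_finite_le[OF assms(1)] admissible_finite_le[OF assms(2)] in blast)
  then show ?thesis using assms by (auto simp: admissible_def)
qed

lemma tser_mult:
  assumes "admissible e A" "admissible e' B"
  shows "tser e c A * tser e' c' B = tser (\<lambda>(i, j). e i + e' j) (\<lambda>(i, j). c i * c' j) (A \<times> B)"
proof (rule agree_eqI)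
  fix d
  define S T where "S = {i\<in>A. e i \<le> int d}" and "T = {j\<in>B. e' j \<le> int d}"
  have fin: "finite S" "finite T"
    using admissible_finite_le assms by (auto simp: S_def T_def)
  have "agree d (tser e c A * tser e' c' B)
      ((\<Sum>i\<in>S. fps_const (c i) * fps_X ^ nat (e i)) * (\<Sum>j\<in>T. fps_const (c' j) * fps_X ^ nat (e' j)))"
    by (intro agree_mult tser_agree assms fin) (auto simp: S_def T_def)
  also have "(\<Sum>i\<in>S. fps_const (c i) * fps_X ^ nat (e i)) * (\<Sum>j\<in>T. fps_const (c' j) * fps_X ^ nat (e' j))
     = (\<Sum>x\<in>S \<times> T. fps_const (case x of (i, j) \<Rightarrow> c i * c' j) * fps_X ^ nat (case x of (i, j) \<Rightarrow> e i + e' j))"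
    unfolding sum_product sum.cartesian_product
  proof (rule sum.cong[OF refl])
    fix x assume "x \<in> S \<times> T"
    then obtain i j where x: "x = (i, j)" "i \<in> A" "j \<in> B" by (auto simp: S_def T_def)
    then have "nat (e i + e' j) = nat (e i) + nat (e' j)"
      using assms by (simp add: admissible_def nat_add_distrib)
    then show "(case x of (i, j) \<Rightarrow> fps_const (c i) * fps_X ^ nat (e i) * (fps_const (c' j) * fps_X ^ nat (e' j)))
      = fps_const (case x of (i, j) \<Rightarrow> c i * c' j) * fps_X ^ nat (case x of (i, j) \<Rightarrow> e i + e' j)"
      unfolding x prod.case fps_const_mult[symmetric] by (simp only: power_add mult_ac)
  qed
  also have "agree d \<dots> (tser (\<lambda>(i, j). e i + e' j) (\<lambda>(i, j). c i * c' j) (A \<times> B))"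
  proof (rule agree_sym, rule tser_agree, rule admissible_Times[OF assms])
    show "finite (S \<times> T)" using fin by simp
    show "S \<times> T \<subseteq> A \<times> B" by (auto simp: S_def T_def)
    fix x assume x: "x \<in> A \<times> B" "(case x of (i, j) \<Rightarrow> e i + e' j) < int d"
    then obtain i j where ij: "x = (i, j)" "i \<in> A" "j \<in> B" "e i + e' j < int d" by auto
    moreover have "e i \<ge> 0" "e' j \<ge> 0" using assms ij by (simp_all add: admissible_def)
    ultimately show "x \<in> S \<times> T" by (simp add: S_def T_def)
  qed
  finally show "agree d (tser e c A * tser e' c' B) (tser (\<lambda>(i, j). e i + e' j) (\<lambda>(i, j). c i * c' j) (A \<times> B))" .
qed

lemma bij_betw_fiber:
  assumes "bij_betw f A B"
  shows "bij_betw f {i\<in>A. e (f i) = n} {j\<in>B. e j = n}"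
proof -
  have "inj_on f {i\<in>A. e (f i) = n}"
    using assms unfolding bij_betw_def by (rule inj_on_subset[OF conjunct1]) auto
  moreover have "f ` {i\<in>A. e (f i) = n} = {j\<in>B. e j = n}"
    using bij_betw_imp_surj_on[OF assms] by auto
  ultimately show ?thesis by (simp add: bij_betw_def)
qed

lemma tser_reindex:
  assumes "bij_betw f A B" "\<And>i. i \<in> A \<Longrightarrow> e (f i) = e' i" "\<And>i. i \<in> A \<Longrightarrow> c (f i) = c' i"
  shows "tser e c B = tser e' c' A"
proof -
  have "(\<Sum>j\<in>{j\<in>B. e j = int n}. c j) = (\<Sum>i\<in>{i\<in>A. e' i = int n}. c' i)" for n
  proof -
    have "(\<Sum>j\<in>{j\<in>B. e j = int n}. c j) = (\<Sum>i\<in>{i\<in>A. e (f i) = int n}. c (f i))"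
      by (rule sum.reindex_bij_betw[symmetric, OF bij_betw_fiber[OF assms(1)]])
    also have "\<dots> = (\<Sum>i\<in>{i\<in>A. e' i = int n}. c' i)"
      using assms by (intro sum.cong) auto
    finally show ?thesis .
  qed
  then show ?thesis by (simp add: tser_def)
qed

lemma admissible_reindex:
  assumes "bij_betw f A B" "\<And>i. i \<in> A \<Longrightarrow> e (f i) = e' i" "admissible e B"
  shows "admissible e' A"
proof -
  have "finite {i\<in>A. e' i = n}" for n
  proof -
    have "{i\<in>A. e' i = n} = {i\<in>A. e (f i) = n}" using assms by auto
    then show ?thesis
      using bij_betw_finite[OF bij_betw_fiber[OF assms(1), of e n]] assms(3) by (simp add: admissible_def)
  qed
  moreover have "e' i \<ge> 0" if "i \<in> A" for i
    using assms that by (metis admissible_def bij_betwE)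
  ultimately show ?thesis by (simp add: admissible_def)
qed

lemma tser_Un:
  assumes "admissible e (A \<union> B)" "A \<inter> B = {}"
  shows "tser e c (A \<union> B) = tser e c A + tser e c B"
proof -
  have "(\<Sum>i\<in>{i\<in>A \<union> B. e i = int n}. c i) = (\<Sum>i\<in>{i\<in>A. e i = int n}. c i) + (\<Sum>i\<in>{i\<in>B. e i = int n}. c i)" for n
  proof -
    have "finite {i\<in>A \<union> B. e i = int n}" using assms(1) by (simp add: admissible_def)
    moreover have "{i\<in>A \<union> B. e i = int n} = {i\<in>A. e i = int n} \<union> {i\<in>B. e i = int n}" by auto
    ultimately show ?thesis
      using assms(2) by (simp add: sum.union_disjoint disjoint_iff)
  qed
  then show ?thesis by (simp add: tser_def fps_eq_iff)
qed

definition jexp :: "int \<Rightarrow> int \<Rightarrow> int \<Rightarrow> int" where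
  "jexp K j n = K * (n * (n - 1) div 2) + j * n"

text \<open>The case n <= 0 mirrors the other one under n to -n, j to K - j. By this bound only |n|
  < d matters modulo X^d.\<close>

lemma jexp_ge:
  assumes "0 < j" "j < K"
  shows "jexp K j n \<ge> \<bar>n\<bar>"
proof (cases "n \<ge> 1")
  case True
  have "n * (n - 1) div 2 \<ge> 0" using True by (simp add: pos_imp_zdiv_nonneg_iff)
  then have "K * (n * (n - 1) div 2) \<ge> 0" using assms by simp
  moreover have "j * n \<ge> 1 * n" using assms True by (intro mult_right_mono) auto
  ultimately show ?thesis using True unfolding jexp_def by linarith
next
  case False
  have n: "n * (n - 1) div 2 = - n + (n + 1) * n div 2"
    using tri_step[of n] by simp
  have "(n + 1) * n div 2 \<ge> 0"
  proof -
    have "(n + 1) * n \<ge> 0"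
      using False by (cases "n = 0") (auto intro: mult_nonpos_nonpos)
    then show ?thesis by (simp add: pos_imp_zdiv_nonneg_iff)
  qed
  then have "K * ((n + 1) * n div 2) \<ge> 0" using assms by simp
  moreover have "(K - j) * (- n) \<ge> 1 * (- n)" using assms False by (intro mult_right_mono) auto
  ultimately show ?thesis
    using False unfolding jexp_def n by (simp add: algebra_simps)
qed

lemma admissible_jexp:
  assumes "0 < j" "j < K"
  shows "admissible (jexp K j) UNIV"
proof -
  have "finite {i \<in> UNIV. jexp K j i = n}" for n
  proof (rule finite_subset)
    show "{i \<in> UNIV. jexp K j i = n} \<subseteq> {-n..n}"
    proof
      fix x assume "x \<in> {i \<in> UNIV. jexp K j i = n}"
      then show "x \<in> {-n..n}" using jexp_ge[OF assms, of x] by auto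
    qed
  qed simp
  moreover have "jexp K j i \<ge> 0" for i
    using jexp_ge[OF assms, of i] by linarith
  ultimately show ?thesis by (simp add: admissible_def)
qed

lemma finite_jacobi_triple_fps:
  assumes "0 < j" "j < K"
  shows "pfin K j N * pfin K (K - j) N
    = (\<Sum>n\<in>{- int N..int N}. fps_const (sgn1 n) * fps_X ^ nat (jexp K j n)
        * (pfin K K (2 * N) * iqf K (int N + n) * iqf K (int N - n)) :: 'a::field_char_0 fps)"
proof -
  have K: "K \<ge> 1" using assms by simp
  interpret qfield "fls_X ^ K :: 'a fls" by (rule qfield_fls_X[OF K])
  let ?x = "fls_X ^ j :: 'a fls"
  have "fps_to_fls (pfin K j N * pfin K (K - j) N :: 'a fps)
      = (\<Prod>i<N. (1 - ?x * (fls_X ^ K) ^ i) * (1 - (fls_X ^ K) ^ (i + 1) / ?x))"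
  proof -
    have "(fls_X ^ K) ^ (i + 1) / ?x = fls_X ^ (K - j + K * i)" for i
    proof -
      have "(fls_X ^ K :: 'a fls) ^ (i + 1) = fls_X ^ (K - j + K * i) * ?x"
        unfolding power_mult[symmetric] power_add[symmetric] using assms by (simp add: algebra_simps)
      then show ?thesis by (simp only: nonzero_mult_div_cancel_right[OF power_not_zero[OF fls_X_nonzero]])
    qed
    then show ?thesis
      unfolding pfin_def prod.distrib[symmetric] fps_to_fls_prod
      by (intro prod.cong refl) (simp add: fls_times_fps_to_fls fps_to_fls_power power_add power_mult)
  qed
  also have "\<dots> = (\<Sum>n\<in>{- int N..int N}. (-1) powi n * (fls_X ^ K) powi (n * (n - 1) div 2) * ?x powi n * qbi (2 * int N) (int N + n))"
    by (rule finite_jacobi_triple) simp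
  also have "\<dots> = fps_to_fls (\<Sum>n\<in>{- int N..int N}. fps_const (sgn1 n) * fps_X ^ nat (jexp (int K) (int j) n)
        * (pfin K K (2 * N) * iqf K (int N + n) * iqf K (int N - n)))"
    unfolding fps_to_fls_sum
  proof (rule sum.cong[OF refl])
    fix n
    have s: "(-1 :: 'a fls) powi n = fps_to_fls (fps_const (sgn1 n))"
      by (simp add: sgn1_def power_int_minus_left flip: fps_const_neg)
    have pw: "(fls_X ^ m :: 'a fls) powi l = fls_X powi (int m * l)" for m l
      by (simp add: power_int_mult)
    have "jexp (int K) (int j) n \<ge> 0"
      using jexp_ge[of "int j" "int K" n] assms by linarith
    then have "fps_to_fls (fps_X ^ nat (jexp (int K) (int j) n)) = (fls_X :: 'a fls) powi (jexp (int K) (int j) n)"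
      by (simp add: fps_to_fls_power power_int_def)
    also have "\<dots> = (fls_X ^ K) powi (n * (n - 1) div 2) * ?x powi n"
      unfolding pw jexp_def by (rule power_int_add) simp
    finally have e: "fps_to_fls (fps_X ^ nat (jexp (int K) (int j) n)) = (fls_X ^ K) powi (n * (n - 1) div 2) * ?x powi n" .
    have b: "qbi (2 * int N) (int N + n) = fps_to_fls (pfin K K (2 * N) * iqf K (int N + n) * iqf K (int N - n))"
    proof -
      have "2 * int N - (int N + n) = int N - n" "nat (2 * int N) = 2 * N" by simp_all
      then show ?thesis
        by (simp only: qbi_def iq_fls[OF K] qfac_fls[OF K] fls_times_fps_to_fls)
    qed
    show "(-1) powi n * (fls_X ^ K) powi (n * (n - 1) div 2) * ?x powi n * qbi (2 * int N) (int N + n)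
      = fps_to_fls (fps_const (sgn1 n) * fps_X ^ nat (jexp (int K) (int j) n)
        * (pfin K K (2 * N) * iqf K (int N + n) * iqf K (int N - n)))"
      unfolding fls_times_fps_to_fls[of "_ * _" "_ * _ * _"] b[symmetric]
      unfolding fls_times_fps_to_fls e s by (simp only: mult.assoc)
  qed
  finally show ?thesis by simp
qed

lemma jacobi_triple:
  assumes "0 < j" "j < K"
  shows "tser (jexp K j) sgn1 UNIV = (pinf K K * pinf K j * pinf K (K - j) :: 'a::field_char_0 fps)"
proof -
  have K: "K \<ge> 1" and j: "j \<ge> 1" "K - j \<ge> 1" using assms by simp_all
  let ?P = "pinf K K :: 'a fps"
  have PI: "?P * inverse ?P = 1"
    using pinf_nth_0[OF K K, where 'a = 'a] by (intro inverse_mult_eq_1') simp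
  have "pinf K j * pinf K (K - j) = tser (jexp K j) sgn1 UNIV * inverse ?P"
  proof (rule agree_eqI)
    fix d :: nat
    \<comment> \<open>For |n| < d both N + n and N - n are at least d, so the q-binomial agrees with
      its limit; all other terms are 0 modulo X^d on both sides.\<close>
    let ?N = "2 * d"
    have adm: "admissible (jexp K j) UNIV" using admissible_jexp assms by simp
    have "agree d (pinf K j * pinf K (K - j)) (pfin K j ?N * pfin K (K - j) ?N :: 'a fps)"
      by (intro agree_mult agree_pinf K j) simp_all
    also have "pfin K j ?N * pfin K (K - j) ?N
     = (\<Sum>n\<in>{- int ?N..int ?N}. fps_const (sgn1 n) * fps_X ^ nat (jexp K j n)
        * (pfin K K (2 * ?N) * iqf K (int ?N + n) * iqf K (int ?N - n)) :: 'a fps)"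
      by (rule finite_jacobi_triple_fps[OF assms])
    also have "agree d \<dots> (\<Sum>n\<in>{- int ?N..int ?N}. fps_const (sgn1 n) * fps_X ^ nat (jexp K j n) * inverse ?P)"
    proof (rule agree_sum)
      fix n assume "n \<in> {- int ?N..int ?N}"
      show "agree d (fps_const (sgn1 n) * fps_X ^ nat (jexp K j n)
        * (pfin K K (2 * ?N) * iqf K (int ?N + n) * iqf K (int ?N - n)))
        (fps_const (sgn1 n) * fps_X ^ nat (jexp K j n) * inverse ?P)"
      proof (cases "\<bar>n\<bar> < int d")
        case True
        have "agree d (pfin K K (2 * ?N) * iqf K (int ?N + n) * iqf K (int ?N - n)) (?P * inverse ?P * inverse ?P)"
          by (intro agree_mult agree_iqf K agree_sym[OF agree_pinf]) (use True in auto)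
        then show ?thesis unfolding PI by (intro agree_mult agree_refl) simp
      next
        case False
        then have "d \<le> nat (jexp K j n)"
          using jexp_ge[of "int j" "int K" n] assms by linarith
        then have *: "agree d (fps_const (sgn1 n) * fps_X ^ nat (jexp K j n) * f) 0" for f :: "'a fps"
          using agree_X_power[of d "nat (jexp K j n)" "fps_const (sgn1 n) * f"] by (simp add: mult_ac)
        show ?thesis by (rule agree_trans[OF * agree_sym[OF *]])
      qed
    qed
    also have "(\<Sum>n\<in>{- int ?N..int ?N}. fps_const (sgn1 n) * fps_X ^ nat (jexp K j n) * inverse ?P)
      = (\<Sum>n\<in>{- int ?N..int ?N}. fps_const (sgn1 n) * fps_X ^ nat (jexp K j n)) * inverse ?P"
      by (rule sum_distrib_right[symmetric])
    also have "agree d \<dots> (tser (jexp K j) sgn1 UNIV * inverse ?P)"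
    proof (intro agree_mult agree_refl agree_sym[OF tser_agree[OF adm]])
      fix n assume "jexp K j n < int d"
      then show "n \<in> {- int ?N..int ?N}" using jexp_ge[of "int j" "int K" n] assms by auto
    qed auto
    finally show "agree d (pinf K j * pinf K (K - j)) (tser (jexp K j) sgn1 UNIV * inverse ?P)" .
  qed
  then have "?P * (pinf K j * pinf K (K - j)) = tser (jexp K j) sgn1 UNIV * (?P * inverse ?P)"
    by (simp add: mult_ac)
  then show ?thesis unfolding PI by (simp add: mult.assoc)
qed

lemma pinf_split3:
  assumes "K \<ge> 1"
  shows "pinf K K = (pinf (3 * K) (3 * K) * pinf (3 * K) K * pinf (3 * K) (2 * K) :: 'a::field fps)"
proof (rule agree_eqI)
  fix d
  have fin: "pfin K K (3 * N) = (pfin (3 * K) (3 * K) N * pfin (3 * K) K N * pfin (3 * K) (2 * K) N :: 'a fps)" for N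
  proof (induction N)
    case (Suc N)
    have "3 * Suc N = Suc (Suc (Suc (3 * N)))" by simp
    then have "pfin K K (3 * Suc N) = (pfin K K (3 * N) * (1 - fps_X ^ (K + K * (3 * N)))
       * (1 - fps_X ^ (K + K * Suc (3 * N))) * (1 - fps_X ^ (K + K * Suc (Suc (3 * N)))) :: 'a fps)"
      by (simp only: pfin_def prod.lessThan_Suc)
    also have "K + K * (3 * N) = K + 3 * K * N" by simp
    also have "K + K * Suc (3 * N) = 2 * K + 3 * K * N" by simp
    also have "K + K * Suc (Suc (3 * N)) = 3 * K + 3 * K * N" by simp
    finally show ?case
      unfolding Suc.IH by (simp only: pfin_def prod.lessThan_Suc mult_ac)
  qed (simp add: pfin_def)
  have "agree d (pinf K K) (pfin K K (3 * d) :: 'a fps)"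
    by (rule agree_pinf) (use assms in auto)
  also have "pfin K K (3 * d) = (pfin (3 * K) (3 * K) d * pfin (3 * K) K d * pfin (3 * K) (2 * K) d :: 'a fps)"
    by (rule fin)
  also have "agree d \<dots> (pinf (3 * K) (3 * K) * pinf (3 * K) K * pinf (3 * K) (2 * K))"
    by (intro agree_mult agree_sym[OF agree_pinf]) (use assms in auto)
  finally show "agree d (pinf K K) (pinf (3 * K) (3 * K) * pinf (3 * K) K * pinf (3 * K) (2 * K) :: 'a fps)" .
qed

text \<open>The triple product with base q^(3K) at q^K: its three factors collect the multiples of K
  according to their residue modulo 3K.\<close>

lemma pentagonal:
  assumes "K \<ge> 1"
  shows "tser (jexp (3 * int K) (int K)) sgn1 UNIV = (pinf K K :: 'a::field_char_0 fps)"
  using jacobi_triple[of K "3 * K", where 'a = 'a] assms pinf_split3[OF assms, where 'a = 'a] by simp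

subsection \<open>The Macdonald identity for $A_2^{(1)}$\<close>

text \<open>The substitution $a = l + n$, $b = m + n$ in the product of three Jacobi triple products leaves,
  for fixed $(a,b)$, a sum over $n$ which vanishes if $a + b \equiv 2$ modulo $3$ and is a multiple of
  the pentagonal number series otherwise.\<close>

definition mac_exp :: "int \<Rightarrow> int \<Rightarrow> int \<times> int \<Rightarrow> int" where
  "mac_exp K i = (\<lambda>(a, b). K * ((a + b) * (a + b - 1) div 3 - a * b) + i * (a + b))"

definition mac_coeff :: "int \<times> int \<Rightarrow> 'a::comm_ring_1" where
  "mac_coeff = (\<lambda>(a, b). if (a + b) mod 3 = 0 then 1 else -1)"

definition mac_index :: "(int \<times> int) set" where
  "mac_index = {(a, b). (a + b) mod 3 \<noteq> 2}"

lemma sgn1_mult: "sgn1 a * sgn1 b = sgn1 (a + b)"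
  by (simp add: sgn1_def)

lemma jexp_triple:
  fixes a b n :: int
  shows "2 * (jexp K i (a - n) + jexp K i (b - n) + jexp K (2 * i) n)
    = K * (a^2 - a + b^2 - b + 3 * n^2 + n - 2 * n * (a + b)) + 2 * (i * (a + b))"
proof -
  define x y z where "x = (a - n) * (a - n - 1) div 2" and "y = (b - n) * (b - n - 1) div 2"
    and "z = n * (n - 1) div 2"
  have "2 * x = (a - n) * (a - n - 1)" "2 * y = (b - n) * (b - n - 1)" "2 * z = n * (n - 1)"
    unfolding x_def y_def z_def by (rule tri_double)+
  then show ?thesis
    unfolding jexp_def x_def[symmetric] y_def[symmetric] z_def[symmetric] by algebra
qed

text \<open>For fixed (a, b) the exponent is quadratic in n with vertex (a+b)/3 - 1/6. Measuring n
  from r, in a direction chosen by the residue of a + b, gives the pentagonal exponent in both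
  cases.\<close>

lemma mac_exp_split:
  fixes a b v :: int
  defines "r \<equiv> (a + b) div 3"
  assumes "(a + b) mod 3 \<noteq> 2"
    and n: "n = (if (a + b) mod 3 = 0 then r - v else r + v)"
  shows "jexp K i (a - n) + jexp K i (b - n) + jexp K (2 * i) n = mac_exp K i (a, b) + jexp (3 * K) K v"
    and "sgn1 (a - n) * sgn1 (b - n) * sgn1 n = (mac_coeff (a, b) * sgn1 v :: 'a::comm_ring_1)"
proof -
  define t where "t = v * (v - 1) div 2"
  have t: "2 * t = v * (v - 1)" unfolding t_def by (rule tri_double)
  have "(a + b) mod 3 = 0 \<or> (a + b) mod 3 = 1" using assms(2) by presburger
  then consider "(a + b) mod 3 = 0" "a + b = 3 * r" | "(a + b) mod 3 = 1" "a + b = 3 * r + 1"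
    unfolding r_def by (metis add.right_neutral mult_div_mod_eq)
  then show "jexp K i (a - n) + jexp K i (b - n) + jexp K (2 * i) n = mac_exp K i (a, b) + jexp (3 * K) K v"
  proof cases
    case 1
    have a: "a = 3 * r - b" using 1 by simp
    have "(a + b) * (a + b - 1) div 3 = r * (3 * r - 1)"
      unfolding 1(2) by (simp add: mult.assoc)
    then have "mac_exp K i (a, b) + jexp (3 * K) K v = K * (r * (3 * r - 1) - a * b) + i * (a + b) + (3 * K * t + K * v)"
      by (simp add: mac_exp_def jexp_def t_def)
    then have "2 * (mac_exp K i (a, b) + jexp (3 * K) K v) = 2 * K * (r * (3 * r - 1) - a * b) + 2 * (i * (a + b)) + (3 * K * (v * (v - 1)) + 2 * K * v)"
      using t by algebra
    also have "\<dots> = 2 * (jexp K i (a - n) + jexp K i (b - n) + jexp K (2 * i) n)"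
      using 1(1) unfolding jexp_triple n a by (simp add: algebra_simps power2_eq_square)
    finally show ?thesis by simp
  next
    case 2
    have a: "a = 3 * r + 1 - b" using 2 by simp
    have "(a + b) * (a + b - 1) div 3 = r * (3 * r + 1)"
      unfolding 2(2) by (simp add: mult.assoc mult.left_commute)
    then have "mac_exp K i (a, b) + jexp (3 * K) K v = K * (r * (3 * r + 1) - a * b) + i * (a + b) + (3 * K * t + K * v)"
      by (simp add: mac_exp_def jexp_def t_def)
    then have "2 * (mac_exp K i (a, b) + jexp (3 * K) K v) = 2 * K * (r * (3 * r + 1) - a * b) + 2 * (i * (a + b)) + (3 * K * (v * (v - 1)) + 2 * K * v)"
      using t by algebra
    also have "\<dots> = 2 * (jexp K i (a - n) + jexp K i (b - n) + jexp K (2 * i) n)"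
      using 2(1) unfolding jexp_triple n a by (simp add: algebra_simps power2_eq_square)
    finally show ?thesis by simp
  qed
  have "sgn1 (a - n) * sgn1 (b - n) * sgn1 n = (sgn1 (a + b - n) :: 'a)"
    by (simp add: sgn1_mult algebra_simps)
  also have "\<dots> = mac_coeff (a, b) * sgn1 v"
    using \<open>(a + b) mod 3 = 0 \<or> (a + b) mod 3 = 1\<close>
  proof
    assume m: "(a + b) mod 3 = 0"
    then have s: "a + b = 3 * r" unfolding r_def by (metis add.right_neutral mult_div_mod_eq)
    have "a + b - n = 2 * r + v" using m unfolding n s by simp
    then show ?thesis using m by (simp add: mac_coeff_def sgn1_def)
  next
    assume m: "(a + b) mod 3 = 1"
    then have s: "a + b = 3 * r + 1" unfolding r_def by (metis mult_div_mod_eq)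
    have "a + b - n = 2 * r + 1 - v" using m unfolding n s by simp
    then show ?thesis using m by (simp add: mac_coeff_def sgn1_def)
  qed
  finally show "sgn1 (a - n) * sgn1 (b - n) * sgn1 n = (mac_coeff (a, b) * sgn1 v :: 'a)" .
qed

text \<open>For a + b = 3r + 2 the vertex is r + 1/2. Reflection in it keeps the exponent and flips
  the parity of n, hence the sign.\<close>

lemma mac_cancel:
  fixes a b n :: int
  assumes "(a + b) mod 3 = 2"
  defines "n' \<equiv> 2 * ((a + b) div 3) + 1 - n"
  shows "jexp K i (a - n') + jexp K i (b - n') + jexp K (2 * i) n' = jexp K i (a - n) + jexp K i (b - n) + jexp K (2 * i) n"
    and "sgn1 (a - n') * sgn1 (b - n') * sgn1 n' = - (sgn1 (a - n) * sgn1 (b - n) * sgn1 n :: 'a::comm_ring_1)"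
proof -
  define r where "r = (a + b) div 3"
  have s: "a + b = 3 * r + 2" using assms(1) unfolding r_def by (metis mult_div_mod_eq)
  have a: "a = 3 * r + 2 - b" using s by simp
  have n': "n' = 2 * r + 1 - n" by (simp add: n'_def r_def)
  have "2 * (jexp K i (a - n') + jexp K i (b - n') + jexp K (2 * i) n')
    = 2 * (jexp K i (a - n) + jexp K i (b - n) + jexp K (2 * i) n)"
    unfolding jexp_triple n' a by (simp add: algebra_simps power2_eq_square)
  then show "jexp K i (a - n') + jexp K i (b - n') + jexp K (2 * i) n' = jexp K i (a - n) + jexp K i (b - n) + jexp K (2 * i) n"
    by simp
  have S: "sgn1 (a - n) * sgn1 (b - n) * sgn1 n = (sgn1 (a + b - n) :: 'a)" for n
    by (simp add: sgn1_mult algebra_simps)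
  show "sgn1 (a - n') * sgn1 (b - n') * sgn1 n' = - (sgn1 (a - n) * sgn1 (b - n) * sgn1 n :: 'a)"
    unfolding S s n' by (simp add: sgn1_def)
qed

lemma macdonald:
  fixes K i :: nat
  assumes "0 < i" "2 * i < K"
  shows "admissible (mac_exp K i) mac_index"
    and "tser (mac_exp K i) mac_coeff mac_index
      = ((pinf K K)^2 * (pinf K i * pinf K (K - i))^2 * (pinf K (2 * i) * pinf K (K - 2 * i)) :: 'a::field_char_0 fps)"
proof -
  let ?J1 = "jexp (int K) (int i)" and ?J2 = "jexp (int K) (2 * int i)" and ?J3 = "jexp (3 * int K) (int K)"
  have K: "K \<ge> 1" using assms by simp
  let ?e0 = "\<lambda>(x, n). (case x of (l, m) \<Rightarrow> ?J1 l + ?J1 m) + ?J2 n"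
  let ?c0 = "\<lambda>(x, n). (case x of (l, m) \<Rightarrow> sgn1 l * sgn1 m) * sgn1 n :: 'a"
  let ?e1 = "\<lambda>((a, b), n). ?J1 (a - n) + ?J1 (b - n) + ?J2 n"
  let ?c1 = "\<lambda>((a, b), n). sgn1 (a - n) * sgn1 (b - n) * sgn1 n :: 'a"
  let ?U = "UNIV :: int set"
  have adm1: "admissible ?J1 UNIV" "admissible ?J2 UNIV"
    using assms by (auto intro!: admissible_jexp)
  have adm0: "admissible ?e0 ((UNIV \<times> UNIV) \<times> UNIV)"
    by (intro admissible_Times adm1)
  have bij0: "bij_betw (\<lambda>((a, b), n). ((a - n, b - n), n)) ((?U \<times> ?U) \<times> ?U) ((?U \<times> ?U) \<times> ?U)"
    by (rule bij_betw_byWitness[where f' = "\<lambda>((a, b), n). ((a + n, b + n), n)"]) auto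
  define A0 A1 where "A0 = {((a, b), n :: int). (a + b :: int) mod 3 = 2}" and "A1 = mac_index \<times> ?U"
  have A01: "(?U \<times> ?U) \<times> ?U = A0 \<union> A1" "A0 \<inter> A1 = {}"
    by (auto simp: A0_def A1_def mac_index_def)
  have adme1: "admissible ?e1 (A0 \<union> A1)"
    unfolding A01(1)[symmetric] by (rule admissible_reindex[OF bij0 _ adm0]) auto
  have "tser ?J1 sgn1 UNIV * tser ?J1 sgn1 UNIV * tser ?J2 sgn1 UNIV = tser ?e0 ?c0 ((UNIV \<times> UNIV) \<times> UNIV)"
    by (simp only: tser_mult[OF adm1(1) adm1(1)] tser_mult[OF admissible_Times[OF adm1(1) adm1(1)] adm1(2)])
  also have "\<dots> = tser ?e1 ?c1 (A0 \<union> A1)"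
    unfolding A01(1)[symmetric] by (rule tser_reindex[OF bij0]) auto
  also have "\<dots> = tser ?e1 ?c1 A0 + tser ?e1 ?c1 A1"
    by (rule tser_Un[OF adme1 A01(2)])
  \<comment> \<open>The reflection of \<open>mac_cancel\<close> shows that this series equals its
    own negative.\<close>
  also have "tser ?e1 ?c1 A0 = 0"
  proof -
    have bij: "bij_betw (\<lambda>((a, b), n). ((a, b), 2 * ((a + b) div 3) + 1 - n)) A0 A0"
      by (rule bij_betw_byWitness[where f' = "\<lambda>((a, b), n). ((a, b), 2 * ((a + b) div 3) + 1 - n)"]) (auto simp: A0_def)
    have "tser ?e1 ?c1 A0 = tser ?e1 (\<lambda>x. - ?c1 x) A0"
      by (rule tser_reindex[OF bij]) (auto simp only: A0_def mem_Collect_eq prod.case mac_cancel)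
    also have "\<dots> = - tser ?e1 ?c1 A0"
      by (simp add: tser_def sum_negf fps_eq_iff)
    finally have "2 * tser ?e1 ?c1 A0 = 0" by simp
    then show ?thesis by simp
  qed
  finally have m0: "tser ?J1 sgn1 UNIV * tser ?J1 sgn1 UNIV * tser ?J2 sgn1 UNIV = 0 + tser ?e1 ?c1 A1" .
  have T: "tser ?e1 ?c1 A1 = tser (\<lambda>(x, v). mac_exp K i x + ?J3 v) (\<lambda>(x, v). mac_coeff x * sgn1 v) (mac_index \<times> UNIV)"
    and admP: "admissible (\<lambda>(x, v). mac_exp K i x + ?J3 v) (mac_index \<times> UNIV)"
  proof -
    let ?g = "\<lambda>((a, b), v). ((a, b), if (a + b) mod 3 = 0 then (a + b) div 3 - v else (a + b) div 3 + v) :: (int \<times> int) \<times> int"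
    have bij: "bij_betw ?g (mac_index \<times> UNIV) A1"
      by (rule bij_betw_byWitness[where f' = "\<lambda>((a, b), n). ((a, b), if (a + b) mod 3 = 0 then (a + b) div 3 - n else n - (a + b) div 3)"])
        (auto simp: A1_def)
    have e: "?e1 (?g x) = (case x of (x, v) \<Rightarrow> mac_exp K i x + ?J3 v)"
      and c: "?c1 (?g x) = (case x of (x, v) \<Rightarrow> mac_coeff x * sgn1 v)" if x: "x \<in> mac_index \<times> UNIV" for x
    proof -
      obtain a b v where abv: "x = ((a, b), v)" "(a + b) mod 3 \<noteq> 2"
        using x by (auto simp: mac_index_def)
      show "?e1 (?g x) = (case x of (x, v) \<Rightarrow> mac_exp K i x + ?J3 v)"
        unfolding abv(1) prod.case by (rule mac_exp_split(1)[OF abv(2) refl])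
      show "?c1 (?g x) = (case x of (x, v) \<Rightarrow> mac_coeff x * sgn1 v)"
        unfolding abv(1) prod.case by (rule mac_exp_split(2)[OF abv(2) refl])
    qed
    show "tser ?e1 ?c1 A1 = tser (\<lambda>(x, v). mac_exp K i x + ?J3 v) (\<lambda>(x, v). mac_coeff x * sgn1 v) (mac_index \<times> UNIV)"
    proof (rule tser_reindex[OF bij])
      fix x assume x: "x \<in> mac_index \<times> ?U"
      show "?e1 (?g x) = (case x of (x, v) \<Rightarrow> mac_exp K i x + ?J3 v)" by (rule e[OF x])
      show "?c1 (?g x) = (case x of (x, v) \<Rightarrow> mac_coeff x * sgn1 v)" by (rule c[OF x])
    qed
    show "admissible (\<lambda>(x, v). mac_exp K i x + ?J3 v) (mac_index \<times> UNIV)"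
    proof (rule admissible_reindex[OF bij, where e = ?e1])
      fix x assume x: "x \<in> mac_index \<times> ?U"
      show "?e1 (?g x) = (case x of (x, v) \<Rightarrow> mac_exp K i x + ?J3 v)" by (rule e[OF x])
    next
      show "admissible ?e1 A1" by (rule admissible_subset[OF adme1]) simp
    qed
  qed
  have main: "tser ?J1 sgn1 UNIV * tser ?J1 sgn1 UNIV * tser ?J2 sgn1 UNIV
    = tser (\<lambda>(x, v). mac_exp K i x + ?J3 v) (\<lambda>(x, v). mac_coeff x * sgn1 v :: 'a) (mac_index \<times> UNIV)"
    unfolding m0 T by simp
  \<comment> \<open>Lower bound and finite fibres are hard to see from \<open>mac_exp\<close>
    itself. They are read off at v = 0 from the family with the pentagonal exponent added, which is
    a reindexed part of the product of the three theta series.\<close>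
  show adm: "admissible (mac_exp K i) mac_index"
    unfolding admissible_def
  proof (intro conjI ballI allI)
    have J0: "?J3 0 = 0" by (simp add: jexp_def)
    fix x assume "x \<in> mac_index"
    then have "(x, 0) \<in> mac_index \<times> ?U" by simp
    then have "(case (x, 0) of (x, v) \<Rightarrow> mac_exp K i x + ?J3 v) \<ge> 0"
      using admP unfolding admissible_def by blast
    then show "mac_exp K i x \<ge> 0" using J0 by simp
  next
    have J0: "?J3 0 = 0" by (simp add: jexp_def)
    fix n
    have "(\<lambda>x. (x, 0)) ` {x \<in> mac_index. mac_exp K i x = n}
      \<subseteq> {y \<in> mac_index \<times> ?U. (case y of (x, v) \<Rightarrow> mac_exp K i x + ?J3 v) = n}"
      using J0 by auto
    then have "finite ((\<lambda>x. (x, 0 :: int)) ` {x \<in> mac_index. mac_exp K i x = n})"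
      using admP finite_subset unfolding admissible_def by blast
    then show "finite {x \<in> mac_index. mac_exp K i x = n}"
      by (rule finite_imageD) (simp add: inj_on_def)
  qed
  have adm3: "admissible ?J3 UNIV"
    by (rule admissible_jexp) (use assms in auto)
  let ?P = "pinf K K :: 'a fps"
  \<comment> \<open>The pentagonal series cancels one of the three factors (q^K; q^K)_inf of the
    triple products, which leaves the square.\<close>
  have "tser (mac_exp K i) mac_coeff mac_index * ?P = tser ?J1 sgn1 UNIV * tser ?J1 sgn1 UNIV * tser ?J2 sgn1 UNIV"
    unfolding main tser_mult[OF adm adm3, symmetric] pentagonal[OF K] ..
  also have "\<dots> = (?P * pinf K i * pinf K (K - i)) * (?P * pinf K i * pinf K (K - i)) * (?P * pinf K (2 * i) * pinf K (K - 2 * i))"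
    using jacobi_triple[of i K, where 'a = 'a] jacobi_triple[of "2 * i" K, where 'a = 'a] assms by simp
  finally have "tser (mac_exp K i) mac_coeff mac_index * ?P
    = (?P^2 * (pinf K i * pinf K (K - i))^2 * (pinf K (2 * i) * pinf K (K - 2 * i))) * ?P"
    by (simp only: power2_eq_square mult_ac)
  moreover have "?P \<noteq> 0"
    using pinf_nth_0[OF K K, where 'a = 'a] by auto
  ultimately show "tser (mac_exp K i) mac_coeff mac_index
      = ((pinf K K)^2 * (pinf K i * pinf K (K - i))^2 * (pinf K (2 * i) * pinf K (K - 2 * i)) :: 'a fps)"
    by simp
qed

text \<open>Inverse of $(u,v) \mapsto \rho - u\alpha_1 - v\alpha_2$ on the $A_2$ root lattice.\<close>

definition kappa_index :: "int \<times> int \<times> int \<Rightarrow> int \<times> int" where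
  "kappa_index = (\<lambda>(a, b, c). (1 - a, 1 + c))"

text \<open>With u = 1 - a and v = 1 + c the Weyl vector becomes the origin, and u + v is congruent
  to a - b - 1 modulo 3. In these coordinates sign and exponent of the lattice sums are those of the
  Macdonald identity.\<close>

lemma kappa_index_props:
  assumes "a + b + c = 0"
  shows "chi3 (a - b) \<noteq> 0 \<longleftrightarrow> kappa_index (a, b, c) \<in> mac_index"
    and "chi3 (a - b) \<noteq> 0 \<Longrightarrow> mac_coeff (kappa_index (a, b, c)) = (of_int (chi3 (a - b)) :: 'a::comm_ring_1)"
    and "chi3 (a - b) \<noteq> 0 \<Longrightarrow> mac_exp K i (kappa_index (a, b, c)) = K * ((qform a b - 1) div 3) - i * (a - c - 2)"
proof -
  have c: "c = - a - b" using assms by simp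
  define s where "s = (1 - a) + (1 + c)"
  have chi: "chi3 (a - b) = chi3 (1 + s)"
    by (rule chi3_cong) (simp add: s_def c)
  have m: "s mod 3 = 0 \<or> s mod 3 = 1 \<or> s mod 3 = 2" by presburger
  have chi': "chi3 (1 + s) = (if s mod 3 = 0 then 1 else if s mod 3 = 1 then -1 else 0)"
    using m by (elim disjE) (simp_all add: chi3_def mod_add_eq[symmetric, of 1 s])
  have k: "kappa_index (a, b, c) = (1 - a, 1 + c)" by (simp add: kappa_index_def)
  show 1: "chi3 (a - b) \<noteq> 0 \<longleftrightarrow> kappa_index (a, b, c) \<in> mac_index"
    using m unfolding chi chi' k mac_index_def by (auto simp: s_def)
  show "mac_coeff (kappa_index (a, b, c)) = (of_int (chi3 (a - b)) :: 'a)" if "chi3 (a - b) \<noteq> 0"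
    using m that unfolding chi chi' k mac_coeff_def by (auto simp: s_def)
  show "mac_exp K i (kappa_index (a, b, c)) = K * ((qform a b - 1) div 3) - i * (a - c - 2)" if "chi3 (a - b) \<noteq> 0"
  proof -
    define e where "e = (qform a b - 1) div 3"
    have e: "3 * e = qform a b - 1" unfolding e_def by (rule qform_mod3[OF that])
    have "s * (s - 1) = 3 * (e + (1 - a) * (1 + c))"
      unfolding distrib_left e qform_def s_def c by (simp add: algebra_simps power2_eq_square)
    then have "s * (s - 1) div 3 - (1 - a) * (1 + c) = e" by simp
    then show ?thesis
      unfolding k mac_exp_def prod.case s_def[symmetric] e_def[symmetric]
      by (simp add: s_def algebra_simps)
  qed
qed

section \<open>Limits of the bosonic sums\<close>

definition bos_fps :: "int \<Rightarrow> int \<Rightarrow> (int \<Rightarrow> int \<Rightarrow> int \<Rightarrow> 'a::field_char_0 fps) \<Rightarrow> int \<Rightarrow> 'a fps" where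
  "bos_fps K i G B = (\<Sum>(a, b, c)\<in>tri B. fps_const (of_int (chi3 (a - b)))
     * fps_X ^ nat (K * ((qform a b - 1) div 3) - i * (a - c - 2)) * G a b c)"

text \<open>Modulo X^d only finitely many lattice points count, and on these the kernel may be
  replaced by its limit E. Since C is chosen before B, G and E, the parameters inside the kernel can
  be made large afterwards.\<close>

lemma bos_fps_agree:
  fixes K i d :: nat
  assumes "0 < i" "2 * i < K"
  shows "\<exists>C. \<forall>B (G :: int \<Rightarrow> int \<Rightarrow> int \<Rightarrow> 'a::field_char_0 fps) E. int C \<le> B \<longrightarrow>
    (\<forall>a b c. \<bar>a\<bar> \<le> int C \<longrightarrow> \<bar>b\<bar> \<le> int C \<longrightarrow> \<bar>c\<bar> \<le> int C \<longrightarrow> agree d (G a b c) E) \<longrightarrow>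
    agree d (bos_fps K i G B) (tser (mac_exp K i) mac_coeff mac_index * E)"
proof -
  have adm: "admissible (mac_exp K i) mac_index" by (rule macdonald(1)[OF assms])
  define S where "S = {x\<in>mac_index. mac_exp K i x \<le> int d}"
  have S: "finite S" unfolding S_def by (rule admissible_finite_le[OF adm])
  \<comment> \<open>A crude common bound: a = 1 - u, b = u - v and c = v - 1 are all at most |u| +
    |v| + 1 in absolute value.\<close>
  define C where "C = nat (\<Sum>(x, y)\<in>S. \<bar>x\<bar> + \<bar>y\<bar> + 1)"
  have Cge: "\<bar>x\<bar> + \<bar>y\<bar> + 1 \<le> int C" if "(x, y) \<in> S" for x y
  proof -
    have "(\<lambda>(x, y). \<bar>x\<bar> + \<bar>y\<bar> + 1) (x, y) \<le> (\<Sum>(x, y)\<in>S. \<bar>x\<bar> + \<bar>y\<bar> + 1)"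
      by (rule member_le_sum[OF that]) (use S in auto)
    moreover have "(\<Sum>(x, y)\<in>S. \<bar>x\<bar> + \<bar>y\<bar> + 1) \<le> int C" by (simp add: C_def)
    ultimately show ?thesis unfolding prod.case by linarith
  qed
  have bound: "\<bar>a\<bar> \<le> int C \<and> \<bar>b\<bar> \<le> int C \<and> \<bar>c\<bar> \<le> int C"
    if "a + b + c = 0" "chi3 (a - b) \<noteq> 0" "mac_exp K i (kappa_index (a, b, c)) < int d" for a b c
  proof -
    have "kappa_index (a, b, c) \<in> S"
      using that kappa_index_props(1)[OF that(1)] by (simp add: S_def)
    then have "\<bar>1 - a\<bar> + \<bar>1 + c\<bar> + 1 \<le> int C"
      by (intro Cge) (simp add: kappa_index_def)
    then show ?thesis using that(1) by linarith
  qed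
  show ?thesis
  proof (intro exI[of _ C] allI impI)
    fix B :: int and G :: "int \<Rightarrow> int \<Rightarrow> int \<Rightarrow> 'a fps" and E
    assume B: "int C \<le> B"
      and G: "\<forall>a b c. \<bar>a\<bar> \<le> int C \<longrightarrow> \<bar>b\<bar> \<le> int C \<longrightarrow> \<bar>c\<bar> \<le> int C \<longrightarrow> agree d (G a b c) E"
    let ?e = "\<lambda>(a :: int, b :: int, c :: int). nat (int K * ((qform a b - 1) div 3) - int i * (a - c - 2))"
    let ?t = "\<lambda>x. (case x of (a, b, c) \<Rightarrow> fps_const (of_int (chi3 (a - b)))) * fps_X ^ ?e x :: 'a fps"
    have "agree d (bos_fps K i G B) (\<Sum>x\<in>tri B. ?t x * E)"
      unfolding bos_fps_def
    proof (rule agree_sum)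
      fix x assume "x \<in> tri B"
      then obtain a b c where x: "x = (a, b, c)" and s: "a + b + c = 0" by (auto simp: tri_def)
      show "agree d (case x of (a, b, c) \<Rightarrow> fps_const (of_int (chi3 (a - b)))
     * fps_X ^ nat (int K * ((qform a b - 1) div 3) - int i * (a - c - 2)) * G a b c)
        (?t x * E)"
      proof (cases "chi3 (a - b) = 0")
        case False
        note me = kappa_index_props(3)[OF s False, of "int K" "int i"]
        show ?thesis
        proof (cases "mac_exp K i (kappa_index (a, b, c)) < int d")
          case True
          then have "agree d (G a b c) E" using bound[OF s False] G by blast
          then show ?thesis unfolding x by (simp add: agree_mult)
        next
          case False
          then have "d \<le> ?e (a, b, c)" using me by simp
          then have *: "agree d (fps_const z * fps_X ^ ?e (a, b, c) * f) 0" for z :: 'a and f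
            using agree_X_power[of d "?e (a, b, c)" "fps_const z * f"] by (simp add: mult_ac)
          show ?thesis
            unfolding x prod.case using agree_trans[OF * agree_sym[OF *]] by simp
        qed
      qed (simp add: x)
    qed
    also have "(\<Sum>x\<in>tri B. ?t x * E)
      = (\<Sum>x\<in>tri B. ?t x) * E"
      by (rule sum_distrib_right[symmetric])
    also have "(\<Sum>x\<in>tri B. ?t x :: 'a fps)
      = (\<Sum>x\<in>{x\<in>tri B. kappa_index x \<in> mac_index}. ?t x)"
    proof (rule sum.mono_neutral_right)
      show "\<forall>x\<in>tri B - {x \<in> tri B. kappa_index x \<in> mac_index}.
          ?t x = (0 :: 'a fps)"
      proof
        fix x assume x: "x \<in> tri B - {x \<in> tri B. kappa_index x \<in> mac_index}"
        then obtain a b c where abc: "x = (a, b, c)" and s: "a + b + c = 0" by (auto simp: tri_def)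
        then have "chi3 (a - b) = 0" using x kappa_index_props(1)[OF s] by auto
        then show "?t x = (0 :: 'a fps)"
          by (simp add: abc)
      qed
    qed auto
    also have "\<dots> = (\<Sum>x\<in>kappa_index ` {x\<in>tri B. kappa_index x \<in> mac_index}. fps_const (mac_coeff x) * fps_X ^ nat (mac_exp K i x))"
    proof -
      have inj: "inj_on kappa_index {x \<in> tri B. kappa_index x \<in> mac_index}"
        by (auto simp: inj_on_def kappa_index_def tri_def)
      show ?thesis
        unfolding sum.reindex[OF inj]
      proof (rule sum.cong[OF refl])
        fix x assume x: "x \<in> {x\<in>tri B. kappa_index x \<in> mac_index}"
        then obtain a b c where abc: "x = (a, b, c)" and s: "a + b + c = 0" by (auto simp: tri_def)
        then have chi: "chi3 (a - b) \<noteq> 0" using x kappa_index_props(1)[OF s] by auto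
        show "?t x
          = ((\<lambda>x. fps_const (mac_coeff x) * fps_X ^ nat (mac_exp K i x)) \<circ> kappa_index) x"
          unfolding abc comp_def kappa_index_props(2)[OF s chi] kappa_index_props(3)[OF s chi] by simp
      qed
    qed
    also have "agree d (\<dots> * E) (tser (mac_exp K i) mac_coeff mac_index * E)"
    proof (intro agree_mult agree_refl agree_sym[OF tser_agree[OF adm]])
      show "finite (kappa_index ` {x \<in> tri B. kappa_index x \<in> mac_index})" by simp
      fix y assume y: "y \<in> mac_index" "mac_exp K i y < int d"
      obtain u v where uv: "y = (u, v)" by (cases y)
      have y': "y = kappa_index (1 - u, u - v, v - 1)" by (simp add: uv kappa_index_def)
      have s: "(1 - u) + (u - v) + (v - 1) = 0" by simp
      have "chi3 ((1 - u) - (u - v)) \<noteq> 0"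
        using y(1) kappa_index_props(1)[OF s] y' by simp
      from bound[OF s this] y y' B have "(1 - u, u - v, v - 1) \<in> tri B"
        by (auto simp: tri_def)
      with y y' show "y \<in> kappa_index ` {x \<in> tri B. kappa_index x \<in> mac_index}" by auto
    qed auto
    finally show "agree d (bos_fps K i G B) (tser (mac_exp K i) mac_coeff mac_index * E)" .
  qed
qed

definition ker3_fps :: "int \<Rightarrow> int \<Rightarrow> int \<Rightarrow> int \<Rightarrow> int \<Rightarrow> 'a::field_char_0 fps" where
  "ker3_fps N M a b c = pfin 1 1 (nat (N + M)) * iqf 1 (N - a) * iqf 1 (N - b) * iqf 1 (N - c)
     * iqf 1 (M + a) * iqf 1 (M + b) * iqf 1 (M + c)"

text \<open>One factor tends to (q)_inf and six to its inverse.\<close>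

lemma ker3_fps_agree:
  assumes "\<bar>a\<bar> + int d \<le> N" "\<bar>b\<bar> + int d \<le> N" "\<bar>c\<bar> + int d \<le> N"
  shows "agree d (ker3_fps N N a b c) (inverse (pinf 1 1) ^ 5 :: 'a::field_char_0 fps)"
proof -
  let ?P = "pinf 1 1 :: 'a fps"
  have "agree d (ker3_fps N N a b c) (?P * inverse ?P * inverse ?P * inverse ?P * inverse ?P * inverse ?P * inverse ?P)"
    unfolding ker3_fps_def
    by (intro agree_mult agree_iqf agree_sym[OF agree_pinf]) (use assms in auto)
  moreover have PI: "?P * inverse ?P = 1"
    using pinf_nth_0[of 1 1, where 'a = 'a] by (intro inverse_mult_eq_1') simp
  ultimately show ?thesis
    unfolding PI mult_1_left by (simp add: eval_nat_numeral mult.assoc)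
qed

lemma iq_fls_X: "qfield.iq (fls_X :: 'a::field_char_0 fls) n = fps_to_fls (iqf 1 n)"
  using iq_fls[of 1 n, where 'a = 'a] by simp

lemma qfac_fls_X: "qfield.qfac (fls_X :: 'a::field_char_0 fls) n = fps_to_fls (pfin 1 1 (nat n))"
  using qfac_fls[of 1 n, where 'a = 'a] by simp

lemma ker3_fls_X: "qfield.ker3 (fls_X :: 'a::field_char_0 fls) N M a b c = fps_to_fls (ker3_fps N M a b c)"
proof -
  interpret qfield "fls_X :: 'a fls" using qfield_fls_X[of 1, where 'a = 'a] by simp
  show ?thesis
    by (simp only: ker3_def ker3_fps_def iq_fls_X qfac_fls_X fls_times_fps_to_fls)
qed

text \<open>The exponent equals a value of \<open>mac_exp\<close> on its index set, which is
  nonnegative by admissibility, so \<open>nat\<close> loses nothing. Where the character vanishes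
  both sides are 0.\<close>

lemma bos_fls_aux:
  fixes K i :: nat
  assumes "0 < i" "2 * i < K" "a + b + c = 0"
  shows "of_int (chi3 (a - b)) * (fls_X :: 'a::field_char_0 fls) powi (int K * ((qform a b - 1) div 3) - int i * (a - c - 2))
      * fps_to_fls G
    = fps_to_fls (fps_const (of_int (chi3 (a - b))) * fps_X ^ nat (int K * ((qform a b - 1) div 3) - int i * (a - c - 2)) * G)"
proof (cases "chi3 (a - b) = 0")
  case False
  let ?e = "int K * ((qform a b - 1) div 3) - int i * (a - c - 2)"
  have "?e \<ge> 0"
    using macdonald(1)[OF assms(1,2)] kappa_index_props(1)[OF assms(3)] kappa_index_props(3)[OF assms(3) False, of "int K" "int i"] False
    by (metis admissible_def)
  then have "(fls_X :: 'a fls) powi ?e = fps_to_fls (fps_X ^ nat ?e)"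
    by (simp add: power_int_def fps_to_fls_power)
  moreover have "(of_int (chi3 (a - b)) :: 'a fls) = fps_to_fls (fps_const (of_int (chi3 (a - b))))"
    by (simp add: fls_of_int)
  ultimately show ?thesis by (simp only: fls_times_fps_to_fls)
qed simp

lemma bos_fls_X:
  fixes K i :: nat
  assumes "0 < i" "2 * i < K"
  shows "qfield.bos (fls_X :: 'a::field_char_0 fls) B K i N M
    = fps_to_fls (bos_fps K i (\<lambda>a b c. ker3_fps N M (a - 1) b (c + 1)) B)"
proof -
  interpret qfield "fls_X :: 'a fls" using qfield_fls_X[of 1, where 'a = 'a] by simp
  show ?thesis
    unfolding bos_def bos_fps_def fps_to_fls_sum ker3_fls_X
    by (rule sum.cong[OF refl]) (use bos_fls_aux[OF assms] in \<open>auto simp: tri_def\<close>)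
qed

lemma bosf_fls_X:
  fixes K :: nat
  assumes "2 < K"
  shows "qfield.bosf (fls_X :: 'a::field_char_0 fls) B K N M
    = fps_to_fls (bos_fps K 1 (ker3_fps N M) B)"
proof -
  interpret qfield "fls_X :: 'a fls" using qfield_fls_X[of 1, where 'a = 'a] by simp
  show ?thesis
    unfolding bosf_def bos_fps_def fps_to_fls_sum ker3_fls_X
    by (rule sum.cong[OF refl]) (use bos_fls_aux[of 1 K, where 'a = 'a] assms in \<open>auto simp: tri_def\<close>)
qed

subsection \<open>The multisum\<close>

lemma sum_PiE_insert:
  assumes "finite A" "i \<notin> I" "finite I"
  shows "(\<Sum>p\<in>insert i I \<rightarrow>\<^sub>E A. F p) = (\<Sum>x\<in>A. \<Sum>p\<in>I \<rightarrow>\<^sub>E A. F (p(i := x)))"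
proof -
  have inj: "inj_on (\<lambda>(x, p). p(i := x)) (A \<times> (I \<rightarrow>\<^sub>E A))"
    using assms(2) by (rule inj_combinator)
  have "(\<Sum>p\<in>insert i I \<rightarrow>\<^sub>E A. F p) = (\<Sum>(x, p)\<in>A \<times> (I \<rightarrow>\<^sub>E A). F (p(i := x)))"
    unfolding PiE_insert_eq by (subst sum.reindex[OF inj]) (simp add: case_prod_unfold comp_def)
  then show ?thesis by (simp add: sum.cartesian_product)
qed

text \<open>The transfer matrix principle: p is a path, c its local weights, and Z j x the total
  weight of all continuations from state x at place j. The initial weight f is arbitrary so that the
  induction can put \<open>c i x\<close> in its place.\<close>

lemma sum_transfer_chain:
  fixes c :: "nat \<Rightarrow> 'b \<Rightarrow> 'b \<Rightarrow> 'c::comm_ring_1"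
  assumes A: "finite A" and "i \<le> k"
    and Zk: "\<And>x. x \<in> A \<Longrightarrow> Z k x = g x"
    and Z: "\<And>j x. j < k \<Longrightarrow> i \<le> j \<Longrightarrow> x \<in> A \<Longrightarrow> Z j x = (\<Sum>y\<in>A. c j x y * Z (Suc j) y)"
  shows "(\<Sum>p\<in>{i..k} \<rightarrow>\<^sub>E A. f (p i) * (\<Prod>j\<in>{i..<k}. c j (p j) (p (Suc j))) * g (p k)) = (\<Sum>x\<in>A. f x * Z i x)"
  using assms(2) Z
proof (induction i arbitrary: f rule: inc_induct)
  case base
  have "(\<Sum>p\<in>{k..k} \<rightarrow>\<^sub>E A. f (p k) * (\<Prod>j\<in>{k..<k}. c j (p j) (p (Suc j))) * g (p k))
    = (\<Sum>p\<in>insert k {} \<rightarrow>\<^sub>E A. f (p k) * g (p k))" by simp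
  also have "\<dots> = (\<Sum>x\<in>A. f x * Z k x)"
    by (subst sum_PiE_insert[OF A]) (simp_all add: Zk)
  finally show ?case .
next
  case (step i)
  have ins: "{i..k} = insert i {Suc i..k}" using step.hyps by auto
  have "(\<Sum>p\<in>{i..k} \<rightarrow>\<^sub>E A. f (p i) * (\<Prod>j\<in>{i..<k}. c j (p j) (p (Suc j))) * g (p k))
    = (\<Sum>x\<in>A. \<Sum>p\<in>{Suc i..k} \<rightarrow>\<^sub>E A. f x * (c i x (p (Suc i)) * (\<Prod>j\<in>{Suc i..<k}. c j (p j) (p (Suc j))) * g (p k)))"
    unfolding ins
  proof (subst sum_PiE_insert[OF A])
    show "(\<Sum>x\<in>A. \<Sum>p\<in>{Suc i..k} \<rightarrow>\<^sub>E A. f ((p(i := x)) i) * (\<Prod>j\<in>{i..<k}. c j ((p(i := x)) j) ((p(i := x)) (Suc j))) * g ((p(i := x)) k))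
      = (\<Sum>x\<in>A. \<Sum>p\<in>{Suc i..k} \<rightarrow>\<^sub>E A. f x * (c i x (p (Suc i)) * (\<Prod>j\<in>{Suc i..<k}. c j (p j) (p (Suc j))) * g (p k)))"
    proof (rule sum.cong[OF refl], rule sum.cong[OF refl])
      fix x p
      have "{i..<k} = insert i {Suc i..<k}" using step.hyps by auto
      then have "(\<Prod>j\<in>{i..<k}. c j ((p(i := x)) j) ((p(i := x)) (Suc j)))
        = c i x (p (Suc i)) * (\<Prod>j\<in>{Suc i..<k}. c j ((p(i := x)) j) ((p(i := x)) (Suc j)))"
        by simp
      also have "(\<Prod>j\<in>{Suc i..<k}. c j ((p(i := x)) j) ((p(i := x)) (Suc j))) = (\<Prod>j\<in>{Suc i..<k}. c j (p j) (p (Suc j)))"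
        by (rule prod.cong) auto
      finally show "f ((p(i := x)) i) * (\<Prod>j\<in>{i..<k}. c j ((p(i := x)) j) ((p(i := x)) (Suc j))) * g ((p(i := x)) k)
        = f x * (c i x (p (Suc i)) * (\<Prod>j\<in>{Suc i..<k}. c j (p j) (p (Suc j))) * g (p k))"
        using step.hyps by (simp add: mult.assoc)
    qed
  qed auto
  also have "\<dots> = (\<Sum>x\<in>A. f x * (\<Sum>y\<in>A. c i x y * Z (Suc i) y))"
    unfolding sum_distrib_left[symmetric]
    using step.IH[of "c i _"] step.prems by (intro sum.cong refl arg_cong2[of _ _ _ _ "(*)"]) auto
  also have "\<dots> = (\<Sum>x\<in>A. f x * Z i x)"
    using step.prems[of i] step.hyps by (intro sum.cong refl) auto
  finally show ?case .
qed

context qfield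
begin

lemma qbi_nonzeroD: "qbi n m \<noteq> 0 \<Longrightarrow> 0 \<le> m \<and> m \<le> n"
  unfolding qbi_def by (metis diff_ge_0_iff_ge iq_neg linorder_not_less mult_eq_0_iff)

text \<open>The second q-binomial forces m <= n - n' + m' + delta. Starting from m = 2n at the inner
  end, the bound rises to 2n + 1 exactly where delta = 1. It allows rectangles of summation that do
  not depend on n.\<close>

lemma ferm_support:
  assumes "n \<ge> 0" "ferm D d n m \<noteq> 0"
  shows "m \<le> 2 * n + 1 - lin D d"
  using assms
proof (induction d arbitrary: n m)
  case 0
  then show ?case by (simp add: lin_def split: if_splits)
next
  case (Suc d)
  then have "(\<Sum>n'\<in>{0..n}. \<Sum>m'\<in>{0..2 * n' + 1 - lin D d}.
         qbi n n' * qbi (n - n' + m' + of_bool (d = D)) m * ferm D d n' m') \<noteq> 0"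
    by auto
  then obtain n' where n': "n' \<in> {0..n}" "(\<Sum>m'\<in>{0..2 * n' + 1 - lin D d}.
         qbi n n' * qbi (n - n' + m' + of_bool (d = D)) m * ferm D d n' m') \<noteq> 0"
    by (meson sum.neutral)
  then obtain m' where m': "m' \<in> {0..2 * n' + 1 - lin D d}"
      "qbi n n' * qbi (n - n' + m' + of_bool (d = D)) m * ferm D d n' m' \<noteq> 0"
    by (meson sum.neutral)
  then have "m \<le> n - n' + m' + of_bool (d = D)"
    using qbi_nonzeroD[of "n - n' + m' + of_bool (d = D)" m] by simp
  moreover have "lin D d = lin D (Suc d) + of_bool (d = D)" by (auto simp: lin_def)
  ultimately show ?case using m'(1) n'(1) by simp
qed

lemma ferm_Suc_box:
  assumes "0 \<le> n" "n \<le> C"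
  shows "ferm D (Suc d) n m = (\<Sum>(n', m')\<in>{0..C} \<times> {0..2 * C + 1}.
     q powi (n^2 - n * m + m^2 + lin D (Suc d) * (n + m))
       * (qbi n n' * qbi (n - n' + m' + of_bool (d = D)) m) * ferm D d n' m')"
proof -
  let ?t = "\<lambda>n' m'. qbi n n' * qbi (n - n' + m' + of_bool (d = D)) m * ferm D d n' m'"
  have "(\<Sum>n'\<in>{0..n}. \<Sum>m'\<in>{0..2 * n' + 1 - lin D d}. ?t n' m') = (\<Sum>n'\<in>{0..n}. \<Sum>m'\<in>{0..2 * C + 1}. ?t n' m')"
  proof (rule sum.cong[OF refl], rule sum.mono_neutral_left)
    fix n' assume n': "n' \<in> {0..n}"
    have "lin D d \<ge> 0" by (simp add: lin_def)
    then show "{0..2 * n' + 1 - lin D d} \<subseteq> {0..2 * C + 1}" using n' assms by auto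
    show "\<forall>i\<in>{0..2 * C + 1} - {0..2 * n' + 1 - lin D d}. ?t n' i = 0"
      using ferm_support[of n' D d] n' by fastforce
  qed simp
  also have "\<dots> = (\<Sum>n'\<in>{0..C}. \<Sum>m'\<in>{0..2 * C + 1}. ?t n' m')"
  proof (rule sum.mono_neutral_left)
    show "\<forall>i\<in>{0..C} - {0..n}. (\<Sum>m'\<in>{0..2 * C + 1}. ?t i m') = 0"
      using qbi_nonzeroD[of n] by (intro ballI sum.neutral) force
  qed (use assms in auto)
  finally show ?thesis
    by (simp add: sum.cartesian_product[symmetric] sum_distrib_left mult.assoc)
qed

lemma ferm_sum_box:
  assumes "0 \<le> N"
  shows "ferm_sum D d N M = (\<Sum>(n, m)\<in>{0..N} \<times> {0..2 * N + 1}.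
     iq (N - n) * iq M * iq (M + m - n + lin D d) * (iq n * ferm D d n m))"
proof -
  have "ferm_sum D d N M = (\<Sum>n\<in>{0..N}. \<Sum>m\<in>{0..2 * N + 1}. iq (N - n) * iq M * iq (M + m - n + lin D d) * (iq n * ferm D d n m))"
    unfolding ferm_sum_def mult.assoc
  proof (rule sum.cong[OF refl], rule sum.mono_neutral_left)
    fix n assume n: "n \<in> {0..N}"
    have "lin D d \<ge> 0" by (simp add: lin_def)
    then show "{0..2 * n + 1 - lin D d} \<subseteq> {0..2 * N + 1}" using n by auto
    show "\<forall>i\<in>{0..2 * N + 1} - {0..2 * n + 1 - lin D d}. iq (N - n) * (iq M * (iq (M + i - n + lin D d) * (iq n * ferm D d n i))) = 0"
      using ferm_support[of n D d] n by fastforce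
  qed simp
  then show ?thesis by (simp add: sum.cartesian_product)
qed

end

section \<open>The fermionic side as power series\<close>

lemma pinf_pfin_split:
  "pinf 1 1 = (pfin 1 1 n * qpoch_inf (fps_X * fps_X ^ n) fps_X :: 'a::field fps)"
proof (rule agree_eqI)
  fix d
  have sp: "pfin 1 1 (n + N) = (pfin 1 1 n * pfin 1 (Suc n) N :: 'a fps)" for N
    by (induction N) (simp_all add: pfin_def mult.assoc)
  have "agree d (pinf 1 1) (pfin 1 1 (n + d) :: 'a fps)"
    by (rule agree_pinf) auto
  also have "pfin 1 1 (n + d) = (pfin 1 1 n * pfin 1 (Suc n) d :: 'a fps)" by (rule sp)
  also have "agree d \<dots> (pfin 1 1 n * pinf 1 (Suc n))"
    by (intro agree_mult agree_refl agree_sym[OF agree_pinf]) auto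
  finally show "agree d (pinf 1 1) (pfin 1 1 n * qpoch_inf (fps_X * fps_X ^ n) fps_X :: 'a fps)"
    by simp
qed

lemma qpoch_X: "qpoch fps_X fps_X n = (pfin 1 1 n :: 'a::field fps)"
proof -
  let ?Q = "qpoch_inf (fps_X * fps_X ^ n) fps_X :: 'a fps"
  have "fps_nth (pinf 1 (Suc n) :: 'a fps) 0 = 1" by (rule pinf_nth_0) auto
  then have "?Q \<noteq> 0" by auto
  then show ?thesis
    using pinf_pfin_split[of n, where 'a = 'a] by (simp add: qpoch_def)
qed

lemma qbinom_fls:
  "fps_to_fls (qbinom fps_X n m) = qfield.qbi (fls_X :: 'a::field_char_0 fls) n m"
proof -
  interpret qfield "fls_X :: 'a fls" using qfield_fls_X[of 1, where 'a = 'a] by simp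
  show ?thesis
  proof (cases "0 \<le> m \<and> m \<le> n")
    case True
    have nz: "fps_nth (pfin 1 1 l :: 'a fps) 0 = 1" for l by (rule pfin_nth_0) simp
    have "qbinom fps_X n m = (pfin 1 1 (nat n) * (inverse (pfin 1 1 (nat m)) * inverse (pfin 1 1 (nat (n - m)))) :: 'a fps)"
      using True nz by (simp add: qbinom_def qpoch_X fps_divide_unit fps_inverse_mult)
    then show ?thesis
      using True by (simp add: qbi_def qfac_fls_X iq_fls_X iqf_def fls_times_fps_to_fls)
  next
    case False
    then show ?thesis using qbi_nonzeroD[of n m] by (auto simp: qbinom_def)
  qed
qed

text \<open>The factor of index j as a transfer weight from (n_j, m_j) to (n_(j+1), m_(j+1)). The
  global linear exponent is distributed over the links to make the weight local.\<close>

definition link :: "nat \<Rightarrow> nat \<Rightarrow> nat \<times> nat \<Rightarrow> nat \<times> nat \<Rightarrow> 'a::field_char_0 fps" where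
  "link s j = (\<lambda>(n, m) (n', m'). fps_X ^ nat ((int n)^2 - int n * int m + (int m)^2)
     * fps_X ^ (if s \<le> j then n + m else 0)
     * (qbinom fps_X (int n) (int n')
     * qbinom fps_X (int n - int n' + int m' + of_bool (j = s - 1)) (int m)))"

definition box :: "nat \<Rightarrow> (nat \<times> nat) set" where
  "box N = {0..N} \<times> {0..2 * N + 1}"

primrec ferm_fps :: "nat \<Rightarrow> nat \<Rightarrow> nat \<Rightarrow> nat \<Rightarrow> nat \<times> nat \<Rightarrow> 'a::field_char_0 fps" where
  "ferm_fps N k s 0 x = (case x of (n, m) \<Rightarrow> if m = 2 * n then fps_X ^ (n^2 + n) else 0)"
| "ferm_fps N k s (Suc d) x = (\<Sum>y\<in>box N. link s (k - Suc d) x y * ferm_fps N k s d y)"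

lemma finite_box [simp]: "finite (box N)"
  by (simp add: box_def)

text \<open>Four times the form is 3n^2 + (2m-n)^2 and also 3m^2 + (2n-m)^2, so an entry of at least
  2d makes the form at least 3d^2.\<close>

lemma norm_form_ge:
  fixes n m :: int
  shows "n^2 - n * m + m^2 \<ge> 0" and "2 * int d \<le> n \<or> 2 * int d \<le> m \<Longrightarrow> int d \<le> n^2 - n * m + m^2"
proof -
  define X Y Z where "X = n^2 - n * m + m^2" and "Y = (2 * m - n)^2" and "Z = (2 * n - m)^2"
  have a: "4 * X = 3 * n^2 + Y" and b: "4 * X = 3 * m^2 + Z"
    by (simp_all add: X_def Y_def Z_def algebra_simps power2_eq_square)
  have pos: "n^2 \<ge> 0" "Y \<ge> 0" "Z \<ge> 0" by (simp_all add: Y_def Z_def)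
  then show "n^2 - n * m + m^2 \<ge> 0" using a unfolding X_def[symmetric] by linarith
  have sq: "4 * int d \<le> 3 * x^2" if "2 * int d \<le> x" for x
  proof -
    have "(2 * int d)^2 \<le> x^2" using that by (intro power_mono) auto
    moreover have "int d \<le> (int d)^2" by (cases d) (auto simp: power2_eq_square)
    moreover have "(2 * int d)^2 = 4 * (int d)^2" by (simp add: power_mult_distrib)
    moreover have "x^2 \<ge> 0" by simp
    ultimately show ?thesis by linarith
  qed
  show "int d \<le> n^2 - n * m + m^2" if "2 * int d \<le> n \<or> 2 * int d \<le> m"
    using that unfolding X_def[symmetric]
  proof
    assume "2 * int d \<le> n"
    from sq[OF this] show "int d \<le> X" using a pos by linarith
  next
    assume "2 * int d \<le> m"
    from sq[OF this] show "int d \<le> X" using b pos by linarith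
  qed
qed

lemma X_power_dvd_link:
  assumes "2 * d \<le> n \<or> 2 * d \<le> m"
  shows "fps_X ^ d dvd (link s j (n, m) y :: 'a::field_char_0 fps)"
proof -
  have "d \<le> nat ((int n)^2 - int n * int m + (int m)^2)"
    using norm_form_ge(2)[of d "int n" "int m"] assms by linarith
  then have "(fps_X :: 'a fps) ^ d dvd fps_X ^ nat ((int n)^2 - int n * int m + (int m)^2)"
    by (rule le_imp_power_dvd)
  then show ?thesis
    by (cases y) (simp add: link_def)
qed

lemma agree_0_dvd: "fps_X ^ d dvd (f :: 'a::field_char_0 fps) \<Longrightarrow> agree d f 0"
  using agree_X_power[of d d] by (auto elim!: dvdE)

lemma X_power_dvd_ferm_fps:
  assumes "2 * d \<le> n"
  shows "fps_X ^ d dvd (ferm_fps N k s c (n, m) :: 'a::field_char_0 fps)"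
proof (cases c)
  case 0
  have "d \<le> n^2 + n" using assms by simp
  then show ?thesis unfolding 0 by (auto intro: le_imp_power_dvd)
next
  case (Suc c)
  show ?thesis
    unfolding Suc ferm_fps.simps
    by (intro dvd_sum dvd_mult2 X_power_dvd_link) (use assms in auto)
qed

lemma sum_box_int:
  "(\<Sum>(n, m)\<in>{0..int N} \<times> {0..2 * int N + 1}. f n m) = (\<Sum>(n, m)\<in>box N. f (int n) (int m))"
  unfolding box_def
  by (rule sum.reindex_bij_witness[of _ "\<lambda>(n, m). (int n, int m)" "\<lambda>(n, m). (nat n, nat m)"]) auto

text \<open>For n <= N the cut-off at \<open>box N\<close> is invisible: the first q-binomial
  confines n' to at most n, and \<open>ferm_support\<close> confines m'.\<close>

lemma ferm_fps_fls:
  assumes "1 \<le> s" "s \<le> k" "d < k" "n \<le> N"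
  shows "fps_to_fls (ferm_fps N k s d (n, m))
    = qfield.ferm (fls_X :: 'a::field_char_0 fls) (k - s) d (int n) (int m)"
  using assms(3,4)
proof (induction d arbitrary: n m)
  interpret qfield "fls_X :: 'a fls" using qfield_fls_X[of 1, where 'a = 'a] by simp
  case 0
  have "int (n^2 + n) = (int n)^2 + int n" by simp
  then have "(fls_X :: 'a fls) powi ((int n)^2 + int n) = fls_X ^ (n^2 + n)"
    by (metis power_int_of_nat)
  then show ?case by (simp add: fps_to_fls_power)
next
  interpret qfield "fls_X :: 'a fls" using qfield_fls_X[of 1, where 'a = 'a] by simp
  case (Suc d)
  define e where "e = lin (k - s) (Suc d)"
  have e: "e = (if s \<le> k - Suc d then 1 else 0)"
    using Suc.prems assms(1,2) by (auto simp: e_def lin_def)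
  have \<delta>: "(k - Suc d = s - 1) = (d = k - s)"
    using Suc.prems assms(1,2) by auto
  have pw: "(fls_X :: 'a fls) powi ((int n)^2 - int n * int m + (int m)^2 + e * (int n + int m))
    = fps_to_fls (fps_X ^ nat ((int n)^2 - int n * int m + (int m)^2) * fps_X ^ (if s \<le> k - Suc d then n + m else 0))"
  proof -
    define u where "u = (int n)^2 - int n * int m + (int m)^2"
    have "u \<ge> 0" unfolding u_def by (rule norm_form_ge)
    then have "u + e * (int n + int m) = int (nat u + (if s \<le> k - Suc d then n + m else 0))"
      by (simp add: e)
    then have "(fls_X :: 'a fls) powi (u + e * (int n + int m)) = fls_X ^ (nat u + (if s \<le> k - Suc d then n + m else 0))"
      by (metis power_int_of_nat)
    then show ?thesis
      by (simp add: u_def fps_to_fls_power fls_times_fps_to_fls power_add)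
  qed
  have "ferm (k - s) (Suc d) (int n) (int m) = (\<Sum>(n', m')\<in>box N.
     fls_X powi ((int n)^2 - int n * int m + (int m)^2 + e * (int n + int m))
       * (qbi (int n) (int n') * qbi (int n - int n' + int m' + of_bool (d = k - s)) (int m)) * ferm (k - s) d (int n') (int m'))"
    using Suc.prems by (subst ferm_Suc_box[of "int n" "int N"]) (simp_all add: sum_box_int e_def)
  also have "\<dots> = (\<Sum>y\<in>box N. fps_to_fls (link s (k - Suc d) (n, m) y * ferm_fps N k s d y))"
  proof (rule sum.cong[OF refl])
    fix y assume "y \<in> box N"
    then obtain n' m' where y: "y = (n', m')" "n' \<le> N" by (auto simp: box_def)
    show "(case y of (n', m') \<Rightarrow>
     fls_X powi ((int n)^2 - int n * int m + (int m)^2 + e * (int n + int m))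
       * (qbi (int n) (int n') * qbi (int n - int n' + int m' + of_bool (d = k - s)) (int m)) * ferm (k - s) d (int n') (int m'))
      = fps_to_fls (link s (k - Suc d) (n, m) y * ferm_fps N k s d y)"
      unfolding y prod.case link_def pw \<delta> qbinom_fls[symmetric]
      using Suc.IH[of n' m'] Suc.prems y(2) by (simp only: fls_times_fps_to_fls Suc_lessD)
  qed
  also have "\<dots> = fps_to_fls (ferm_fps N k s (Suc d) (n, m))"
    by (simp add: fps_to_fls_sum)
  finally show ?case ..
qed

section \<open>The summand of the theorem and its sums over boxes\<close>

definition summand :: "nat \<Rightarrow> nat \<Rightarrow> (nat \<Rightarrow> nat) \<times> (nat \<Rightarrow> nat) \<Rightarrow> 'a::field_char_0 fps" where
  "summand k s = (\<lambda>(n, m).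
        fps_X ^ ((n k)^2 + (\<Sum>i=s..k. n i) + (\<Sum>i=s..k-1. m i)) / qpoch fps_X fps_X (n 1) *
        (\<Prod>i=1..k-1.
           fps_X ^ nat ((int (n i))^2 - int (n i) * int (m i) + (int (m i))^2) *
           qbinom fps_X (int (n i)) (int (n (i + 1))) *
           qbinom fps_X
             (int (n i) - int (n (i + 1)) + int ((m(k := 2 * n k)) (i + 1)) + of_bool (i = s - 1))
             (int (m i))))"

text \<open>Merges the two index functions into one path. The value m_k = 2 n_k is written in here
  because m itself is only defined up to k - 1.\<close>

definition join :: "nat \<Rightarrow> (nat \<Rightarrow> nat) \<times> (nat \<Rightarrow> nat) \<Rightarrow> nat \<Rightarrow> nat \<times> nat" where
  "join k = (\<lambda>(n, m). \<lambda>j\<in>{1..k}. (n j, (m(k := 2 * n k)) j))"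

lemma summand_eq:
  assumes "1 \<le> s" "s \<le> k"
  shows "summand k s (n, m) = (inverse (pfin 1 1 (n 1)) * (\<Prod>j\<in>{1..<k}. link s j (join k (n, m) j) (join k (n, m) (Suc j)))
     * fps_X ^ ((n k)^2 + n k) :: 'a::field_char_0 fps)"
proof -
  let ?g = "\<lambda>i. fps_X ^ nat ((int (n i))^2 - int (n i) * int (m i) + (int (m i))^2) :: 'a fps"
  let ?l = "\<lambda>i. if s \<le> i then n i + m i else 0"
  let ?b = "\<lambda>i. qbinom fps_X (int (n i)) (int (n (i + 1))) * qbinom fps_X
             (int (n i) - int (n (i + 1)) + int ((m(k := 2 * n k)) (i + 1)) + of_bool (i = s - 1))
             (int (m i)) :: 'a fps"
  have r: "{1..k-1} = {1..<k}" using assms by auto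
  have k: "{s..k} = insert k {s..k-1}" "k \<notin> {s..k-1}" using assms by auto
  have lin: "(\<Sum>i=s..k. n i) + (\<Sum>i=s..k-1. m i) = n k + (\<Sum>i\<in>{1..<k}. ?l i)"
  proof -
    have "(\<Sum>i\<in>{1..<k}. ?l i) = (\<Sum>i\<in>{s..k-1}. n i + m i)"
      by (rule sum.mono_neutral_cong_right) (use assms in auto)
    moreover have "(\<Sum>i=s..k. n i) = n k + (\<Sum>i=s..k-1. n i)"
      unfolding k(1) using k(2) by (subst sum.insert) auto
    ultimately show ?thesis by (simp add: sum.distrib)
  qed
  have "(\<Prod>j\<in>{1..<k}. link s j (join k (n, m) j) (join k (n, m) (Suc j))) = (\<Prod>i\<in>{1..<k}. ?g i * fps_X ^ ?l i * ?b i)"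
    by (rule prod.cong) (auto simp: link_def join_def)
  also have "\<dots> = (\<Prod>i\<in>{1..<k}. ?g i * ?b i) * fps_X ^ (\<Sum>i\<in>{1..<k}. ?l i)"
    by (simp add: prod.distrib power_sum mult_ac)
  finally have *: "(\<Prod>j\<in>{1..<k}. link s j (join k (n, m) j) (join k (n, m) (Suc j)))
    = (\<Prod>i\<in>{1..<k}. ?g i * ?b i) * fps_X ^ (\<Sum>i\<in>{1..<k}. ?l i)" .
  have "fps_nth (pfin 1 1 (n 1) :: 'a fps) 0 \<noteq> 0" by (simp add: pfin_nth_0)
  then have "summand k s (n, m) = (fps_X ^ ((n k)^2 + ((\<Sum>i=s..k. n i) + (\<Sum>i=s..k-1. m i))) * inverse (pfin 1 1 (n 1)) * (\<Prod>i\<in>{1..<k}. ?g i * ?b i))"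
    unfolding summand_def prod.case qpoch_X r by (simp add: fps_divide_unit mult.assoc add.assoc)
  then show ?thesis
    unfolding * lin by (simp add: power_add mult_ac)
qed

text \<open>For i < k the norm form in the link at i supplies X^d; for i = k the power with exponent
  n_k^2 + n_k does.\<close>

lemma summand_agree_0:
  assumes "1 \<le> s" "s \<le> k" "i \<in> {1..k}" "2 * d \<le> n i \<or> (i < k \<and> 2 * d \<le> m i)"
  shows "agree d (summand k s (n, m) :: 'a::field_char_0 fps) 0"
proof (rule agree_0_dvd)
  show "fps_X ^ d dvd (summand k s (n, m) :: 'a fps)"
  proof (cases "i < k")
    case True
    have "link s i (join k (n, m) i) (join k (n, m) (Suc i)) dvd
        (\<Prod>j\<in>{1..<k}. link s j (join k (n, m) j) (join k (n, m) (Suc j)) :: 'a fps)"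
      using True assms(3) by (intro dvd_prodI) auto
    moreover have "join k (n, m) i = (n i, m i)" using True assms(3) by (simp add: join_def)
    then have "fps_X ^ d dvd (link s i (join k (n, m) i) (join k (n, m) (Suc i)) :: 'a fps)"
      using X_power_dvd_link[of d "n i" "m i" s i "join k (n, m) (Suc i)", where 'a = 'a] assms(4) by auto
    ultimately show ?thesis
      unfolding summand_eq[OF assms(1,2)] by (meson dvd_mult dvd_mult2 dvd_trans)
  next
    case False
    then have "d \<le> (n k)^2 + n k" using assms(3,4) by auto
    then have "fps_X ^ d dvd (fps_X ^ ((n k)^2 + n k) :: 'a fps)" by (rule le_imp_power_dvd)
    then show ?thesis
      unfolding summand_eq[OF assms(1,2)] by (rule dvd_mult)
  qed
qed

text \<open>\<open>join\<close> identifies pairs of index functions with paths that end on m = 2n.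
  Paths with another end have final weight 0, so the restriction can be lifted and
  \<open>sum_transfer_chain\<close> applies.\<close>

lemma sum_summand_box:
  assumes "1 \<le> s" "s \<le> k"
  shows "(\<Sum>x\<in>({1..k} \<rightarrow>\<^sub>E {0..N}) \<times> ({1..k-1} \<rightarrow>\<^sub>E {0..2 * N + 1}). summand k s x)
    = (\<Sum>(n, m)\<in>box N. inverse (pfin 1 1 n) * ferm_fps N k s (k - 1) (n, m) :: 'a::field_char_0 fps)"
proof -
  let ?S = "({1..k} \<rightarrow>\<^sub>E {0..N}) \<times> ({1..k-1} \<rightarrow>\<^sub>E {0..2 * N + 1})"
  let ?g = "\<lambda>(n, m). if m = 2 * n then fps_X ^ (n^2 + n) else (0 :: 'a fps)"
  let ?f = "\<lambda>(n, m :: nat). inverse (pfin 1 1 n) :: 'a fps"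
  let ?F = "\<lambda>p. ?f (p 1) * (\<Prod>j\<in>{1..<k}. link s j (p j) (p (Suc j))) * ?g (p k)"
  define R where "R = {p \<in> {1..k} \<rightarrow>\<^sub>E box N. snd (p k) = 2 * fst (p k)}"
  have "(\<Sum>x\<in>?S. summand k s x) = (\<Sum>p\<in>R. ?F p)"
  proof (rule sum.reindex_bij_witness[of _ "\<lambda>p. (\<lambda>j\<in>{1..k}. fst (p j), \<lambda>j\<in>{1..k-1}. snd (p j))" "join k"])
    fix x assume x: "x \<in> ?S"
    then obtain n m where nm: "x = (n, m)" "n \<in> {1..k} \<rightarrow>\<^sub>E {0..N}" "m \<in> {1..k-1} \<rightarrow>\<^sub>E {0..2 * N + 1}" by auto
    show "(\<lambda>j\<in>{1..k}. fst (join k x j), \<lambda>j\<in>{1..k-1}. snd (join k x j)) = x"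
    proof -
      have "(\<lambda>j\<in>{1..k}. fst (join k x j)) = n"
        using nm(2) by (intro ext) (auto simp: join_def nm(1) restrict_def PiE_def extensional_def)
      moreover have "(\<lambda>j\<in>{1..k-1}. snd (join k x j)) = m"
        using nm(3) by (intro ext) (auto simp: join_def nm(1) restrict_def PiE_def extensional_def)
      ultimately show ?thesis by (simp add: nm(1))
    qed
    have bn: "n j \<le> N" if "j \<in> {1..k}" for j using nm(2) that by (force simp: PiE_iff)
    have bm: "m j \<le> 2 * N + 1" if "j \<in> {1..k-1}" for j using nm(3) that by (force simp: PiE_iff)
    have "join k x j \<in> box N" if "j \<in> {1..k}" for j
      using bn[OF that] bm[of j] that by (auto simp: join_def nm(1) box_def)
    then show "join k x \<in> R"
      using assms by (auto simp: R_def join_def nm(1) PiE_iff)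
    have "join k x 1 = (n 1, (m(k := 2 * n k)) 1)" "join k x k = (n k, 2 * n k)"
      using assms by (auto simp: join_def nm(1))
    then show "?F (join k x) = summand k s x"
      unfolding nm(1) summand_eq[OF assms] by simp
  next
    fix p assume p: "p \<in> R"
    let ?x = "(\<lambda>j\<in>{1..k}. fst (p j), \<lambda>j\<in>{1..k-1}. snd (p j))"
    have b: "p j \<in> box N" if "j \<in> {1..k}" for j using p that by (auto simp: R_def)
    have b': "fst (p j) \<le> N" "snd (p j) \<le> 2 * N + 1" if "j \<in> {1..k}" for j
      using b[OF that] by (auto simp: box_def)
    show "?x \<in> ?S" using b' by auto
    show "join k ?x = p"
    proof
      fix j
      show "join k ?x j = p j"
      proof (cases "j \<in> {1..k}")
        case True
        then show ?thesis
          using p by (cases "j = k") (auto simp: join_def R_def prod_eq_iff)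
      next
        case False
        then show ?thesis
          using p by (auto simp: join_def R_def PiE_def extensional_def)
      qed
    qed
  qed
  also have "(\<Sum>p\<in>R. ?F p) = (\<Sum>p\<in>{1..k} \<rightarrow>\<^sub>E box N. ?F p)"
    by (rule sum.mono_neutral_left) (auto simp: R_def finite_PiE split: prod.splits)
  also have "\<dots> = (\<Sum>x\<in>box N. ?f x * ferm_fps N k s (k - 1) x)"
  proof (rule sum_transfer_chain[where Z = "\<lambda>j. ferm_fps N k s (k - j)"])
    fix j x assume j: "j < k" "1 \<le> j"
    then have e: "k - j = Suc (k - Suc j)" "k - Suc (k - Suc j) = j" by simp_all
    show "ferm_fps N k s (k - j) x = (\<Sum>y\<in>box N. link s j x y * ferm_fps N k s (k - Suc j) y)"
      unfolding e(1) ferm_fps.simps e(2) ..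
  qed (use assms in auto)
  finally show ?thesis by (simp add: case_prod_unfold)
qed

text \<open>\<open>ferm_sum_eq\<close> at N = M, modulo X^d. The lattice side carries (q)_inf^(-5)
  and the three completing factors of \<open>ferm_sum\<close> give (q)_inf^(-3). The term l = 1
  stems from \<open>bosf\<close>, whose linear exponent has multiple 1; the terms l >= 2 stem from
  \<open>bos\<close>.\<close>

lemma ferm_limit:
  fixes d :: nat
  assumes "1 \<le> s" "s \<le> k"
  shows "\<exists>N0. \<forall>N\<ge>N0. agree d (\<Sum>(n, m)\<in>box N. inverse (pfin 1 1 n) * ferm_fps N k s (k - 1) (n, m))
    (inverse (pinf 1 1) ^ 2 * (\<Sum>l\<in>{1..s}. fps_X ^ (s - l) * tser (mac_exp (3 * k + 2) l) mac_coeff mac_index) :: 'a::field_char_0 fps)"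
proof -
  let ?P = "pinf 1 1 :: 'a fps"
  let ?K = "3 * k + 2"
  have PI: "?P * inverse ?P = 1"
    using pinf_nth_0[of 1 1, where 'a = 'a] by (intro inverse_mult_eq_1') simp
  interpret qfield "fls_X :: 'a fls" using qfield_fls_X[of 1, where 'a = 'a] by simp
  have K: "0 < l" "2 * l < ?K" if "l \<in> {1..s}" for l using that assms by auto
  define good where "good = (\<lambda>l C. \<forall>B (G :: int \<Rightarrow> int \<Rightarrow> int \<Rightarrow> 'a fps) E. int C \<le> B \<longrightarrow>
    (\<forall>a b c. \<bar>a\<bar> \<le> int C \<longrightarrow> \<bar>b\<bar> \<le> int C \<longrightarrow> \<bar>c\<bar> \<le> int C \<longrightarrow> agree d (G a b c) E) \<longrightarrow>
    agree d (bos_fps (int ?K) (int l) G B) (tser (mac_exp (int ?K) (int l)) mac_coeff mac_index * E))"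
  have "\<forall>l\<in>{1..s}. \<exists>C. good l C"
    unfolding good_def using bos_fps_agree[OF K, of _ d, where 'a = 'a] by (intro ballI)
  from bchoice[OF this] obtain C where good: "\<forall>l\<in>{1..s}. good l (C l)" ..
  have C: "agree d (bos_fps (int ?K) (int l) G B) (tser (mac_exp (int ?K) (int l)) mac_coeff mac_index * E)"
    if "l \<in> {1..s}" "int (C l) \<le> B"
      "\<And>a b c. \<bar>a\<bar> \<le> int (C l) \<Longrightarrow> \<bar>b\<bar> \<le> int (C l) \<Longrightarrow> \<bar>c\<bar> \<le> int (C l) \<Longrightarrow> agree d (G a b c) E"
    for l B and G :: "int \<Rightarrow> int \<Rightarrow> int \<Rightarrow> 'a fps" and E
    using bspec[OF good that(1), unfolded good_def, rule_format, OF that(2,3)] .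
  define M where "M = (\<Sum>l\<in>{1..s}. C l)"
  have CM: "C l \<le> M" if "l \<in> {1..s}" for l
    unfolding M_def by (rule member_le_sum[OF that]) auto
  show ?thesis
  proof (intro exI[of _ "3 * d + M + 2"] allI impI)
    \<comment> \<open>The part 3d leaves N - n >= d whenever n < 2d; M + d + 1 is enough for the
      kernel, whose arguments are shifted by at most 1.\<close>
    fix N assume N: "3 * d + M + 2 \<le> N"
    \<comment> \<open>The smallest cut-off that \<open>ferm_sum_eq\<close> admits for equal N and
      M.\<close>
    define B where "B = 2 * int N + 1"
    define T where "T = (\<lambda>l. tser (mac_exp ?K l) mac_coeff mac_index :: 'a fps)"
    define \<Phi> where "\<Phi> = (\<Sum>(n, m)\<in>box N. iqf 1 (int N - int n) * iqf 1 (int N)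
      * iqf 1 (int N + int m - int n + lin (k - s) (k - 1)) * (iqf 1 (int n) * ferm_fps N k s (k - 1) (n, m)) :: 'a fps)"
    define \<Psi> :: "'a fps" where "\<Psi> = (\<Sum>l\<in>{2..s}. fps_X ^ (s - l) * bos_fps ?K l (\<lambda>a b c. ker3_fps N N (a - 1) b (c + 1)) B)
      + fps_X ^ (s - 1) * bos_fps ?K 1 (ker3_fps (int N + 1) (int N + 1)) B"
    have "fps_to_fls \<Phi> = ferm_sum (k - s) (k - 1) (int N) (int N)"
      unfolding \<Phi>_def fps_to_fls_sum ferm_sum_box[of "int N", simplified] sum_box_int
    proof (rule sum.cong[OF refl])
      fix x assume "x \<in> box N"
      then obtain n m where x: "x = (n, m)" "n \<le> N" by (auto simp: box_def)
      have "k - 1 < k" using assms by simp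
      from ferm_fps_fls[OF assms this x(2), of m, where 'a = 'a]
      show "fps_to_fls (case x of (n, m) \<Rightarrow> iqf 1 (int N - int n) * iqf 1 (int N)
      * iqf 1 (int N + int m - int n + lin (k - s) (k - 1)) * (iqf 1 (int n) * ferm_fps N k s (k - 1) (n, m)))
       = (case x of (n, m) \<Rightarrow> iq (int N - int n) * iq (int N) * iq (int N + int m - int n + lin (k - s) (k - 1))
        * (iq (int n) * ferm (k - s) (k - 1) (int n) (int m)))"
        unfolding x prod.case by (simp only: fls_times_fps_to_fls iq_fls_X)
    qed
    also have "\<dots> = (\<Sum>l\<in>{2..k - 1 - (k - s) + 1}. fls_X ^ (k - 1 - (k - s) + 1 - l) * bos B (3 * int (k - 1) + 5) (int l) N N)
      + fls_X ^ (k - 1 - (k - s)) * bosf B (3 * int (k - 1) + 5) (int N + 1) (int N + 1)"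
      by (rule ferm_sum_eq) (auto simp: B_def)
    also have "k - 1 - (k - s) + 1 = s" using assms by simp
    also have "k - 1 - (k - s) = s - 1" using assms by simp
    also have "3 * int (k - 1) + 5 = int ?K" using assms by simp
    also have "(\<Sum>l\<in>{2..s}. fls_X ^ (s - l) * bos B (int ?K) (int l) N N) + fls_X ^ (s - 1) * bosf B (int ?K) (int N + 1) (int N + 1)
      = fps_to_fls \<Psi>"
      unfolding \<Psi>_def fps_to_fls_plus fps_to_fls_sum
    proof (intro arg_cong2[of _ _ _ _ "(+)"] sum.cong refl)
      fix l assume "l \<in> {2..s}"
      then have l: "0 < l" "2 * l < ?K" using assms by auto
      show "fls_X ^ (s - l) * bos B (int ?K) (int l) N N
        = fps_to_fls (fps_X ^ (s - l) * bos_fps ?K l (\<lambda>a b c. ker3_fps N N (a - 1) b (c + 1)) B)"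
        by (simp only: bos_fls_X[OF l] fls_times_fps_to_fls fps_to_fls_power fps_X_to_fls)
    next
      have "2 < ?K" using assms by simp
      from bosf_fls_X[OF this, of B "int N + 1" "int N + 1", where 'a = 'a]
      show "fls_X ^ (s - 1) * bosf B (int ?K) (int N + 1) (int N + 1)
        = fps_to_fls (fps_X ^ (s - 1) * bos_fps ?K 1 (ker3_fps (int N + 1) (int N + 1)) B)"
        by (simp only: fls_times_fps_to_fls fps_to_fls_power fps_X_to_fls)
    qed
    finally have \<Phi>\<Psi>: "\<Phi> = \<Psi>" by simp
    have bosT: "agree d (bos_fps ?K l (\<lambda>a b c. ker3_fps N N (a - 1) b (c + 1)) B) (T l * inverse ?P ^ 5)"
      if l: "l \<in> {2..s}" for l
      unfolding T_def
    proof (rule C)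
      show l': "l \<in> {1..s}" using l by auto
      show "int (C l) \<le> B" using CM[OF l'] N by (simp add: B_def)
      fix a b c :: int assume "\<bar>a\<bar> \<le> int (C l)" "\<bar>b\<bar> \<le> int (C l)" "\<bar>c\<bar> \<le> int (C l)"
      then show "agree d (ker3_fps N N (a - 1) b (c + 1)) (inverse ?P ^ 5)"
        using CM[OF l'] N by (intro ker3_fps_agree) linarith+
    qed
    have s1: "1 \<in> {1..s}" using assms by simp
    have bosfT: "agree d (bos_fps ?K 1 (ker3_fps (int N + 1) (int N + 1)) B) (T 1 * inverse ?P ^ 5)"
    proof -
      have "int (C 1) \<le> B" using CM[OF s1] N by (simp add: B_def)
      moreover have "agree d (ker3_fps (int N + 1) (int N + 1) a b c) (inverse ?P ^ 5)"
        if "\<bar>a\<bar> \<le> int (C 1)" "\<bar>b\<bar> \<le> int (C 1)" "\<bar>c\<bar> \<le> int (C 1)" for a b c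
        using CM[OF s1] N that by (intro ker3_fps_agree) linarith+
      ultimately show ?thesis
        using C[OF s1, of B "ker3_fps (int N + 1) (int N + 1)" "inverse ?P ^ 5"] by (simp only: T_def of_nat_1)
    qed
    have "agree d \<Psi> ((\<Sum>l\<in>{2..s}. fps_X ^ (s - l) * (T l * inverse ?P ^ 5)) + fps_X ^ (s - 1) * (T 1 * inverse ?P ^ 5))"
      unfolding \<Psi>_def by (intro agree_add agree_sum agree_mult agree_refl bosT bosfT)
    also have "(\<Sum>l\<in>{2..s}. fps_X ^ (s - l) * (T l * inverse ?P ^ 5)) + fps_X ^ (s - 1) * (T 1 * inverse ?P ^ 5)
      = (\<Sum>l\<in>{1..s}. fps_X ^ (s - l) * T l) * inverse ?P ^ 5"
    proof -
      have "{1..s} = insert 1 {2..s}" using assms by auto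
      then show ?thesis by (simp add: sum_distrib_right distrib_right mult.assoc add.commute)
    qed
    finally have bosside: "agree d \<Phi> ((\<Sum>l\<in>{1..s}. fps_X ^ (s - l) * T l) * inverse ?P ^ 5)"
      by (simp only: \<Phi>\<Psi>)
    let ?S = "\<Sum>(n, m)\<in>box N. inverse (pfin 1 1 n) * ferm_fps N k s (k - 1) (n, m) :: 'a fps"
    have "agree d \<Phi> (\<Sum>x\<in>box N. inverse ?P ^ 3 * (case x of (n, m) \<Rightarrow> inverse (pfin 1 1 n) * ferm_fps N k s (k - 1) (n, m)))"
      unfolding \<Phi>_def
    proof (rule agree_sum)
      fix x :: "nat \<times> nat" assume "x \<in> box N"
      obtain n m where x: "x = (n, m)" by (cases x)
      let ?Z = "ferm_fps N k s (k - 1) (n, m) :: 'a fps"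
      have "agree d (iqf 1 (int N - int n) * iqf 1 (int N) * iqf 1 (int N + int m - int n + lin (k - s) (k - 1)) * (iqf 1 (int n) * ?Z))
        (inverse ?P ^ 3 * (inverse (pfin 1 1 n) * ?Z))"
      \<comment> \<open>For n >= 2d the argument N - n may be too small for
        \<open>agree_iqf\<close>, but then the summand is 0 modulo X^d anyway.\<close>
      proof (cases "2 * d \<le> n")
        case True
        then have "agree d ?Z 0" by (intro agree_0_dvd X_power_dvd_ferm_fps)
        then have z: "agree d (f * ?Z) 0" for f
          using agree_mult[OF agree_refl[of d f], of ?Z 0] by simp
        show ?thesis
          unfolding mult.assoc[symmetric] by (rule agree_trans[OF z agree_sym[OF z]])
      next
        case False
        have i: "iqf 1 (int n) = inverse (pfin 1 1 n :: 'a fps)" by (simp add: iqf_def)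
        have "lin (k - s) (k - 1) \<ge> 0" by (simp add: lin_def)
        then have "agree d (iqf 1 (int N - int n) * iqf 1 (int N) * iqf 1 (int N + int m - int n + lin (k - s) (k - 1)) * (iqf 1 (int n) * ?Z))
          (inverse ?P * inverse ?P * inverse ?P * (iqf 1 (int n) * ?Z))"
          by (intro agree_mult agree_refl agree_iqf) (use False N in auto)
        then show ?thesis unfolding i power3_eq_cube by (simp only: mult.assoc)
      qed
      then show "agree d (case x of (n, m) \<Rightarrow> iqf 1 (int N - int n) * iqf 1 (int N)
         * iqf 1 (int N + int m - int n + lin (k - s) (k - 1)) * (iqf 1 (int n) * ferm_fps N k s (k - 1) (n, m)))
        (inverse ?P ^ 3 * (case x of (n, m) \<Rightarrow> inverse (pfin 1 1 n) * ferm_fps N k s (k - 1) (n, m)))"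
        by (simp add: x)
    qed
    also have "(\<Sum>x\<in>box N. inverse ?P ^ 3 * (case x of (n, m) \<Rightarrow> inverse (pfin 1 1 n) * ferm_fps N k s (k - 1) (n, m))) = inverse ?P ^ 3 * ?S"
      by (rule sum_distrib_left[symmetric])
    finally have fs: "agree d (?P ^ 3 * (inverse ?P ^ 3 * ?S)) (?P ^ 3 * ((\<Sum>l\<in>{1..s}. fps_X ^ (s - l) * T l) * inverse ?P ^ 5))"
      using bosside by (intro agree_mult[OF agree_refl]) (rule agree_trans[OF agree_sym])
    have P3: "?P ^ 3 * inverse ?P ^ 3 = 1"
      by (simp only: power_mult_distrib[symmetric] PI power_one)
    have e1: "?P ^ 3 * (inverse ?P ^ 3 * ?S) = ?S"
      by (simp only: mult.assoc[symmetric] P3 mult_1_left)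
    have e2: "?P ^ 3 * ((\<Sum>l\<in>{1..s}. fps_X ^ (s - l) * T l) * inverse ?P ^ 5)
      = inverse ?P ^ 2 * (\<Sum>l\<in>{1..s}. fps_X ^ (s - l) * T l)"
    proof -
      have "inverse ?P ^ 5 = inverse ?P ^ 3 * inverse ?P ^ 2"
        by (simp only: power_add[symmetric]) simp
      then have "?P ^ 3 * ((\<Sum>l\<in>{1..s}. fps_X ^ (s - l) * T l) * inverse ?P ^ 5)
        = (?P ^ 3 * inverse ?P ^ 3) * (inverse ?P ^ 2 * (\<Sum>l\<in>{1..s}. fps_X ^ (s - l) * T l))"
        by (simp only: mult_ac)
      then show ?thesis by (simp only: P3 mult_1_left)
    qed
    show "agree d ?S (inverse ?P ^ 2 * (\<Sum>l\<in>{1..s}. fps_X ^ (s - l) * tser (mac_exp ?K l) mac_coeff mac_index))"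
      using fs unfolding e1 e2 unfolding T_def .
  qed
qed

lemma theta_X_power:
  assumes "i \<le> K"
  shows "theta (fps_X ^ i) (fps_X ^ K) = (pinf K i * pinf K (K - i) :: 'a::field fps)"
proof -
  have "(fps_X ^ K :: 'a fps) = fps_X ^ (K - i) * fps_X ^ i"
    using assms by (simp add: power_add[symmetric])
  then have "(fps_X ^ K :: 'a fps) / fps_X ^ i = fps_X ^ (K - i)"
    by (simp only:) (rule nonzero_mult_div_cancel_right, simp)
  then show ?thesis by (simp add: theta_def)
qed

text \<open>A coefficient t receives nonzero contributions only from indices below 2(t+1), hence
  from inside a finite box. Convergence is therefore checked coefficient by coefficient, on a box
  large enough for \<open>ferm_limit\<close> as well.\<close>

lemma summand_has_sum:
  assumes "1 \<le> s" "s \<le> k"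
  shows "(summand k s has_sum (inverse (pinf 1 1) ^ 2
       * (\<Sum>l\<in>{1..s}. fps_X ^ (s - l) * tser (mac_exp (3 * k + 2) l) mac_coeff mac_index) :: 'a::field_char_0 fps))
      (({1..k} \<rightarrow>\<^sub>E (UNIV :: nat set)) \<times> ({1..k-1} \<rightarrow>\<^sub>E (UNIV :: nat set)))"
    (is "(_ has_sum ?R) ?I")
proof -
  let ?S = "\<lambda>N. ({1..k} \<rightarrow>\<^sub>E {0..N}) \<times> ({1..k-1} \<rightarrow>\<^sub>E {0..2 * N + 1 :: nat})"
  have fin: "finite (?S N)" for N
    by (intro finite_cartesian_product finite_PiE) auto
  have sub: "{x\<in>?I. fps_nth (summand k s x :: 'a fps) t \<noteq> 0} \<subseteq> ?S N" if N: "2 * Suc t \<le> N" for t N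
  proof
    fix x assume x: "x \<in> {x\<in>?I. fps_nth (summand k s x :: 'a fps) t \<noteq> 0}"
    then obtain n m where nm: "x = (n, m)" "n \<in> {1..k} \<rightarrow>\<^sub>E UNIV" "m \<in> {1..k-1} \<rightarrow>\<^sub>E UNIV"
      and nz: "fps_nth (summand k s (n, m) :: 'a fps) t \<noteq> 0" by auto
    have small: "n i < 2 * Suc t \<and> (i < k \<longrightarrow> m i < 2 * Suc t)" if "i \<in> {1..k}" for i
    proof (rule ccontr)
      assume "\<not> ?thesis"
      then have "2 * Suc t \<le> n i \<or> (i < k \<and> 2 * Suc t \<le> m i)" by linarith
      from summand_agree_0[where n = n and m = m and 'a = 'a, OF assms that this] nz show False
        by (simp add: agree_def)
    qed
    have "n i \<in> {0..N}" if "i \<in> {1..k}" for i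
      using small[OF that] N by auto
    moreover have "m i \<in> {0..2 * N + 1}" if "i \<in> {1..k-1}" for i
    proof -
      have "i \<in> {1..k}" "i < k" using that by auto
      with small[of i] N show ?thesis by auto
    qed
    ultimately show "x \<in> ?S N" using nm by (auto simp: PiE_iff)
  qed
  have ss: "?S N \<subseteq> ?I" for N by (auto simp: PiE_iff)
  show ?thesis
  proof (rule has_sum_fpsI)
    fix t
    show "finite {x\<in>?I. fps_nth (summand k s x :: 'a fps) t \<noteq> 0}"
      by (rule finite_subset[OF sub[OF order_refl] fin])
    obtain N0 where N0: "\<And>N. N \<ge> N0 \<Longrightarrow> agree (Suc t) (\<Sum>(n, m)\<in>box N. inverse (pfin 1 1 n) * ferm_fps N k s (k - 1) (n, m)) ?R"
      using ferm_limit[OF assms, of "Suc t", where 'a = 'a] by blast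
    define N where "N = N0 + 2 * Suc t"
    have "(\<Sum>x | x \<in> ?I \<and> fps_nth (summand k s x :: 'a fps) t \<noteq> 0. fps_nth (summand k s x :: 'a fps) t) = (\<Sum>x\<in>?S N. fps_nth (summand k s x :: 'a fps) t)"
      by (rule sum.mono_neutral_left[OF fin sub]) (use ss[of N] in \<open>auto simp: N_def\<close>)
    also have "\<dots> = fps_nth (\<Sum>x\<in>?S N. summand k s x) t"
      by (simp add: fps_sum_nth)
    also have "\<dots> = fps_nth ?R t"
      using N0[of N] unfolding sum_summand_box[OF assms] by (simp add: agree_def N_def)
    finally show "fps_nth ?R t = (\<Sum>x | x \<in> ?I \<and> fps_nth (summand k s x :: 'a fps) t \<noteq> 0. fps_nth (summand k s x :: 'a fps) t)" ..
  qed
qed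

theorem theorem2p4:
  fixes k s :: nat and q :: "rat fps"
  assumes "1 \<le> s" and "s \<le> k"
  defines "q \<equiv> fps_X"
  shows
    "((\<lambda>(n, m).
        q ^ ((n k)\<^sup>2 + (\<Sum>i=s..k. n i) + (\<Sum>i=s..k-1. m i)) / qpoch q q (n 1) *
        (\<Prod>i=1..k-1.
           q ^ nat ((int (n i))\<^sup>2 - int (n i) * int (m i) + (int (m i))\<^sup>2) *
           qbinom q (int (n i)) (int (n (i + 1))) *
           qbinom q
             (int (n i) - int (n (i + 1)) + int ((m(k := 2 * n k)) (i + 1)) + of_bool (i = s - 1))
             (int (m i))))
      has_sum
        (qpoch_inf (q ^ (3*k+2)) (q ^ (3*k+2)))\<^sup>2 / (qpoch_inf q q)\<^sup>2 *
        (\<Sum>i=1..s. q ^ (s - i) * thetas [q ^ i, q ^ i, q ^ (2*i)] (q ^ (3*k+2))))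
      (({1..k} \<rightarrow>\<^sub>E (UNIV :: nat set)) \<times> ({1..k-1} \<rightarrow>\<^sub>E (UNIV :: nat set)))"
proof -
  let ?K = "3 * k + 2"
  let ?P = "pinf 1 1 :: rat fps"
  have "fps_nth ?P 0 = 1" by (rule pinf_nth_0) auto
  then have nz: "fps_nth (?P\<^sup>2) 0 \<noteq> 0" by (simp add: fps_power_zeroth)
  have th: "tser (mac_exp ?K i) mac_coeff mac_index
      = (pinf ?K ?K)\<^sup>2 * (thetas [fps_X ^ i, fps_X ^ i, fps_X ^ (2 * i)] (fps_X ^ ?K) :: rat fps)"
    if "i \<in> {1..s}" for i
  proof -
    have i: "0 < i" "2 * i < ?K" and le: "i \<le> ?K" "2 * i \<le> ?K" using that assms by auto
    show ?thesis
      unfolding macdonald(2)[OF i] thetas_def list.map prod_list.Cons prod_list.Nil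
        theta_X_power[OF le(1)] theta_X_power[OF le(2)]
      by (simp only: power2_eq_square mult_ac mult_1_right mult_1_left)
  qed
  have "(\<Sum>l\<in>{1..s}. fps_X ^ (s - l) * tser (mac_exp ?K l) mac_coeff mac_index)
    = (\<Sum>l\<in>{1..s}. (pinf ?K ?K)\<^sup>2 * (fps_X ^ (s - l) * (thetas [fps_X ^ l, fps_X ^ l, fps_X ^ (2 * l)] (fps_X ^ ?K) :: rat fps)))"
  proof (rule sum.cong[OF refl])
    fix l assume l: "l \<in> {1..s}"
    show "fps_X ^ (s - l) * tser (mac_exp ?K l) mac_coeff mac_index
      = (pinf ?K ?K)\<^sup>2 * (fps_X ^ (s - l) * (thetas [fps_X ^ l, fps_X ^ l, fps_X ^ (2 * l)] (fps_X ^ ?K) :: rat fps))"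
      unfolding th[OF l] by (rule mult.left_commute)
  qed
  then have "inverse ?P ^ 2 * (\<Sum>l\<in>{1..s}. fps_X ^ (s - l) * tser (mac_exp ?K l) mac_coeff mac_index)
    = inverse (?P\<^sup>2) * (\<Sum>l\<in>{1..s}. (pinf ?K ?K)\<^sup>2 * (fps_X ^ (s - l) * thetas [fps_X ^ l, fps_X ^ l, fps_X ^ (2 * l)] (fps_X ^ ?K)))"
    by (simp only: fps_inverse_power)
  also have "\<dots> = (pinf ?K ?K)\<^sup>2 / ?P\<^sup>2 * (\<Sum>l\<in>{1..s}. fps_X ^ (s - l) * thetas [fps_X ^ l, fps_X ^ l, fps_X ^ (2 * l)] (fps_X ^ ?K))"
    unfolding fps_divide_unit[OF nz] sum_distrib_left[symmetric] by (simp only: mult_ac)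
  finally show ?thesis
    using summand_has_sum[OF assms(1,2), where 'a = rat] unfolding summand_def q_def by (simp only: power_one_right)
qed

end
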